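(* Let $n\ge 3$, $k\ge 1$, and let $P_1,\dots,P_k$ be hyperbolic $n$-gons with fixed total perimeter $\sum_{i=1}^k \mathrm{Peri}(P_i)=T$, satisfying $$\mathrm{Peri}(P_i) > 2n\,\cosh^{-1}\!\sqrt{1+\sin(\pi/n)}\qquad\text{for } i=1,\dots,k.$$ Then $$\sum_{i=1}^k \mathrm{Area}(P_i)\;\leq\; k(n-2)\pi - 2nk\,\sin^{-1}\!\left(\frac{\cos(\pi/n)}{\cosh\!\left(T/(2nk)\right)}\right),$$ with equality if and only if all $P_i$ are isometric to a regular polygon of perimeter $T/k$.
   Context: A hyperbolic $n$-gon is a polygon with $n$ geodesic sides in the hyperbolic plane of constant curvature $-1$; all of its vertices are assumed to lie in the hyperbolic plane (no ideal vertices). $\mathrm{Area}(P)$ is the hyperbolic area of $P$ and $\mathrm{Peri}(P)$ is the sum of the hyperbolic lengths of its sides. A polygon is regular if all its sides are equal and all its interior angles are equal. Here $\cosh^{-1}$ takes values in $[0,\infty)$. *)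

theory Defs
  imports "HOL-Analysis.Analysis"
begin

text \<open>
  The hyperbolic plane of curvature \<open>-1\<close> is the upper half-plane with the Riemannian metric
  \<open>(dx\<^sup>2 + dy\<^sup>2) / y\<^sup>2\<close>; the distance and the area element below are those of this metric.
\<close>

definition hyp_plane :: "complex set" where
  "hyp_plane = {z. Im z > 0}"

definition hyp_dist :: "complex \<Rightarrow> complex \<Rightarrow> real" where
  "hyp_dist z w = arcosh (1 + (cmod (z - w))\<^sup>2 / (2 * Im z * Im w))"

definition hyp_area :: "complex set \<Rightarrow> real" where
  "hyp_area S = (LINT z:S|lborel. 1 / (Im z)\<^sup>2)"

text \<open>
  Two points of the hyperbolic plane are joined by exactly one geodesic segment, which consists
  of the points where the triangle inequality is an equality.
\<close>

definition hyp_segment :: "complex \<Rightarrow> complex \<Rightarrow> complex set" where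
  "hyp_segment a b = {z \<in> hyp_plane. hyp_dist a z + hyp_dist z b = hyp_dist a b}"

text \<open>
  A polygon is given by the list of its vertices in cyclic order; side \<open>i\<close> joins vertex \<open>i\<close> to
  its cyclic successor.
\<close>

definition next_vertex :: "complex list \<Rightarrow> nat \<Rightarrow> complex" where
  "next_vertex vs i = vs ! (Suc i mod length vs)"

definition poly_side :: "complex list \<Rightarrow> nat \<Rightarrow> complex set" where
  "poly_side vs i = hyp_segment (vs ! i) (next_vertex vs i)"

definition side_length :: "complex list \<Rightarrow> nat \<Rightarrow> real" where
  "side_length vs i = hyp_dist (vs ! i) (next_vertex vs i)"

text \<open>
  The intersection condition makes the closed polygonal curve simple: sides that are cyclic
  neighbours share only their common vertex, all other pairs of sides are disjoint.
  The polygon need not be convex, and an angle \<open>\<pi>\<close> at a vertex is allowed.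
\<close>

definition hyp_polygon :: "nat \<Rightarrow> complex list \<Rightarrow> bool" where
  "hyp_polygon n vs \<longleftrightarrow>
     3 \<le> n \<and> length vs = n \<and> distinct vs \<and> set vs \<subseteq> hyp_plane \<and>
     (\<forall>i<n. \<forall>j<n. i \<noteq> j \<longrightarrow>
        poly_side vs i \<inter> poly_side vs j =
          {vs ! i, next_vertex vs i} \<inter> {vs ! j, next_vertex vs j})"

definition poly_boundary :: "complex list \<Rightarrow> complex set" where
  "poly_boundary vs = (\<Union>i<length vs. poly_side vs i)"

definition poly_region :: "complex list \<Rightarrow> complex set" where
  "poly_region vs = poly_boundary vs \<union> inside (poly_boundary vs)"

definition Area :: "complex list \<Rightarrow> real" where
  "Area vs = hyp_area (poly_region vs)"

definition Peri :: "complex list \<Rightarrow> real" where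
  "Peri vs = (\<Sum>i<length vs. side_length vs i)"

text \<open>
  The half-plane model is conformal, so the interior angle at a vertex is the Euclidean size of
  the set of directions pointing into the polygon. It takes values in \<open>(0, 2\<pi>)\<close>, exceeding \<open>\<pi>\<close>
  at a reflex vertex. Rays are Euclidean rather than geodesic, which matters at most for
  the two directions tangent to the sides.
\<close>

definition interior_angle :: "complex list \<Rightarrow> nat \<Rightarrow> real" where
  "interior_angle vs i =
     measure lebesgue
       {t \<in> {0..<2 * pi}. \<forall>\<^sub>F r in at_right 0. vs ! i + of_real r * cis t \<in> poly_region vs}"

definition regular_polygon :: "nat \<Rightarrow> complex list \<Rightarrow> bool" where
  "regular_polygon n vs \<longleftrightarrow>
     hyp_polygon n vs \<and>
     (\<forall>i<n. \<forall>j<n. side_length vs i = side_length vs j) \<and>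
     (\<forall>i<n. \<forall>j<n. interior_angle vs i = interior_angle vs j)"

definition hyp_isometry :: "(complex \<Rightarrow> complex) \<Rightarrow> bool" where
  "hyp_isometry f \<longleftrightarrow>
     bij_betw f hyp_plane hyp_plane \<and>
     (\<forall>z\<in>hyp_plane. \<forall>w\<in>hyp_plane. hyp_dist (f z) (f w) = hyp_dist z w)"

definition isometric_polygons :: "complex list \<Rightarrow> complex list \<Rightarrow> bool" where
  "isometric_polygons vs ws \<longleftrightarrow>
     (\<exists>f. hyp_isometry f \<and> f ` poly_region vs = poly_region ws)"

end

theory Submission
  imports Defs "HOL-Complex_Analysis.Cauchy_Integral_Formula" "HOL-Complex_Analysis.Winding_Numbers"
begin

text \<open>
  Integrating \<open>dx / y\<close> along the geodesic from \<open>z\<close> to \<open>w\<close> gives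
  \<open>2 arctan ((Re w - Re z) / (Im z + Im w))\<close>, so the area of a simple polygon is, up to sign, the sum of
  these terms over its sides. This sum makes sense for every closed tuple of \<open>n\<close> points. On tuples of
  bounded perimeter it attains its maximum, and a maximum with nonzero sides satisfies a Lagrange
  condition. In the disc centred at a vertex \<open>v\<close>, where the two neighbours of \<open>v\<close> become \<open>P\<close> and \<open>Q\<close>,
  the gradients of area and perimeter with respect to \<open>v\<close> are \<open>Q - P\<close> and
  \<open>- \<i> (Q / |Q| + P / |P|)\<close>. If these are proportional, then \<open>|P| = |Q|\<close> and \<open>P / Q\<close> depends only on
  the side length and the multiplier. All sides and all angles of a maximal tuple are therefore equal,
  a Moebius transformation permutes its vertices cyclically, and the fixed point of that
  transformation is a centre. The bound on the perimeters lies in the range where the area of the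
  regular \<open>n\<close>-gon is a strictly concave function of its perimeter, and Jensen's inequality gives the
  theorem.
\<close>

section \<open>The disc centred at a point of the half-plane\<close>

text \<open>The competitors are closed tuples and not simple polygons, because a limit of simple
  polygons may cross itself or lose sides; tuples of bounded length with a fixed base vertex form a
  compact set on which the signed sum stays continuous. Two kinds of spurious extremals come with
  this choice. A side of length zero makes the length non-differentiable; it is removed by splitting
  a nonzero side next to it, unless all points coincide. Star-shaped tuples, running several times
  round the centre, have equal sides and angles too and lose only by a comparison of areas. The link
  to the area as an integral over the inside of a Jordan curve is the winding number, computed once
  as a sum of angles seen from a point and once as the signed number of sides below that point. The
  threshold on the perimeters comes from the half side x = Peri/(2n): with k = cos(pi/n), the
  function arcsin(k / cosh x) turns from concave to convex where cosh(x)^2 = 1 + sin(pi/n).\<close>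

lemma sum_Suc_cyclic:
  fixes f :: "nat \<Rightarrow> 'a :: ab_group_add"
  assumes "f n = f 0"
  shows "(\<Sum>i<n. f (Suc i)) = (\<Sum>i<n. f i)"
proof -
  have "(\<Sum>i<n. f (Suc i) - f i) = f n - f 0" by (rule sum_lessThan_telescope)
  then show ?thesis using assms by (simp add: sum_subtractf)
qed

text \<open>The Cayley transform onto the unit disc with \<open>v\<close> at the centre: geodesics
  through \<open>v\<close> become diameters, and infinity goes to 1.\<close>

definition disc :: "complex \<Rightarrow> complex \<Rightarrow> complex" where
  "disc v z = (z - v) / (z - cnj v)"

definition undisc :: "complex \<Rightarrow> complex \<Rightarrow> complex" where
  "undisc v \<zeta> = (v - cnj v * \<zeta>) / (1 - \<zeta>)"

definition edge_area :: "complex \<Rightarrow> complex \<Rightarrow> real" where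
  "edge_area z w = 2 * arctan ((Re w - Re z) / (Im z + Im w))"

lemma hyp_plane_iff: "z \<in> hyp_plane \<longleftrightarrow> Im z > 0"
  by (simp add: hyp_plane_def)

lemma diff_cnj_nonzero:
  assumes "Im v > 0" "Im z > 0"
  shows "z - cnj v \<noteq> 0"
  using assms by (auto simp: complex_eq_iff)

lemma one_minus_disc_sq:
  assumes "Im v > 0" "Im z > 0"
  shows "1 - (cmod (disc v z))\<^sup>2 = 4 * Im v * Im z / (cmod (z - cnj v))\<^sup>2"
proof -
  have nz: "(cmod (z - cnj v))\<^sup>2 \<noteq> 0" using diff_cnj_nonzero[OF assms] by simp
  have "(cmod (z - cnj v))\<^sup>2 - (cmod (z - v))\<^sup>2 = 4 * Im v * Im z"
    unfolding cmod_power2 by (simp add: power2_eq_square algebra_simps)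
  then show ?thesis
    using nz by (simp add: disc_def norm_divide power_divide field_simps)
qed

lemma norm_disc_less_1:
  assumes "Im v > 0" "Im z > 0"
  shows "cmod (disc v z) < 1"
proof -
  have "(cmod (z - cnj v))\<^sup>2 > 0" using diff_cnj_nonzero[OF assms] by simp
  then have "1 - (cmod (disc v z))\<^sup>2 > 0"
    unfolding one_minus_disc_sq[OF assms] using assms by simp
  then have "(cmod (disc v z))\<^sup>2 < 1" by simp
  then show ?thesis by (metis abs_norm_cancel abs_square_less_1)
qed

lemma norm_disc_sq_less_1:
  assumes "Im v > 0" "Im z > 0"
  shows "(cmod (disc v z))\<^sup>2 < 1"
  using norm_disc_less_1[OF assms] by (simp add: power_less_one_iff)

lemma disc_self [simp]: "disc v v = 0"
  by (simp add: disc_def)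

lemma one_minus_nonzero: "cmod \<zeta> < 1 \<Longrightarrow> 1 - \<zeta> \<noteq> 0"
  by auto

lemma undisc_disc:
  assumes "Im v > 0" "Im z > 0"
  shows "undisc v (disc v z) = z"
proof -
  have a: "z - cnj v \<noteq> 0" using diff_cnj_nonzero[OF assms] .
  have b: "v - cnj v \<noteq> 0" using assms by (auto simp: complex_eq_iff)
  have c: "1 - disc v z = (v - cnj v) / (z - cnj v)"
    using a by (simp add: disc_def field_simps)
  have d: "v - cnj v * disc v z = z * (v - cnj v) / (z - cnj v)"
    using a by (simp add: disc_def field_simps)
  show ?thesis unfolding undisc_def c d using a b by simp
qed

lemma undisc_minus:
  assumes "1 - \<zeta> \<noteq> 0" "1 - \<omega> \<noteq> 0"
  shows "undisc v \<zeta> - undisc v \<omega> = (v - cnj v) * (\<zeta> - \<omega>) / ((1 - \<zeta>) * (1 - \<omega>))"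
  using assms by (simp add: undisc_def field_simps)

lemma undisc_minus_cnj:
  assumes "1 - \<zeta> \<noteq> 0" "1 - \<omega> \<noteq> 0"
  shows "undisc v \<omega> - cnj (undisc v \<zeta>) =
    (v - cnj v) * (1 - \<omega> * cnj \<zeta>) / ((1 - \<omega>) * (1 - cnj \<zeta>))"
proof -
  have "1 - cnj \<zeta> \<noteq> 0" using assms(1) by (metis complex_cnj_cnj complex_cnj_diff complex_cnj_one
        complex_cnj_zero)
  then show ?thesis using assms by (simp add: undisc_def field_simps)
qed

lemma undisc_0 [simp]: "undisc v 0 = v"
  by (simp add: undisc_def)

lemma Im_undisc:
  assumes "1 - \<zeta> \<noteq> 0"
  shows "Im (undisc v \<zeta>) = Im v * (1 - (cmod \<zeta>)\<^sup>2) / (cmod (1 - \<zeta>))\<^sup>2"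
proof -
  have "undisc v \<zeta> - cnj (undisc v \<zeta>) =
      (v - cnj v) * (1 - \<zeta> * cnj \<zeta>) / ((1 - \<zeta>) * cnj (1 - \<zeta>))"
    using undisc_minus_cnj[OF assms assms, of v] by simp
  also have "\<dots> = (2 * Im v * (1 - (cmod \<zeta>)\<^sup>2) / (cmod (1 - \<zeta>))\<^sup>2 :: real) * \<i>"
    unfolding complex_norm_square[symmetric] complex_diff_cnj
    by (simp add: complex_norm_square[symmetric])
  finally have "Im (undisc v \<zeta> - cnj (undisc v \<zeta>)) = 
     2 * Im v * (1 - (cmod \<zeta>)\<^sup>2) / (cmod (1 - \<zeta>))\<^sup>2"
    by (metis Im_complex_of_real Re_complex_of_real complex_i_mult_minus imaginary_unit.simps
        mult.commute Im_i_times)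
  then show ?thesis by simp
qed

lemma Im_undisc_pos:
  assumes "Im v > 0" "cmod \<zeta> < 1"
  shows "Im (undisc v \<zeta>) > 0"
proof -
  have "1 - \<zeta> \<noteq> 0" using assms by auto
  moreover have "(cmod \<zeta>)\<^sup>2 < 1" using assms by (simp add: power_less_one_iff)
  ultimately show ?thesis using assms by (simp add: Im_undisc)
qed

lemma disc_undisc:
  assumes "Im v > 0" "cmod \<zeta> < 1"
  shows "disc v (undisc v \<zeta>) = \<zeta>"
proof -
  have a: "1 - \<zeta> \<noteq> 0" using assms by auto
  have b: "v - cnj v \<noteq> 0" using assms by (auto simp: complex_eq_iff)
  have c: "undisc v \<zeta> - v = (v - cnj v) * \<zeta> / (1 - \<zeta>)" using a by (simp add: undisc_def field_simps)
  have d: "undisc v \<zeta> - cnj v = (v - cnj v) / (1 - \<zeta>)" using a by (simp add: undisc_def field_simps)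
  show ?thesis unfolding disc_def c d using a b by simp
qed

lemma disc_inj:
  assumes "Im v > 0" "Im z > 0" "Im w > 0" "disc v z = disc v w"
  shows "z = w"
  using undisc_disc assms by metis

lemma disc_eq_0_iff:
  assumes "Im v > 0" "Im z > 0"
  shows "disc v z = 0 \<longleftrightarrow> z = v"
  using assms disc_inj[of v z v] by auto

lemma dist_ratio_aux:
  fixes y A B C p q :: real
  assumes "y \<noteq> 0" "B \<noteq> 0" "C \<noteq> 0"
  shows "(2 * y * A / (B * C))\<^sup>2 / (2 * (y * p / B\<^sup>2) * (y * q / C\<^sup>2)) = 2 * A\<^sup>2 / (p * q)"
  using assms by (cases "p = 0"; cases "q = 0") (simp_all add: field_simps power2_eq_square)

lemma dist_ratio_undisc:
  assumes "Im v > 0" "cmod \<zeta> < 1" "cmod \<omega> < 1"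
  shows "(cmod (undisc v \<zeta> - undisc v \<omega>))\<^sup>2 / (2 * Im (undisc v \<zeta>) * Im (undisc v \<omega>)) =
    2 * (cmod (\<zeta> - \<omega>))\<^sup>2 / ((1 - (cmod \<zeta>)\<^sup>2) * (1 - (cmod \<omega>)\<^sup>2))"
proof -
  have a: "1 - \<zeta> \<noteq> 0" "1 - \<omega> \<noteq> 0" using assms by auto
  have "cmod (v - cnj v) = 2 * Im v"
    using assms by (simp add: complex_diff_cnj norm_mult)
  then have "cmod (undisc v \<zeta> - undisc v \<omega>) =
      2 * Im v * cmod (\<zeta> - \<omega>) / (cmod (1 - \<zeta>) * cmod (1 - \<omega>))"
    unfolding undisc_minus[OF a] by (simp add: norm_mult norm_divide)
  then show ?thesis
    unfolding Im_undisc[OF a(1)] Im_undisc[OF a(2)]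
    using dist_ratio_aux[of "Im v" "cmod (1 - \<zeta>)" "cmod (1 - \<omega>)"] a assms(1) by simp
qed

lemma hyp_dist_disc:
  assumes "Im v > 0" "Im z > 0" "Im w > 0"
  shows "hyp_dist z w = arcosh (1 + 2 * (cmod (disc v z - disc v w))\<^sup>2 /
     ((1 - (cmod (disc v z))\<^sup>2) * (1 - (cmod (disc v w))\<^sup>2)))"
  unfolding hyp_dist_def
  using dist_ratio_undisc[OF assms(1) norm_disc_less_1[OF assms(1,2)] norm_disc_less_1[OF assms(1,3)]]
  unfolding undisc_disc[OF assms(1,2)] undisc_disc[OF assms(1,3)] by simp

lemma cosh_hyp_dist:
  assumes "Im z > 0" "Im w > 0"
  shows "cosh (hyp_dist z w) = 1 + (cmod (z - w))\<^sup>2 / (2 * Im z * Im w)"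
  unfolding hyp_dist_def using assms by (subst cosh_arcosh_real) auto

lemma cosh_hyp_dist_disc:
  assumes "Im v > 0" "Im z > 0" "Im w > 0"
  shows "cosh (hyp_dist z w) = 1 + 2 * (cmod (disc v z - disc v w))\<^sup>2 /
     ((1 - (cmod (disc v z))\<^sup>2) * (1 - (cmod (disc v w))\<^sup>2))"
  unfolding cosh_hyp_dist[OF assms(2,3)]
  using dist_ratio_undisc[OF assms(1) norm_disc_less_1[OF assms(1,2)] norm_disc_less_1[OF assms(1,3)]]
  unfolding undisc_disc[OF assms(1,2)] undisc_disc[OF assms(1,3)] by simp

lemma hyp_dist_nonneg: "Im z > 0 \<Longrightarrow> Im w > 0 \<Longrightarrow> hyp_dist z w \<ge> 0"
  unfolding hyp_dist_def by (rule arcosh_nonneg_real) auto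

lemma hyp_dist_sym: "hyp_dist z w = hyp_dist w z"
  by (simp add: hyp_dist_def norm_minus_commute mult.commute mult.left_commute)

lemma hyp_dist_self [simp]: "hyp_dist z z = 0"
  by (simp add: hyp_dist_def)

lemma hyp_dist_eq_0_iff: "Im z > 0 \<Longrightarrow> Im w > 0 \<Longrightarrow> hyp_dist z w = 0 \<longleftrightarrow> z = w"
  unfolding hyp_dist_def by (subst arcosh_eq_0_iff_real) auto

lemma hyp_dist_pos: "Im z > 0 \<Longrightarrow> Im w > 0 \<Longrightarrow> z \<noteq> w \<Longrightarrow> hyp_dist z w > 0"
  using hyp_dist_nonneg[of z w] hyp_dist_eq_0_iff[of z w] by linarith

lemma hyp_dist_eq_iff_cosh:
  assumes "Im z > 0" "Im w > 0" "Im z' > 0" "Im w' > 0"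
  shows "hyp_dist z w = hyp_dist z' w' \<longleftrightarrow> cosh (hyp_dist z w) = cosh (hyp_dist z' w')"
  using hyp_dist_nonneg assms by auto

lemma sinh_sq_aux:
  fixes a :: real
  assumes "a < 1"
  shows "(1 + a)\<^sup>2 / (1 - a)\<^sup>2 = 4 * a / (1 - a)\<^sup>2 + 1"
  using assms by (simp add: divide_simps) (simp add: power2_eq_square algebra_simps)

lemma cosh_hyp_dist_radius:
  assumes "Im v > 0" "Im z > 0"
  shows "cosh (hyp_dist v z) = (1 + (cmod (disc v z))\<^sup>2) / (1 - (cmod (disc v z))\<^sup>2)"
    and "sinh (hyp_dist v z) = 2 * cmod (disc v z) / (1 - (cmod (disc v z))\<^sup>2)"
proof -
  let ?r = "cmod (disc v z)"
  have r: "?r\<^sup>2 < 1" using norm_disc_sq_less_1[OF assms] .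
  show c: "cosh (hyp_dist v z) = (1 + ?r\<^sup>2) / (1 - ?r\<^sup>2)"
    using cosh_hyp_dist_disc[OF assms(1) assms(1,2)] r by (simp add: field_simps)
  have "(sinh (hyp_dist v z))\<^sup>2 = (1 + ?r\<^sup>2)\<^sup>2 / (1 - ?r\<^sup>2)\<^sup>2 - 1"
    using cosh_square_eq[of "hyp_dist v z"] unfolding c power_divide by linarith
  also have "\<dots> = (2 * ?r / (1 - ?r\<^sup>2))\<^sup>2"
    unfolding sinh_sq_aux[OF r] power_divide power_mult_distrib by simp
  finally have e: "(sinh (hyp_dist v z))\<^sup>2 = (2 * ?r / (1 - ?r\<^sup>2))\<^sup>2" .
  show "sinh (hyp_dist v z) = 2 * ?r / (1 - ?r\<^sup>2)"
  proof (rule power2_eq_imp_eq[OF e])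
    show "0 \<le> sinh (hyp_dist v z)" using hyp_dist_nonneg[OF assms] by simp
    show "0 \<le> 2 * ?r / (1 - ?r\<^sup>2)" using r by (intro divide_nonneg_pos) auto
  qed
qed

lemma hyp_dist_le_iff_radius:
  assumes "Im v > 0" "Im z > 0" "Im w > 0"
  shows "hyp_dist v z \<le> hyp_dist v w \<longleftrightarrow> cmod (disc v z) \<le> cmod (disc v w)"
proof -
  let ?r = "(cmod (disc v z))\<^sup>2" and ?s = "(cmod (disc v w))\<^sup>2"
  have r: "?r < 1" "?s < 1" using norm_disc_sq_less_1 assms by auto
  have "hyp_dist v z \<le> hyp_dist v w \<longleftrightarrow> cosh (hyp_dist v z) \<le> cosh (hyp_dist v w)"
    using hyp_dist_nonneg assms by (simp add: cosh_real_nonneg_le_iff)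
  also have "\<dots> \<longleftrightarrow> ?r \<le> ?s"
    using r assms by (simp add: cosh_hyp_dist_radius field_simps)
  also have "\<dots> \<longleftrightarrow> cmod (disc v z) \<le> cmod (disc v w)" by simp
  finally show ?thesis .
qed

lemma hyp_dist_eq_iff_radius:
  assumes "Im v > 0" "Im z > 0" "Im v' > 0" "Im z' > 0"
  shows "hyp_dist v z = hyp_dist v' z' \<longleftrightarrow> cmod (disc v z) = cmod (disc v' z')"
proof -
  let ?r = "(cmod (disc v z))\<^sup>2" and ?s = "(cmod (disc v' z'))\<^sup>2"
  have r: "?r < 1" "?s < 1" using norm_disc_sq_less_1 assms by auto
  have "hyp_dist v z = hyp_dist v' z' \<longleftrightarrow> cosh (hyp_dist v z) = cosh (hyp_dist v' z')"
    using hyp_dist_eq_iff_cosh assms by blast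
  also have "\<dots> \<longleftrightarrow> ?r = ?s"
    using r assms by (auto simp: cosh_hyp_dist_radius field_simps)
  finally show ?thesis by simp
qed

text \<open>Up to a positive factor this is a comparison of Euclidean lengths, so both the
  hyperbolic triangle inequality and its equality case reduce to the Euclidean ones in the disc
  centred at \<open>v\<close>.\<close>

lemma cosh_diff_hyp_dist:
  assumes "Im v > 0" "Im z > 0" "Im w > 0"
  shows "cosh (hyp_dist z w) - cosh (hyp_dist v w - hyp_dist v z) =
    2 * ((cmod (disc v z - disc v w))\<^sup>2 - (cmod (disc v w) - cmod (disc v z))\<^sup>2) /
     ((1 - (cmod (disc v z))\<^sup>2) * (1 - (cmod (disc v w))\<^sup>2))"
proof -
  have r: "1 - (cmod (disc v z))\<^sup>2 \<noteq> 0" "1 - (cmod (disc v w))\<^sup>2 \<noteq> 0"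
    using norm_disc_sq_less_1[of v z] norm_disc_sq_less_1[of v w] assms by auto
  show ?thesis
    unfolding cosh_diff cosh_hyp_dist_disc[OF assms] cosh_hyp_dist_radius[OF assms(1,2)]
      cosh_hyp_dist_radius[OF assms(1,3)]
    using r by (simp add: divide_simps) (simp add: algebra_simps power2_eq_square)
qed

lemma hyp_dist_triangle_diff:
  assumes "Im v > 0" "Im z > 0" "Im w > 0"
  shows "\<bar>hyp_dist v w - hyp_dist v z\<bar> \<le> hyp_dist z w"
proof -
  let ?Z = "disc v z" and ?W = "disc v w"
  have r: "(cmod ?Z)\<^sup>2 < 1" "(cmod ?W)\<^sup>2 < 1" using norm_disc_sq_less_1 assms by auto
  have "\<bar>cmod ?W - cmod ?Z\<bar> \<le> cmod (?Z - ?W)"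
    by (metis norm_minus_commute norm_triangle_ineq3)
  then have "(cmod ?W - cmod ?Z)\<^sup>2 \<le> (cmod (?Z - ?W))\<^sup>2"
    by (metis abs_le_square_iff abs_norm_cancel)
  then have "0 \<le> cosh (hyp_dist z w) - cosh (hyp_dist v w - hyp_dist v z)"
    unfolding cosh_diff_hyp_dist[OF assms] using r by (intro divide_nonneg_pos) auto
  then have "cosh \<bar>hyp_dist v w - hyp_dist v z\<bar> \<le> cosh (hyp_dist z w)" by simp
  then show ?thesis
    using hyp_dist_nonneg[OF assms(2,3)] by (simp add: cosh_real_nonneg_le_iff del: cosh_real_abs)
qed

lemma hyp_dist_triangle:
  assumes "Im v > 0" "Im z > 0" "Im w > 0"
  shows "hyp_dist v w \<le> hyp_dist v z + hyp_dist z w"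
  using hyp_dist_triangle_diff[OF assms] by linarith

text \<open>Geodesic segments from \<open>v\<close> are radii of the disc centred at
  \<open>v\<close>: by \<open>cosh_diff_hyp_dist\<close>, equality in the hyperbolic triangle
  inequality is equality in the Euclidean one for \<open>disc v z\<close> and
  \<open>disc v w - disc v z\<close>.\<close>

lemma hyp_dist_between_iff:
  assumes "Im v > 0" "Im z > 0" "Im w > 0"
  shows "hyp_dist v z + hyp_dist z w = hyp_dist v w \<longleftrightarrow>
    (\<exists>t\<in>{0..1}. disc v z = of_real t * disc v w)"
proof -
  let ?Z = "disc v z" and ?W = "disc v w"
  have r: "(cmod ?Z)\<^sup>2 < 1" "(cmod ?W)\<^sup>2 < 1" using norm_disc_sq_less_1 assms by auto
  have "hyp_dist v z + hyp_dist z w = hyp_dist v w \<longleftrightarrow>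
      hyp_dist v z \<le> hyp_dist v w \<and> cosh (hyp_dist z w) = cosh (hyp_dist v w - hyp_dist v z)"
    using hyp_dist_nonneg[OF assms(2,3)] by auto
  also have "\<dots> \<longleftrightarrow> cmod ?Z \<le> cmod ?W \<and> (cmod (?Z - ?W))\<^sup>2 = (cmod ?W - cmod ?Z)\<^sup>2"
  proof -
    have nz: "(1 - (cmod ?Z)\<^sup>2) * (1 - (cmod ?W)\<^sup>2) \<noteq> 0" using r by auto
    have "cosh (hyp_dist z w) = cosh (hyp_dist v w - hyp_dist v z) \<longleftrightarrow>
        (cmod (?Z - ?W))\<^sup>2 = (cmod ?W - cmod ?Z)\<^sup>2"
      using cosh_diff_hyp_dist[OF assms] nz
      by (metis divide_eq_0_iff eq_iff_diff_eq_0 mult_eq_0_iff zero_neq_numeral)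
    then show ?thesis using hyp_dist_le_iff_radius[OF assms] by blast
  qed
  also have "\<dots> \<longleftrightarrow> cmod (?Z + (?W - ?Z)) = cmod ?Z + cmod (?W - ?Z)"
  proof
    assume a: "cmod ?Z \<le> cmod ?W \<and> (cmod (?Z - ?W))\<^sup>2 = (cmod ?W - cmod ?Z)\<^sup>2"
    then have "cmod (?Z - ?W) = cmod ?W - cmod ?Z"
      using power2_eq_imp_eq[of "cmod (?Z - ?W)" "cmod ?W - cmod ?Z"] by simp
    then show "cmod (?Z + (?W - ?Z)) = cmod ?Z + cmod (?W - ?Z)" by (simp add: norm_minus_commute)
  next
    assume "cmod (?Z + (?W - ?Z)) = cmod ?Z + cmod (?W - ?Z)"
    then have "cmod ?W - cmod ?Z = cmod (?Z - ?W)" by (simp add: norm_minus_commute)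
    then show "cmod ?Z \<le> cmod ?W \<and> (cmod (?Z - ?W))\<^sup>2 = (cmod ?W - cmod ?Z)\<^sup>2"
      by (smt (verit) norm_ge_zero)
  qed
  also have "\<dots> \<longleftrightarrow> (\<exists>t\<in>{0..1}. ?Z = of_real t * ?W)"
  proof
    assume a: "cmod (?Z + (?W - ?Z)) = cmod ?Z + cmod (?W - ?Z)"
    show "\<exists>t\<in>{0..1}. ?Z = of_real t * ?W"
    proof (cases "?W = 0")
      case True
      with a have "?Z = 0" by simp
      with True show ?thesis by auto
    next
      case False
      from a have "cmod ?Z *\<^sub>R (?W - ?Z) = cmod (?W - ?Z) *\<^sub>R ?Z"
        by (rule norm_triangle_eq[THEN iffD1])
      then have "cmod ?Z *\<^sub>R ?W = (cmod ?Z + cmod (?W - ?Z)) *\<^sub>R ?Z"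
        by (simp add: algebra_simps)
      also have "\<dots> = cmod ?W *\<^sub>R ?Z" using a by simp
      finally have "?Z = of_real (cmod ?Z / cmod ?W) * ?W"
        using False by (simp add: scaleR_conv_of_real field_simps)
      moreover have "cmod ?Z \<le> cmod ?W" using a norm_ge_zero[of "?W - ?Z"] by simp
      then have "cmod ?Z / cmod ?W \<le> 1" using False by (simp add: divide_le_eq_1)
      ultimately show ?thesis by (intro bexI[of _ "cmod ?Z / cmod ?W"]) auto
    qed
  next
    assume "\<exists>t\<in>{0..1}. ?Z = of_real t * ?W"
    then obtain t where t: "t \<in> {0..1}" "?Z = of_real t * ?W" by blast
    have "?W - ?Z = of_real (1 - t) * ?W" by (simp add: t algebra_simps)
    then have "cmod (?W - ?Z) = (1 - t) * cmod ?W" using t(1) by (simp only: norm_mult norm_of_real) auto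
    moreover have "cmod ?Z = t * cmod ?W" using t by (simp add: norm_mult)
    ultimately show "cmod (?Z + (?W - ?Z)) = cmod ?Z + cmod (?W - ?Z)"
      by (simp add: algebra_simps)
  qed
  finally show ?thesis .
qed

lemma norm_scaled_disc_less_1:
  assumes "Im v > 0" "Im w > 0" "t \<in> {0..1}"
  shows "cmod (of_real t * disc v w) < 1"
proof -
  have "cmod (of_real t * disc v w) \<le> cmod (disc v w)"
    using assms(3) by (simp add: norm_mult mult_left_le_one_le)
  then show ?thesis using norm_disc_less_1[OF assms(1,2)] by linarith
qed

lemma in_hyp_segment_iff:
  assumes "Im v > 0" "Im w > 0"
  shows "z \<in> hyp_segment v w \<longleftrightarrow> Im z > 0 \<and> (\<exists>t\<in>{0..1}. disc v z = of_real t * disc v w)"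
  using hyp_dist_between_iff[OF assms(1) _ assms(2)] by (auto simp: hyp_segment_def hyp_plane_iff)

lemma hyp_segment_eq_image:
  assumes "Im v > 0" "Im w > 0"
  shows "hyp_segment v w = (\<lambda>t. undisc v (of_real t * disc v w)) ` {0..1}"
proof (intro equalityI subsetI)
  fix z assume z: "z \<in> hyp_segment v w"
  then obtain t where "Im z > 0" "t \<in> {0..1}" "disc v z = of_real t * disc v w"
    using in_hyp_segment_iff[OF assms] by blast
  then show "z \<in> (\<lambda>t. undisc v (of_real t * disc v w)) ` {0..1}"
    using undisc_disc[OF assms(1), of z] by auto
next
  fix z assume "z \<in> (\<lambda>t. undisc v (of_real t * disc v w)) ` {0..1}"
  then obtain t where t: "t \<in> {0..1}" "z = undisc v (of_real t * disc v w)" by blast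
  have "cmod (of_real t * disc v w) < 1" using norm_scaled_disc_less_1[OF assms t(1)] .
  then show "z \<in> hyp_segment v w"
    using in_hyp_segment_iff[OF assms] t Im_undisc_pos disc_undisc assms(1) by auto
qed

lemma hyp_segment_sym: "hyp_segment a b = hyp_segment b a"
  unfolding hyp_segment_def by (metis (no_types, lifting) add.commute hyp_dist_sym)

lemma hyp_segment_ends:
  assumes "Im a > 0" "Im b > 0"
  shows "a \<in> hyp_segment a b" "b \<in> hyp_segment a b"
  using assms by (auto simp: hyp_segment_def hyp_plane_iff)

text \<open>The same computation with \<open>cosh_add\<close> in place of \<open>cosh_diff\<close>,
  seen from the point in between: equality means that the two ends lie in opposite
  directions.\<close>

lemma in_hyp_segment_iff_opposite:
  assumes "Im p > 0" "Im z > 0" "Im w > 0"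
  shows "p \<in> hyp_segment z w \<longleftrightarrow>
    cmod (disc p z - disc p w) = cmod (disc p z) + cmod (disc p w)"
proof -
  let ?Z = "disc p z" and ?W = "disc p w"
  have r: "(cmod ?Z)\<^sup>2 < 1" "(cmod ?W)\<^sup>2 < 1" using norm_disc_sq_less_1 assms by auto
  have "p \<in> hyp_segment z w \<longleftrightarrow> hyp_dist p z + hyp_dist p w = hyp_dist z w"
    using assms by (simp add: hyp_segment_def hyp_plane_iff hyp_dist_sym[of z p])
  also have "\<dots> \<longleftrightarrow> cosh (hyp_dist z w) = cosh (hyp_dist p z + hyp_dist p w)"
    using hyp_dist_nonneg assms by (metis add_nonneg_nonneg abs_of_nonneg cosh_real_eq_iff)
  also have "\<dots> \<longleftrightarrow> (cmod (?Z - ?W))\<^sup>2 = (cmod ?Z + cmod ?W)\<^sup>2"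
  proof -
    have nz: "1 - (cmod ?Z)\<^sup>2 \<noteq> 0" "1 - (cmod ?W)\<^sup>2 \<noteq> 0" using r by auto
    have "cosh (hyp_dist z w) - cosh (hyp_dist p z + hyp_dist p w) =
      2 * ((cmod (?Z - ?W))\<^sup>2 - (cmod ?Z + cmod ?W)\<^sup>2) / ((1 - (cmod ?Z)\<^sup>2) * (1 - (cmod ?W)\<^sup>2))"
      unfolding cosh_add cosh_hyp_dist_disc[OF assms] cosh_hyp_dist_radius[OF assms(1,2)]
        cosh_hyp_dist_radius[OF assms(1,3)]
      using nz by (simp add: divide_simps) (simp add: algebra_simps power2_eq_square)
    then show ?thesis using nz
      by (metis divide_eq_0_iff eq_iff_diff_eq_0 mult_eq_0_iff zero_neq_numeral)
  qed
  also have "\<dots> \<longleftrightarrow> cmod (?Z - ?W) = cmod ?Z + cmod ?W"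
    using power2_eq_imp_eq[of "cmod (?Z - ?W)" "cmod ?Z + cmod ?W"] by fastforce
  finally show ?thesis .
qed

section \<open>The area term of an edge in disc coordinates\<close>

lemma edge_area_sym: "edge_area w z = - edge_area z w"
proof -
  have "(Re z - Re w) / (Im w + Im z) = - ((Re w - Re z) / (Im z + Im w))"
    by (simp add: add.commute minus_divide_left)
  then show ?thesis unfolding edge_area_def by (simp only: arctan_minus)
qed

lemma edge_area_self [simp]: "edge_area z z = 0"
  by (simp add: edge_area_def)

lemma Arg_eq_arctan: "Re z > 0 \<Longrightarrow> Arg z = arctan (Im z / Re z)"
proof -
  assume z: "Re z > 0"
  have a: "\<bar>Arg z\<bar> < pi / 2" using z Arg_Re_pos by blast
  have "Re z = cmod z * cos (Arg z)" "Im z = cmod z * sin (Arg z)"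
    using rcis_cmod_Arg[of z] by (metis Re_rcis, metis Im_rcis)
  then have "tan (Arg z) = Im z / Re z" using z by (cases "z = 0") (simp_all add: tan_def)
  then show "Arg z = arctan (Im z / Re z)" using a by (intro arctan_unique[symmetric]) auto
qed

lemma Arg_eq_mod_2pi:
  assumes "cis x = cis y" "\<bar>x - y\<bar> < 2 * pi"
  shows "x = y"
proof -
  have "cis (x - y) = 1" using assms(1) by (simp add: cis_divide[symmetric])
  then have "cos (x - y) = 1" by (metis cis.simps(1) one_complex.simps(1))
  then obtain k :: int where k: "x - y = of_int k * 2 * pi" by (auto simp: cos_one_2pi_int)
  have "\<bar>of_int k\<bar> < (1::real)" using assms(2) unfolding k by (simp add: abs_mult)
  then have "k = 0" by linarith
  then show ?thesis using k by simp
qed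

lemma cis_Arg_mult: "z \<noteq> 0 \<Longrightarrow> w \<noteq> 0 \<Longrightarrow> cis (Arg (z * w)) = cis (Arg z) * cis (Arg w)"
  by (simp add: cis_Arg sgn_mult)

lemma cis_Arg_divide: "z \<noteq> 0 \<Longrightarrow> w \<noteq> 0 \<Longrightarrow> cis (Arg (z / w)) = cis (Arg z) / cis (Arg w)"
  by (simp add: cis_Arg sgn_divide)

lemma cnj_one_minus_Arg: "cmod \<zeta> < 1 \<Longrightarrow> Arg (1 - cnj \<zeta>) = - Arg (1 - \<zeta>)"
proof -
  assume a: "cmod \<zeta> < 1"
  have r: "Re (1 - \<zeta>) > 0" using a abs_Re_le_cmod[of \<zeta>] by auto
  then have "Re (1 - cnj \<zeta>) > 0" by simp
  then show ?thesis using r by (simp add: Arg_eq_arctan flip: arctan_minus)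
qed

lemma Re_one_minus_pos: "cmod \<zeta> < 1 \<Longrightarrow> Re (1 - \<zeta>) > 0"
  using abs_Re_le_cmod[of \<zeta>] by auto

text \<open>The term is \<open>- 2 * Arg (- \<i> * (w - cnj z))\<close>, and in the disc
  \<open>w - cnj z\<close> factors. The arguments that involve one endpoint only telescope around a
  closed tuple; what remains is invariant under rotations of the disc.\<close>

lemma edge_area_disc:
  assumes "Im c > 0" "Im z > 0" "Im w > 0"
  defines "Z \<equiv> disc c z" and "W \<equiv> disc c w"
  shows "edge_area z w = - 2 * Arg (1 - W * cnj Z) + 2 * Arg (1 - W) - 2 * Arg (1 - Z)"
proof -
  have n: "cmod Z < 1" "cmod W < 1" using assms norm_disc_less_1 by auto
  then have n': "cmod (cnj Z) < 1" "cmod (W * cnj Z) < 1"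
    using mult_strict_mono[of "cmod W" 1 "cmod Z" 1] by (auto simp: norm_mult)
  have nz: "1 - Z \<noteq> 0" "1 - W \<noteq> 0" "1 - cnj Z \<noteq> 0" "1 - W * cnj Z \<noteq> 0" using n n' by auto
  have "w - cnj z = (c - cnj c) * (1 - W * cnj Z) / ((1 - W) * (1 - cnj Z))"
    using undisc_minus_cnj[OF nz(1,2), of c] assms undisc_disc by simp
  also have "c - cnj c = of_real (2 * Im c) * \<i>" by (simp add: complex_diff_cnj)
  finally have "w - cnj z = \<i> * (of_real (2 * Im c) * ((1 - W * cnj Z) / ((1 - W) * (1 - cnj Z))))"
    by (simp add: mult_ac)
  then have e: "- \<i> * (w - cnj z) = of_real (2 * Im c) * ((1 - W * cnj Z) / ((1 - W) * (1 - cnj Z)))"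
    by (simp only: mult.assoc[symmetric]) simp
  have re: "Re (- \<i> * (w - cnj z)) > 0" using assms by simp
  have "Arg (- \<i> * (w - cnj z)) = arctan (- ((Re w - Re z) / (Im z + Im w)))"
    by (subst Arg_eq_arctan[OF re]) (simp add: add.commute minus_divide_left)
  then have ea: "edge_area z w = - 2 * Arg (- \<i> * (w - cnj z))"
    unfolding edge_area_def arctan_minus by simp
  let ?u = "(1 - W * cnj Z) / ((1 - W) * (1 - cnj Z))"
  have A: "Arg (- \<i> * (w - cnj z)) = Arg ?u"
    unfolding e using assms by (intro Arg_times_of_real) auto
  have "cis (Arg ?u) = cis (Arg (1 - W * cnj Z) - Arg (1 - W) - Arg (1 - cnj Z))"
    using nz by (simp add: cis_Arg_divide cis_Arg_mult flip: cis_divide)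
  \<comment> \<open>Four arguments, each below pi/2 in absolute value, since all four numbers have
    positive real part.\<close>
  moreover have "\<bar>Arg ?u - (Arg (1 - W * cnj Z) - Arg (1 - W) - Arg (1 - cnj Z))\<bar> < 2 * pi"
  proof -
    have "\<bar>Arg ?u\<bar> < pi / 2" using re A Arg_Re_pos by metis
    moreover have "\<bar>Arg (1 - W * cnj Z)\<bar> < pi / 2" "\<bar>Arg (1 - W)\<bar> < pi / 2" "\<bar>Arg (1 - cnj Z)\<bar> < pi / 2"
      using Re_one_minus_pos n n' Arg_Re_pos by metis+
    ultimately show ?thesis by linarith
  qed
  ultimately have "Arg ?u = Arg (1 - W * cnj Z) - Arg (1 - W) - Arg (1 - cnj Z)"
    by (rule Arg_eq_mod_2pi)
  then show ?thesis unfolding ea A cnj_one_minus_Arg[OF n(1)] by simp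
qed

text \<open>Two centrings differ by a disc automorphism that takes \<open>a\<close> to 0. The
  unimodular factor in front is forced, because both centrings send infinity to 1.\<close>

lemma disc_change:
  assumes "Im c > 0" "Im v > 0" "Im z > 0"
  defines "a \<equiv> disc c v"
  shows "disc v z = (1 - cnj a) / (1 - a) * ((disc c z - a) / (1 - cnj a * disc c z))"
proof -
  let ?Z = "disc c z"
  have n: "cmod a < 1" "cmod ?Z < 1" using assms norm_disc_less_1 by auto
  then have n': "cmod (cnj a * ?Z) < 1" "cmod (cnj a) < 1"
    using mult_strict_mono[of "cmod a" 1 "cmod ?Z" 1] by (auto simp: norm_mult)
  have "c - cnj c \<noteq> 0" using assms(1) by (auto simp: complex_eq_iff)
  moreover have "1 - ?Z * cnj a \<noteq> 0" using n'(1) one_minus_nonzero by (simp add: mult.commute)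
  ultimately have nz: "1 - a \<noteq> 0" "1 - ?Z \<noteq> 0" "1 - cnj a \<noteq> 0" "1 - ?Z * cnj a \<noteq> 0" "c - cnj c \<noteq> 0"
    using n n'(2) one_minus_nonzero by blast+
  have "z - v = (c - cnj c) * (?Z - a) / ((1 - ?Z) * (1 - a))"
    using undisc_minus[OF nz(2,1), of c] assms undisc_disc by simp
  moreover have "z - cnj v = (c - cnj c) * (1 - ?Z * cnj a) / ((1 - ?Z) * (1 - cnj a))"
    using undisc_minus_cnj[OF nz(1,2), of c] assms undisc_disc by simp
  ultimately show ?thesis unfolding disc_def[of v z] using nz by (simp add: mult.commute)
qed

lemma norm_disc_sym:
  assumes "Im v > 0" "Im z > 0"
  shows "cmod (disc v z) = cmod (disc z v)"
  using hyp_dist_eq_iff_radius[of v z z v] assms hyp_dist_sym by simp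

section \<open>Winding numbers of geodesic polygons\<close>

text \<open>Keeps a primitive on one branch: a point off the whole edge is off every initial piece
  of it.\<close>

lemma hyp_segment_subset_left:
  assumes "Im z > 0" "Im w > 0" "\<zeta> \<in> hyp_segment z w"
  shows "hyp_segment z \<zeta> \<subseteq> hyp_segment z w"
proof
  fix p assume p: "p \<in> hyp_segment z \<zeta>"
  obtain t where t: "t \<in> {0..1}" "disc z \<zeta> = of_real t * disc z w" and z: "Im \<zeta> > 0"
    using assms in_hyp_segment_iff by blast
  obtain s where s: "s \<in> {0..1}" "disc z p = of_real s * disc z \<zeta>" and "Im p > 0"
    using p z assms(1) in_hyp_segment_iff by blast
  moreover have "s * t \<in> {0..1}" using s(1) t(1) by (auto simp: mult_le_one)
  moreover have "disc z p = of_real (s * t) * disc z w" using s(2) t(2) by simp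
  ultimately show "p \<in> hyp_segment z w" using assms(1,2) in_hyp_segment_iff by blast
qed

text \<open>A negative quotient would put the ends in opposite directions from \<open>p\<close>,
  hence \<open>p\<close> between them. Off the edge, the principal logarithm of the quotient is
  therefore holomorphic.\<close>

lemma disc_quotient_not_nonpos:
  assumes "Im p > 0" "Im z > 0" "Im w > 0" "p \<notin> hyp_segment z w"
  shows "disc p w / disc p z \<notin> \<real>\<^sub>\<le>\<^sub>0" and "disc p z \<noteq> 0" and "disc p w \<noteq> 0"
proof -
  have "p \<noteq> z" "p \<noteq> w" using assms hyp_segment_ends by blast+
  then show nz: "disc p z \<noteq> 0" "disc p w \<noteq> 0" using assms disc_eq_0_iff by auto
  show "disc p w / disc p z \<notin> \<real>\<^sub>\<le>\<^sub>0"
  proof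
    assume "disc p w / disc p z \<in> \<real>\<^sub>\<le>\<^sub>0"
    then obtain l where l: "l \<le> 0" "disc p w / disc p z = of_real l" by (metis nonpos_Reals_cases)
    then have w: "disc p w = of_real l * disc p z" using nz by (simp add: field_simps)
    have "disc p z - disc p w = of_real (1 - l) * disc p z" unfolding w by (simp add: algebra_simps)
    then have "cmod (disc p z - disc p w) = (1 - l) * cmod (disc p z)"
      using l(1) by (simp only: norm_mult norm_of_real)
    moreover have "cmod (disc p w) = - l * cmod (disc p z)" using l(1) by (simp add: w norm_mult)
    ultimately have "p \<in> hyp_segment z w"
      using assms by (subst in_hyp_segment_iff_opposite) (auto simp: algebra_simps)
    then show False using assms by blast
  qed
qed

section \<open>Geodesic edges as paths and their winding numbers\<close>

definition edge_path :: "complex \<Rightarrow> complex \<Rightarrow> real \<Rightarrow> complex" where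
  "edge_path z w = undisc z \<circ> linepath 0 (disc z w)"

lemma edge_path_eq: "edge_path z w t = undisc z (of_real t * disc z w)"
  by (simp add: edge_path_def linepath_def scaleR_conv_of_real)

lemma path_image_edge_path:
  assumes "Im z > 0" "Im w > 0"
  shows "path_image (edge_path z w) = hyp_segment z w"
  unfolding path_image_def hyp_segment_eq_image[OF assms] by (simp add: edge_path_eq)

lemma edge_path_ends:
  assumes "Im z > 0" "Im w > 0"
  shows "pathstart (edge_path z w) = z" "pathfinish (edge_path z w) = w"
  using assms undisc_disc by (simp_all add: pathstart_def pathfinish_def edge_path_eq)

lemma undisc_holomorphic: "undisc z holomorphic_on - {1}"
  unfolding undisc_def by (intro holomorphic_intros) auto

lemma valid_path_edge_path:
  assumes "Im z > 0" "Im w > 0"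
  shows "valid_path (edge_path z w)"
  unfolding edge_path_def
proof (rule valid_path_compose_holomorphic[OF _ undisc_holomorphic])
  show "path_image (linepath 0 (disc z w)) \<subseteq> - {1}"
  proof
    fix x assume "x \<in> path_image (linepath 0 (disc z w))"
    then obtain t where "t \<in> {0..1}" "x = of_real t * disc z w"
      by (auto simp: closed_segment_def scaleR_conv_of_real)
    then have "cmod x < 1" using norm_scaled_disc_less_1[OF assms] by blast
    then show "x \<in> - {1}" by auto
  qed
qed auto

lemma arc_edge_path:
  assumes "Im z > 0" "Im w > 0" "z \<noteq> w"
  shows "arc (edge_path z w)"
  unfolding arc_def
proof
  show "path (edge_path z w)" using assms valid_path_edge_path valid_path_imp_path by blast
  have d: "disc z w \<noteq> 0" using assms disc_eq_0_iff by auto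
  show "inj_on (edge_path z w) {0..1}"
  proof (rule inj_onI)
    fix s t :: real assume st: "s \<in> {0..1}" "t \<in> {0..1}" "edge_path z w s = edge_path z w t"
    have "of_real s * disc z w = of_real t * disc z w"
      using st(3) disc_undisc[OF assms(1) norm_scaled_disc_less_1[OF assms(1,2) st(1)]]
        disc_undisc[OF assms(1) norm_scaled_disc_less_1[OF assms(1,2) st(2)]]
      unfolding edge_path_eq by metis
    then show "s = t" using d by simp
  qed
qed

lemma cnj_notin_edge:
  assumes "Im p > 0" "Im z > 0" "Im w > 0"
  shows "cnj p \<notin> hyp_segment z w"
  using assms by (auto simp: hyp_segment_def hyp_plane_iff)

text \<open>Subtracting the winding number about the mirror point turns the integrand into the
  logarithmic derivative of \<open>disc p\<close>. Every initial piece of the edge misses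
  \<open>p\<close>, so the quotient \<open>disc p \<zeta> / disc p z\<close> avoids the cut of
  \<open>Ln\<close> along the whole edge and one primitive suffices. For a closed loop in the
  half-plane the subtracted term will be zero.\<close>

lemma winding_number_edge_path:
  assumes "Im p > 0" "Im z > 0" "Im w > 0" "p \<notin> hyp_segment z w"
  shows "winding_number (edge_path z w) p - winding_number (edge_path z w) (cnj p) =
    Ln (disc p w / disc p z) / (2 * pi * \<i>)"
proof -
  let ?g = "edge_path z w"
  let ?F = "\<lambda>\<zeta>. Ln (disc p \<zeta> / disc p z)"
  have im: "path_image ?g = hyp_segment z w" using path_image_edge_path assms by blast
  have vp: "valid_path ?g" using valid_path_edge_path assms by blast
  have nz: "disc p z \<noteq> 0" using disc_quotient_not_nonpos(2)[OF assms] .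
  have der: "(?F has_field_derivative 1 / (\<zeta> - p) - 1 / (\<zeta> - cnj p)) (at \<zeta> within hyp_segment z w)"
    if "\<zeta> \<in> hyp_segment z w" for \<zeta>
  proof -
    have z: "Im \<zeta> > 0" using that by (simp add: hyp_segment_def hyp_plane_iff)
    have notin: "p \<notin> hyp_segment z \<zeta>" using hyp_segment_subset_left[OF assms(2,3) that] assms(4) by blast
    have q: "disc p \<zeta> / disc p z \<notin> \<real>\<^sub>\<le>\<^sub>0" using disc_quotient_not_nonpos[OF assms(1,2) z notin] by blast
    have n1: "\<zeta> - cnj p \<noteq> 0" using diff_cnj_nonzero[OF assms(1) z] .
    have n2: "\<zeta> - p \<noteq> 0" using disc_quotient_not_nonpos(3)[OF assms(1,2) z notin] by (auto simp: disc_def)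
    have e: "(\<lambda>\<zeta>. disc p \<zeta> / disc p z) = (\<lambda>\<zeta>. ((\<zeta> - p) / (\<zeta> - cnj p)) / disc p z)"
      by (simp add: disc_def)
    have "((\<lambda>\<zeta>. disc p \<zeta> / disc p z) has_field_derivative
       (((\<zeta> - cnj p) - (\<zeta> - p)) / ((\<zeta> - cnj p) * (\<zeta> - cnj p))) / disc p z) (at \<zeta>)"
      unfolding e using n1 by (intro DERIV_cdivide) (auto intro!: derivative_eq_intros)
    then have "(?F has_field_derivative inverse (disc p \<zeta> / disc p z) *
        ((((\<zeta> - cnj p) - (\<zeta> - p)) / ((\<zeta> - cnj p) * (\<zeta> - cnj p))) / disc p z)) (at \<zeta>)"
      using q by (rule DERIV_chain'[OF _ has_field_derivative_Ln])
    moreover have "inverse (disc p \<zeta> / disc p z) *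
        ((((\<zeta> - cnj p) - (\<zeta> - p)) / ((\<zeta> - cnj p) * (\<zeta> - cnj p))) / disc p z)
        = 1 / (\<zeta> - p) - 1 / (\<zeta> - cnj p)"
    proof -
      have "inverse (x / y / d) * (((y - x) / (y * y)) / d) = 1 / x - 1 / y"
        if "x \<noteq> 0" "y \<noteq> 0" "d \<noteq> 0" for x y d :: complex
        using that by (simp add: field_simps)
      from this[OF n2 n1 nz] show ?thesis unfolding disc_def[of p \<zeta>] .
    qed
    ultimately show ?thesis by (simp add: has_field_derivative_at_within)
  qed
  have "((\<lambda>\<zeta>. 1 / (\<zeta> - p) - 1 / (\<zeta> - cnj p)) has_contour_integral (?F (pathfinish ?g) - ?F (pathstart ?g))) ?g"
    by (rule contour_integral_primitive[OF der vp]) (auto simp: im)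
  moreover have "((\<lambda>\<zeta>. 1 / (\<zeta> - p) - 1 / (\<zeta> - cnj p)) has_contour_integral
      (2 * pi * \<i> * winding_number ?g p - 2 * pi * \<i> * winding_number ?g (cnj p))) ?g"
    by (intro has_contour_integral_diff has_contour_integral_winding_number vp)
      (use im assms cnj_notin_edge in auto)
  ultimately have "?F (pathfinish ?g) - ?F (pathstart ?g) =
      2 * pi * \<i> * winding_number ?g p - 2 * pi * \<i> * winding_number ?g (cnj p)"
    using has_contour_integral_unique by blast
  moreover have "?F (pathfinish ?g) - ?F (pathstart ?g) = Ln (disc p w / disc p z)"
    using edge_path_ends[OF assms(2,3)] nz by simp
  ultimately show ?thesis by (simp add: field_simps)
qed

text \<open>\<open>chain v k\<close> consists of \<open>k + 1\<close> edges and ends at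
  \<open>v (Suc k)\<close>.\<close>

primrec chain :: "(nat \<Rightarrow> complex) \<Rightarrow> nat \<Rightarrow> real \<Rightarrow> complex" where
  "chain v 0 = edge_path (v 0) (v 1)"
| "chain v (Suc k) = chain v k +++ edge_path (v (Suc k)) (v (Suc (Suc k)))"

lemma chain_basic:
  assumes "\<And>i. Im (v i) > 0"
  shows "pathstart (chain v k) = v 0" "pathfinish (chain v k) = v (Suc k)" "path (chain v k)"
    "path_image (chain v k) = (\<Union>i\<le>k. hyp_segment (v i) (v (Suc i)))"
proof -
  have "pathstart (chain v k) = v 0 \<and> pathfinish (chain v k) = v (Suc k) \<and> path (chain v k) \<and>
    path_image (chain v k) = (\<Union>i\<le>k. hyp_segment (v i) (v (Suc i)))"
  proof (induction k)
    case 0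
    show ?case using assms edge_path_ends path_image_edge_path
        valid_path_imp_path[OF valid_path_edge_path] by simp
  next
    case (Suc k)
    then show ?case using assms edge_path_ends path_image_edge_path
        valid_path_imp_path[OF valid_path_edge_path] by (simp add: path_image_join atMost_Suc Un_commute)
  qed
  then show "pathstart (chain v k) = v 0" "pathfinish (chain v k) = v (Suc k)" "path (chain v k)"
    "path_image (chain v k) = (\<Union>i\<le>k. hyp_segment (v i) (v (Suc i)))" by blast+
qed

lemma winding_number_chain:
  assumes "\<And>i. Im (v i) > 0" "\<And>i. i \<le> k \<Longrightarrow> p \<notin> hyp_segment (v i) (v (Suc i))"
  shows "winding_number (chain v k) p = (\<Sum>i\<le>k. winding_number (edge_path (v i) (v (Suc i))) p)"
  using assms(2)
proof (induction k)
  case (Suc k)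
  have "winding_number (chain v (Suc k)) p =
      winding_number (chain v k) p + winding_number (edge_path (v (Suc k)) (v (Suc (Suc k)))) p"
    unfolding chain.simps
    using assms(1) Suc.prems edge_path_ends path_image_edge_path
        valid_path_imp_path[OF valid_path_edge_path] chain_basic[of v k]
    by (intro winding_number_join) auto
  then show ?case using Suc by simp
qed simp

section \<open>The boundary of a polygon as a simple closed path\<close>

lemma convex_hyp_plane: "convex hyp_plane"
  by (simp add: hyp_plane_def convex_halfspace_Im_gt)

locale polygon =
  fixes n :: nat and vs :: "complex list"
  assumes poly: "hyp_polygon n vs"
begin

text \<open>A periodic sequence, so that indices are never reduced by hand and
  \<open>i + (n - 1)\<close> can stand for the predecessor of \<open>i\<close> without subtracting
  from it.\<close>

definition V :: "nat \<Rightarrow> complex" where "V i = vs ! (i mod n)"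

abbreviation B :: "complex set" where "B \<equiv> poly_boundary vs"

lemma n3: "n \<ge> 3" and len: "length vs = n" and dist_vs: "distinct vs"
  using poly by (auto simp: hyp_polygon_def)

lemma n0: "n > 0" using n3 by linarith

lemma V_add [simp]: "V (i + n) = V i" "V n = V 0"
  by (auto simp: V_def)

lemma V_mod: "V (i mod n) = V i"
  by (simp add: V_def)

lemma Im_V: "Im (V i) > 0"
proof -
  have "i mod n < length vs" using n0 len by simp
  then have "V i \<in> set vs" unfolding V_def by (rule nth_mem)
  then show ?thesis using poly by (auto simp: hyp_polygon_def hyp_plane_iff)
qed

lemma V_eq_iff: "i < n \<Longrightarrow> j < n \<Longrightarrow> V i = V j \<longleftrightarrow> i = j"
  using dist_vs len by (simp add: V_def nth_eq_iff_index_eq)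

lemma V_less: "i < n \<Longrightarrow> vs ! i = V i"
  by (simp add: V_def)

lemma next_V: "next_vertex vs i = V (Suc i)"
  by (simp add: next_vertex_def V_def len)

lemma V_Suc_neq: "V (Suc i) \<noteq> V i"
proof -
  have "Suc i mod n \<noteq> i mod n"
    using n3 by (simp add: mod_Suc)
  then have "V (Suc i mod n) \<noteq> V (i mod n)" using n0 by (simp add: V_eq_iff)
  then show ?thesis by (simp add: V_mod)
qed

lemma side_V: "i < n \<Longrightarrow> poly_side vs i = hyp_segment (V i) (V (Suc i))"
  by (simp add: poly_side_def next_V V_less)

lemma side_length_V: "i < n \<Longrightarrow> side_length vs i = hyp_dist (V i) (V (Suc i))"
  by (simp add: side_length_def next_V V_less)

lemma B_eq: "B = (\<Union>i<n. hyp_segment (V i) (V (Suc i)))"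
  by (simp add: poly_boundary_def len side_V)

lemma sides_Int:
  assumes "i < n" "j < n" "i \<noteq> j"
  shows "hyp_segment (V i) (V (Suc i)) \<inter> hyp_segment (V j) (V (Suc j)) = {V i, V (Suc i)} \<inter> {V j, V (Suc j)}"
  using poly assms by (simp add: hyp_polygon_def side_V next_V V_less)

text \<open>The bound on \<open>k\<close> stops before the closing edge, the one that returns to
  \<open>V 0\<close>. Up to there distinctness of the vertices leaves only the shared vertex as
  common point.\<close>

lemma arc_chain:
  assumes "k \<le> n - 2"
  shows "arc (chain V k)"
  using assms
proof (induction k)
  case 0
  show ?case using Im_V V_Suc_neq[of 0] by (simp add: arc_edge_path)
next
  case (Suc k)
  have "arc (chain V k +++ edge_path (V (Suc k)) (V (Suc (Suc k))))"
  proof (rule arc_join)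
    show "arc (chain V k)" using Suc by simp
    show "arc (edge_path (V (Suc k)) (V (Suc (Suc k))))"
      using Im_V V_Suc_neq[of "Suc k"] by (simp add: arc_edge_path)
    show "pathfinish (chain V k) = pathstart (edge_path (V (Suc k)) (V (Suc (Suc k))))"
      using chain_basic(2)[of V, OF Im_V] edge_path_ends Im_V by simp
    show "path_image (chain V k) \<inter> path_image (edge_path (V (Suc k)) (V (Suc (Suc k)))) \<subseteq>
      {pathstart (edge_path (V (Suc k)) (V (Suc (Suc k))))}"
    proof
      fix x assume x: "x \<in> path_image (chain V k) \<inter> path_image (edge_path (V (Suc k)) (V (Suc (Suc k))))"
      then obtain i where i: "i \<le> k" "x \<in> hyp_segment (V i) (V (Suc i))"
        "x \<in> hyp_segment (V (Suc k)) (V (Suc (Suc k)))"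
        using chain_basic(4)[of V, OF Im_V] path_image_edge_path Im_V by auto
      have lt: "i < n" "Suc i < n" "Suc k < n" "Suc (Suc k) < n" "i \<noteq> Suc k"
        using i(1) Suc.prems n3 by auto
      then have "x \<in> {V i, V (Suc i)} \<inter> {V (Suc k), V (Suc (Suc k))}"
        using sides_Int[of i "Suc k"] i(2,3) by blast
      then have "x = V (Suc k)" using lt i(1) V_eq_iff by auto
      then show "x \<in> {pathstart (edge_path (V (Suc k)) (V (Suc (Suc k))))}"
        using edge_path_ends Im_V by simp
    qed
  qed
  then show ?case by simp
qed

definition loop :: "real \<Rightarrow> complex" where "loop = chain V (n - 1)"

lemma Suc_n1: "Suc (n - 1) = n" and n12: "n - 1 = Suc (n - 2)"
  using n3 by auto

lemma loop_basic:
  "path loop" "pathstart loop = V 0" "pathfinish loop = V 0" "path_image loop = B"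
proof -
  have "{..n - 1} = {..<n}" using n3 by auto
  then show "path loop" "pathstart loop = V 0" "pathfinish loop = V 0" "path_image loop = B"
    unfolding loop_def B_eq using chain_basic[of V "n - 1", OF Im_V] Suc_n1 by simp_all
qed

lemma simple_path_loop: "simple_path loop"
  unfolding loop_def n12 chain.simps
proof (rule simple_path_join_loop)
  let ?e = "edge_path (V (Suc (n - 2))) (V (Suc (Suc (n - 2))))"
  have e: "Suc (Suc (n - 2)) = n" "Suc (n - 2) = n - 1" using n3 by auto
  show "arc (chain V (n - 2))" by (rule arc_chain) simp
  show "arc ?e" using Im_V V_Suc_neq[of "Suc (n - 2)"] by (simp add: arc_edge_path)
  show "pathfinish (chain V (n - 2)) = pathstart ?e"
    using chain_basic(2)[of V, OF Im_V] edge_path_ends Im_V by simp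
  show "pathfinish ?e = pathstart (chain V (n - 2))"
    using chain_basic(1)[of V, OF Im_V] edge_path_ends Im_V e by simp
  show "path_image (chain V (n - 2)) \<inter> path_image ?e \<subseteq> {pathstart (chain V (n - 2)), pathstart ?e}"
  proof
    fix x assume x: "x \<in> path_image (chain V (n - 2)) \<inter> path_image ?e"
    then obtain i where i: "i \<le> n - 2" "x \<in> hyp_segment (V i) (V (Suc i))"
        "x \<in> hyp_segment (V (n - 1)) (V (Suc (n - 1)))"
      using chain_basic(4)[of V, OF Im_V] path_image_edge_path Im_V e n3 by auto
    then have "x \<in> {V (n - 1), V (Suc (n - 1))}"
    proof -
      have "i < n" "n - 1 < n" "i \<noteq> n - 1" using i(1) n3 by auto
      then show ?thesis using sides_Int[of i "n - 1"] i(2,3) by blast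
    qed
    then show "x \<in> {pathstart (chain V (n - 2)), pathstart ?e}"
      using chain_basic(1)[of V, OF Im_V] edge_path_ends Im_V e by auto
  qed
qed

lemma B_subset: "B \<subseteq> hyp_plane"
  by (auto simp: B_eq hyp_segment_def)

lemma inside_subset: "inside B \<subseteq> hyp_plane"
  using outside_subset_convex[OF convex_hyp_plane B_subset] inside_Int_outside[of B] by blast

text \<open>The total angle through which the boundary turns as seen from \<open>p\<close>, measured
  in the disc centred at \<open>p\<close>.\<close>

definition wsum :: "complex \<Rightarrow> real" where
  "wsum p = (\<Sum>i<n. Arg (disc p (V (Suc i)) / disc p (V i)))"

lemma wsum_winding:
  assumes "Im p > 0" "p \<notin> B"
  shows "wsum p = 2 * pi * Re (winding_number loop p)"
proof -
  have p: "p \<notin> hyp_segment (V i) (V (Suc i))" if "i < n" for i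
    using assms(2) that by (auto simp: B_eq)
  have s: "{..n - 1} = {..<n}" using n3 by auto
  \<comment> \<open>The mirror point lies outside the convex half-plane that contains the
    loop.\<close>
  have "winding_number loop (cnj p) = 0"
    using B_subset loop_basic assms(1)
    by (intro winding_number_zero_outside[OF _ convex_hyp_plane]) (auto simp: hyp_plane_iff)
  then have "winding_number loop p = winding_number loop p - winding_number loop (cnj p)" by simp
  also have "\<dots> = (\<Sum>i<n. winding_number (edge_path (V i) (V (Suc i))) p
      - winding_number (edge_path (V i) (V (Suc i))) (cnj p))"
    unfolding loop_def sum_subtractf
    using winding_number_chain[of V "n - 1" p, OF Im_V] winding_number_chain[of V "n - 1" "cnj p", OF Im_V]
      p cnj_notin_edge[OF assms(1) Im_V Im_V] n3 Im_V unfolding s by simp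
  also have "\<dots> = (\<Sum>i<n. Ln (disc p (V (Suc i)) / disc p (V i)) / (2 * pi * \<i>))"
    by (intro sum.cong refl winding_number_edge_path assms(1) Im_V p) simp
  finally have "(\<Sum>i<n. Ln (disc p (V (Suc i)) / disc p (V i))) = 2 * pi * \<i> * winding_number loop p"
    by (simp add: sum_divide_distrib[symmetric] field_simps)
  then have "Im (\<Sum>i<n. Ln (disc p (V (Suc i)) / disc p (V i))) = 2 * pi * Re (winding_number loop p)"
    by simp
  then have "(\<Sum>i<n. Im (Ln (disc p (V (Suc i)) / disc p (V i)))) = 2 * pi * Re (winding_number loop p)"
    by (simp only: Im_sum)
  moreover have "Arg (disc p (V (Suc i)) / disc p (V i)) = Im (Ln (disc p (V (Suc i)) / disc p (V i)))"
    if "i < n" for i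
    using disc_quotient_not_nonpos(2,3)[OF assms(1) Im_V Im_V p[OF that]] by (simp add: Arg_eq_Im_Ln)
  ultimately show ?thesis by (simp add: wsum_def)
qed

text \<open>\<open>e\<close> is the winding number of the boundary about inside points: 1 for
  counterclockwise and -1 for clockwise vertices.\<close>

definition orientation :: "real \<Rightarrow> bool" where
  "orientation e \<longleftrightarrow> e \<in> {1, -1} \<and>
     (\<forall>p. Im p > 0 \<longrightarrow> p \<notin> B \<longrightarrow> wsum p = 2 * pi * (if p \<in> inside B then e else 0))"

lemma orientation_exists:
  obtains e where "orientation e"
proof -
  have out: "winding_number loop p = 0" if "p \<notin> B" "p \<notin> inside B" for p
  proof (rule winding_number_zero_in_outside)
    show "p \<in> outside (path_image loop)"
      using that inside_Un_outside[of B] unfolding loop_basic by blast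
  qed (use loop_basic in auto)
  consider "\<And>z. z \<in> inside B \<Longrightarrow> winding_number loop z = 1" |
    "\<And>z. z \<in> inside B \<Longrightarrow> winding_number loop z = -1"
    using simple_closed_path_winding_number_inside[OF simple_path_loop] loop_basic(4) by metis
  then show ?thesis
  proof cases
    case 1
    show ?thesis
      by (rule that[of 1]) (use 1 out wsum_winding in \<open>auto simp: orientation_def\<close>)
  next
    case 2
    show ?thesis
      by (rule that[of "-1"]) (use 2 out wsum_winding in \<open>auto simp: orientation_def\<close>)
  qed
qed

end

section \<open>Area of a polygon as a sum over its sides\<close>

text \<open>
  \<open>cross z w p > 0\<close> says that \<open>p\<close> lies to the left of the geodesic from \<open>z\<close> to \<open>w\<close>, hence above it if
  \<open>Re z < Re w\<close>: up to a positive factor it is the equation of the circle through \<open>z\<close> and \<open>w\<close> centred on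
  the real axis.
\<close>

definition cross :: "complex \<Rightarrow> complex \<Rightarrow> complex \<Rightarrow> real" where
  "cross z w p = (Re w - Re z) * (cmod p)\<^sup>2 - ((cmod w)\<^sup>2 - (cmod z)\<^sup>2) * Re p
     + (cmod w)\<^sup>2 * Re z - (cmod z)\<^sup>2 * Re w"

lemma Im_disc:
  assumes "Im p > 0" "Im z > 0"
  shows "Im (disc p z) = 2 * Im p * (Re p - Re z) / (cmod (z - cnj p))\<^sup>2"
proof -
  have "disc p z = (z - p) * cnj (z - cnj p) / of_real ((cmod (z - cnj p))\<^sup>2)"
    using diff_cnj_nonzero[OF assms] unfolding disc_def by (metis complex_div_cnj)
  then have "Im (disc p z) = Im ((z - p) * cnj (z - cnj p)) / (cmod (z - cnj p))\<^sup>2"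
    by (simp only: Im_divide_of_real)
  also have "Im ((z - p) * cnj (z - cnj p)) = 2 * Im p * (Re p - Re z)"
    by (simp add: algebra_simps)
  finally show ?thesis .
qed

lemma Im_disc_cross:
  assumes "Im p > 0" "Im z > 0" "Im w > 0"
  shows "Im (disc p w * cnj (disc p z)) =
    2 * Im p * cross z w p / ((cmod (z - cnj p))\<^sup>2 * (cmod (w - cnj p))\<^sup>2)"
proof -
  have e: "disc p u = (u - p) * cnj (u - cnj p) / of_real ((cmod (u - cnj p))\<^sup>2)" if "Im u > 0" for u
    using diff_cnj_nonzero[OF assms(1) that] unfolding disc_def by (metis complex_div_cnj)
  have "disc p w * cnj (disc p z) = ((w - p) * cnj (w - cnj p)) * cnj ((z - p) * cnj (z - cnj p)) /
     of_real ((cmod (z - cnj p))\<^sup>2 * (cmod (w - cnj p))\<^sup>2)"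
    unfolding e[OF assms(2)] e[OF assms(3)] by simp
  then have "Im (disc p w * cnj (disc p z)) =
     Im (((w - p) * cnj (w - cnj p)) * cnj ((z - p) * cnj (z - cnj p))) /
     ((cmod (z - cnj p))\<^sup>2 * (cmod (w - cnj p))\<^sup>2)"
    by (simp only: Im_divide_of_real)
  also have "Im (((w - p) * cnj (w - cnj p)) * cnj ((z - p) * cnj (z - cnj p))) = 2 * Im p * cross z w p"
    unfolding cross_def cmod_power2 by (simp add: algebra_simps power2_eq_square)
  finally show ?thesis .
qed

text \<open>For \<open>Re z < Re w\<close> this is the geodesic triangle with vertices
  \<open>z\<close>, \<open>w\<close> and infinity; otherwise it is empty, so edges running to the
  left are covered by \<open>above w z\<close>.\<close>

definition above :: "complex \<Rightarrow> complex \<Rightarrow> complex set" where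
  "above z w = {p. 0 < Im p \<and> Re z < Re p \<and> Re p < Re w \<and> 0 < cross z w p}"

lemma Im_disc_pos_iff:
  assumes "Im p > 0" "Im z > 0" "Re p \<noteq> Re z"
  shows "Im (disc p z) > 0 \<longleftrightarrow> Re z < Re p" and "Im (disc p z) < 0 \<longleftrightarrow> Re p < Re z"
proof -
  have "(cmod (z - cnj p))\<^sup>2 > 0" using diff_cnj_nonzero[OF assms(1,2)] by simp
  then show "Im (disc p z) > 0 \<longleftrightarrow> Re z < Re p" "Im (disc p z) < 0 \<longleftrightarrow> Re p < Re z"
    unfolding Im_disc[OF assms(1,2)] using assms(1)
    by (simp_all add: zero_less_divide_iff divide_less_0_iff zero_less_mult_iff mult_less_0_iff)
qed

lemma Arg_quotient_eq:
  assumes "a \<noteq> 0" "b \<noteq> 0" "\<bar>Arg b - Arg a + 2 * pi * k\<bar> < pi" "k \<in> \<int>"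
  shows "Arg (b / a) = Arg b - Arg a + 2 * pi * k"
proof (rule Arg_eq_mod_2pi)
  have "cis (2 * pi * k) = 1" using assms(4) by (simp add: cis_multiple_2pi)
  then show "cis (Arg (b / a)) = cis (Arg b - Arg a + 2 * pi * k)"
    using assms(1,2) by (simp add: cis_Arg_divide flip: cis_divide cis_mult)
  show "\<bar>Arg (b / a) - (Arg b - Arg a + 2 * pi * k)\<bar> < 2 * pi"
    using assms(3) mpi_less_Arg[of "b / a"] Arg_le_pi[of "b / a"] by linarith
qed

lemma Arg_inverse_not_nonpos: "u \<notin> \<real>\<^sub>\<le>\<^sub>0 \<Longrightarrow> Arg (inverse u) = - Arg u"
  by (cases "u \<in> \<real>") (auto simp: Arg_inverse Arg_real complex_nonpos_Reals_iff complex_is_Real_iff)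

text \<open>In the disc centred at \<open>p\<close>, the points straight below \<open>p\<close> lie
  on the negative real axis, which is where \<open>Arg\<close> jumps. So the principal argument of
  the quotient differs from the difference of arguments by a full turn exactly when the edge passes
  below \<open>p\<close>. Summed over a closed tuple, the differences cancel, and the angle sum
  becomes a signed count of the edges below \<open>p\<close>.\<close>

lemma Arg_quotient_cross:
  assumes "Im p > 0" "Im z > 0" "Im w > 0" "p \<notin> hyp_segment z w" "Re p \<noteq> Re z" "Re p \<noteq> Re w"
  shows "Arg (disc p w / disc p z) = Arg (disc p w) - Arg (disc p z) +
    2 * pi * (indicator (above z w) p - indicator (above w z) p)"
proof -
  have main: "Arg (disc p w / disc p z) = Arg (disc p w) - Arg (disc p z) + 2 * pi * indicator (above z w) p"
    if a: "Im p > 0" "Im z > 0" "Im w > 0" "p \<notin> hyp_segment z w" "Re z < Re p" "Re p < Re w" for z w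
  proof -
    let ?a = "disc p z" and ?b = "disc p w"
    have nz: "?a \<noteq> 0" "?b \<noteq> 0" and q: "?b / ?a \<notin> \<real>\<^sub>\<le>\<^sub>0"
      using disc_quotient_not_nonpos a by blast+
    have "Im ?a > 0" "Im ?b < 0" using Im_disc_pos_iff a by auto
    then have A: "0 < Arg ?a" "Arg ?a < pi" "Arg ?b < 0" "- pi < Arg ?b"
      using Arg_lt_pi Arg_neg_iff mpi_less_Arg by auto
    have "?b * cnj ?a = of_real (cmod ?b * cmod ?a) * cis (Arg ?b - Arg ?a)"
      by (subst (1) rcis_cmod_Arg[symmetric, of ?b], subst (1) rcis_cmod_Arg[symmetric, of ?a])
        (simp add: rcis_def cis_cnj cis_mult)
    then have "Im (?b * cnj ?a) = cmod ?b * cmod ?a * sin (Arg ?b - Arg ?a)" by simp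
    moreover have "Im (?b * cnj ?a) > 0 \<longleftrightarrow> cross z w p > 0"
      unfolding Im_disc_cross[OF a(1-3)]
      using a(1) diff_cnj_nonzero[OF a(1,2)] diff_cnj_nonzero[OF a(1,3)]
      by (simp add: zero_less_divide_iff zero_less_mult_iff mult_less_0_iff)
    moreover have "cmod ?b * cmod ?a > 0" using nz by simp
    moreover have "p \<in> above z w \<longleftrightarrow> cross z w p > 0" using a by (auto simp: above_def)
    ultimately have sgn: "p \<in> above z w \<longleftrightarrow> sin (Arg ?b - Arg ?a) > 0"
      by (metis zero_less_mult_pos mult_pos_pos)
    \<comment> \<open>A difference of exactly \<open>- pi\<close> would mean opposite directions,
      hence \<open>p\<close> on the edge.\<close>
    have ne: "Arg ?b - Arg ?a \<noteq> - pi"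
    proof
      assume e: "Arg ?b - Arg ?a = - pi"
      have "cis (Arg (?b / ?a)) = cis (Arg ?b - Arg ?a)"
        using nz by (simp add: cis_Arg_divide flip: cis_divide)
      also have "\<dots> = cis pi" unfolding e by (simp add: complex_eq_iff)
      finally have "Arg (?b / ?a) = pi"
        by (intro Arg_eq_mod_2pi) (use mpi_less_Arg[of "?b / ?a"] Arg_le_pi[of "?b / ?a"] in \<open>auto simp: abs_if\<close>)
      then have "Re (?b / ?a) < 0 \<and> Im (?b / ?a) = 0" by (simp only: Arg_eq_pi)
      then show False using q by (simp add: complex_nonpos_Reals_iff)
    qed
    show ?thesis
    proof (cases "p \<in> above z w")
      case True
      then have "sin (Arg ?b - Arg ?a) > 0" using sgn by simp
      moreover have "sin (- (Arg ?b - Arg ?a)) > 0" if "Arg ?b - Arg ?a > - pi"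
        using that A by (intro sin_gt_zero) auto
      ultimately have "Arg ?b - Arg ?a < - pi"
        using ne by (metis sin_minus neg_0_less_iff_less not_less_iff_gr_or_eq)
      then show ?thesis using True A nz Arg_quotient_eq[of ?a ?b 1] by simp
    next
      case False
      then have s: "sin (Arg ?b - Arg ?a) \<le> 0" using sgn by simp
      have "Arg ?b - Arg ?a > - pi"
      proof (rule ccontr)
        assume "\<not> ?thesis"
        then have "0 < Arg ?b - Arg ?a + 2 * pi" "Arg ?b - Arg ?a + 2 * pi < pi"
          using ne A by auto
        then have "sin (Arg ?b - Arg ?a + 2 * pi) > 0" using sin_gt_zero by blast
        then show False using s by (simp only: sin_periodic)
      qed
      then show ?thesis using False A nz Arg_quotient_eq[of ?a ?b 0] by simp
    qed
  qed
  have d: "disc p z \<noteq> 0" "disc p w \<noteq> 0" and q: "disc p w / disc p z \<notin> \<real>\<^sub>\<le>\<^sub>0"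
    using disc_quotient_not_nonpos assms by blast+
  consider "Re z < Re p" "Re p < Re w" | "Re w < Re p" "Re p < Re z"
    | "Re p < Re z" "Re p < Re w" | "Re z < Re p" "Re w < Re p"
    using assms(5,6) by linarith
  then show ?thesis
  proof cases
    case 1
    then have "p \<notin> above w z" by (auto simp: above_def)
    then show ?thesis using main[OF assms(1-4) 1] by simp
  next
    case 2
    have "p \<notin> hyp_segment w z" using assms(4) hyp_segment_sym by blast
    from main[OF assms(1,3,2) this 2]
    have e: "Arg (disc p z / disc p w) = Arg (disc p z) - Arg (disc p w) + 2 * pi * indicator (above w z) p" .
    have "disc p z / disc p w = inverse (disc p w / disc p z)" by simp
    moreover have "Arg (inverse (disc p w / disc p z)) = - Arg (disc p w / disc p z)"
      using q by (rule Arg_inverse_not_nonpos)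
    moreover have "p \<notin> above z w" using 2 by (auto simp: above_def)
    ultimately show ?thesis using e by simp
  next
    case 3
    then have "Im (disc p z) < 0" "Im (disc p w) < 0" using Im_disc_pos_iff assms by auto
    then have "Arg (disc p z) < 0" "Arg (disc p w) < 0" using Arg_neg_iff by auto
    then have "\<bar>Arg (disc p w) - Arg (disc p z) + 2 * pi * 0\<bar> < pi"
      using mpi_less_Arg[of "disc p z"] mpi_less_Arg[of "disc p w"] by (simp add: abs_if)
    moreover have "p \<notin> above z w" "p \<notin> above w z" using 3 by (auto simp: above_def)
    ultimately show ?thesis using Arg_quotient_eq[OF d, of 0] by simp
  next
    case 4
    then have "Im (disc p z) > 0" "Im (disc p w) > 0" using Im_disc_pos_iff assms by auto
    then have "0 < Arg (disc p z)" "Arg (disc p z) < pi" "0 < Arg (disc p w)" "Arg (disc p w) < pi"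
      using Arg_lt_pi by auto
    then have "\<bar>Arg (disc p w) - Arg (disc p z) + 2 * pi * 0\<bar> < pi"
      by (simp add: abs_if)
    moreover have "p \<notin> above z w" "p \<notin> above w z" using 4 by (auto simp: above_def)
    ultimately show ?thesis using Arg_quotient_eq[OF d, of 0] by simp
  qed
qed

section \<open>Hyperbolic area of the region above a geodesic\<close>

lemma lborel_complex_eq:
  "(lborel :: complex measure) = distr (lborel \<Otimes>\<^sub>M lborel) borel (\<lambda>(x, y). Complex x y)"
proof (rule lborel_eqI)
  have C: "(\<lambda>(x, y). Complex x y) \<in> borel_measurable (lborel \<Otimes>\<^sub>M lborel)"
    unfolding lborel_prod Complex_eq case_prod_unfold
    by (simp, intro borel_measurable_continuous_onI continuous_intros)
  fix l u :: complex
  assume lu: "\<And>b. b \<in> Basis \<Longrightarrow> l \<bullet> b \<le> u \<bullet> b"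
  have le: "Re l \<le> Re u" "Im l \<le> Im u" using lu[of 1] lu[of \<i>] by (simp_all add: Basis_complex_def)
  have "(\<lambda>(x, y). Complex x y) -` box l u \<inter> space (lborel \<Otimes>\<^sub>M lborel) =
      {Re l<..<Re u} \<times> {Im l<..<Im u}"
    by (auto simp: in_box_complex_iff space_pair_measure)
  then have "emeasure (distr (lborel \<Otimes>\<^sub>M lborel) borel (\<lambda>(x, y). Complex x y)) (box l u) =
      emeasure (lborel \<Otimes>\<^sub>M lborel) ({Re l<..<Re u} \<times> {Im l<..<Im u})"
    using C by (subst emeasure_distr) auto
  also have "\<dots> = ennreal ((Re u - Re l) * (Im u - Im l))"
    using le by (simp add: lborel.emeasure_pair_measure_Times ennreal_mult)
  finally show "emeasure (distr (lborel \<Otimes>\<^sub>M lborel) borel (\<lambda>(x, y). Complex x y)) (box l u) =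
      (\<Prod>b\<in>Basis. (u - l) \<bullet> b)"
    by (simp add: Basis_complex_def)
qed simp

lemma nn_integral_complex:
  assumes [measurable]: "f \<in> borel_measurable borel"
  shows "(\<integral>\<^sup>+z. f z \<partial>lborel) = (\<integral>\<^sup>+x. \<integral>\<^sup>+y. f (Complex x y) \<partial>lborel \<partial>lborel)"
proof -
  have C: "(\<lambda>(x, y). Complex x y) \<in> borel_measurable (lborel \<Otimes>\<^sub>M lborel)"
    unfolding lborel_prod Complex_eq case_prod_unfold
    by (simp, intro borel_measurable_continuous_onI continuous_intros)
  have "(\<integral>\<^sup>+z. f z \<partial>lborel) = (\<integral>\<^sup>+q. f (case q of (x, y) \<Rightarrow> Complex x y) \<partial>(lborel \<Otimes>\<^sub>M lborel))"
    by (subst lborel_complex_eq, subst nn_integral_distr[OF C]) auto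
  also have "\<dots> = (\<integral>\<^sup>+x. \<integral>\<^sup>+y. f (Complex x y) \<partial>lborel \<partial>lborel)"
    using C by (subst lborel.nn_integral_fst[symmetric]) auto
  finally show ?thesis .
qed

lemma nn_integral_inverse_square:
  assumes "a > 0"
  shows "(\<integral>\<^sup>+y. ennreal (1 / y\<^sup>2) * indicator {a<..} y \<partial>lborel) = ennreal (1 / a)"
proof -
  have "(\<integral>\<^sup>+y. ennreal (1 / y\<^sup>2) * indicator {a<..} y \<partial>lborel) =
      (\<integral>\<^sup>+y. ennreal (1 / y\<^sup>2) * indicator {a..} y \<partial>lborel)"
  proof (rule nn_integral_cong_AE)
    have "AE y in lborel. y \<noteq> a" by (rule AE_lborel_singleton)
    then show "AE y in lborel. ennreal (1 / y\<^sup>2) * indicator {a<..} y = ennreal (1 / y\<^sup>2) * indicator {a..} y"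
      by eventually_elim (auto simp: indicator_def)
  qed
  also have "\<dots> = ennreal (0 - (- 1 / a))"
  proof (rule nn_integral_FTC_atLeast)
    fix y assume "a \<le> y"
    then show "((\<lambda>y. - 1 / y) has_real_derivative 1 / y\<^sup>2) (at y)"
      using assms by (auto intro!: derivative_eq_intros simp: power2_eq_square)
  next
    show "((\<lambda>y :: real. - 1 / y) \<longlongrightarrow> 0) at_top"
      using tendsto_divide_0[OF tendsto_const[of "- 1 :: real"] filterlim_at_top_imp_at_infinity[OF filterlim_ident]] .
  qed auto
  finally show ?thesis by simp
qed

lemma square_less_bounds:
  fixes u r :: real
  assumes "r > 0" "u\<^sup>2 < r\<^sup>2"
  shows "- 1 < u / r" "u / r < 1"
proof -
  have "\<bar>u\<bar> < r" using assms power2_less_imp_less[of "\<bar>u\<bar>" r] by simp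
  then show "- 1 < u / r" "u / r < 1"
    using assms(1) by (simp_all add: pos_less_divide_eq pos_divide_less_eq abs_less_iff)
qed

lemma sqrt_less_iff_square:
  fixes y Y :: real
  assumes "Y > 0"
  shows "sqrt Y < y \<longleftrightarrow> 0 < y \<and> Y < y\<^sup>2"
proof (cases "y > 0")
  case True
  then have "sqrt Y < y \<longleftrightarrow> sqrt Y < sqrt (y\<^sup>2)" by simp
  also have "\<dots> \<longleftrightarrow> Y < y\<^sup>2" by (rule real_sqrt_less_iff)
  finally show ?thesis using True by simp
next
  case False
  moreover have "sqrt Y > 0" using assms by simp
  ultimately show ?thesis by linarith
qed

text \<open>The two arcsines are the angles of the end points, measured from the vertical at the
  centre \<open>c\<close> of the circle; the claim is the formula tan((b - a)/2) = (sin b - sin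
  a)/(cos a + cos b), in which the radius cancels.\<close>

lemma arcsin_diff_half_plane:
  fixes x1 x2 c r y1 y2 :: real
  assumes "y1 > 0" "y2 > 0" "r > 0" "(x1 - c)\<^sup>2 + y1\<^sup>2 = r\<^sup>2" "(x2 - c)\<^sup>2 + y2\<^sup>2 = r\<^sup>2"
  shows "arcsin ((x2 - c) / r) - arcsin ((x1 - c) / r) = 2 * arctan ((x2 - x1) / (y1 + y2))"
proof -
  define a where "a = arcsin ((x1 - c) / r)"
  define b where "b = arcsin ((x2 - c) / r)"
  have aux: "\<bar>arcsin ((x - c) / r)\<bar> < pi / 2 \<and> sin (arcsin ((x - c) / r)) = (x - c) / r \<and> cos (arcsin ((x - c) / r)) = y / r"
    if "y > 0" "(x - c)\<^sup>2 + y\<^sup>2 = r\<^sup>2" for x y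
  proof -
    have "(x - c)\<^sup>2 < r\<^sup>2" using zero_less_power[OF that(1), of 2] that(2) by linarith
    then have l: "- 1 < (x - c) / r" "(x - c) / r < 1" using assms(3) square_less_bounds by blast+
    have "1 - ((x - c) / r)\<^sup>2 = (y / r)\<^sup>2"
      using that(2) assms(3) by (simp add: power_divide field_simps)
    then have "sqrt (1 - ((x - c) / r)\<^sup>2) = y / r" using that(1) assms(3) by simp
    then show ?thesis using l arcsin_lt_bounded[OF l] by (auto simp: cos_arcsin abs_less_iff)
  qed
  have A: "\<bar>a\<bar> < pi / 2" "sin a = (x1 - c) / r" "cos a = y1 / r"
    using aux[OF assms(1,4)] by (auto simp: a_def)
  have B: "\<bar>b\<bar> < pi / 2" "sin b = (x2 - c) / r" "cos b = y2 / r"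
    using aux[OF assms(2,5)] by (auto simp: b_def)
  have c0: "cos ((a + b) / 2) > 0" "cos ((b - a) / 2) > 0"
    using A(1) B(1) by (intro cos_gt_zero_pi; simp add: abs_less_iff)+
  have "sin b - sin a = 2 * sin ((b - a) / 2) * cos ((b + a) / 2)" by (rule sin_diff_sin)
  moreover have "cos a + cos b = 2 * cos ((a + b) / 2) * cos ((a - b) / 2)" by (rule cos_plus_cos)
  moreover have "cos ((a - b) / 2) = cos ((b - a) / 2)" by (metis cos_minus minus_diff_eq minus_divide_left)
  ultimately have "(sin b - sin a) / (cos a + cos b) = tan ((b - a) / 2)"
    using c0 by (simp add: tan_def add.commute)
  moreover have "(sin b - sin a) / (cos a + cos b) = (x2 - x1) / (y1 + y2)"
    unfolding A B using assms(3) by (simp add: diff_divide_distrib[symmetric] add_divide_distrib[symmetric])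
  ultimately have "tan ((b - a) / 2) = (x2 - x1) / (y1 + y2)" by simp
  then have "arctan ((x2 - x1) / (y1 + y2)) = (b - a) / 2"
    using A(1) B(1) by (intro arctan_unique) (auto simp: abs_less_iff)
  then show ?thesis by (simp add: a_def b_def)
qed

lemma nn_integral_above:
  assumes "Im z > 0" "Im w > 0" "Re z < Re w"
  shows "(\<integral>\<^sup>+p. ennreal (1 / (Im p)\<^sup>2) * indicator (above z w) p \<partial>lborel) = ennreal (edge_area z w)"
proof -
  \<comment> \<open>The centre, on the real axis, of the circle carrying the geodesic;
    \<open>r\<close> below is its radius.\<close>
  define c where "c = ((cmod w)\<^sup>2 - (cmod z)\<^sup>2) / (2 * (Re w - Re z))"
  define R where "R = (Re z - c)\<^sup>2 + (Im z)\<^sup>2"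
  have "2 * (N / (2 * D)) * D = N" if "D \<noteq> 0" for N D :: real using that by simp
  then have cc: "2 * c * (Re w - Re z) = (cmod w)\<^sup>2 - (cmod z)\<^sup>2"
    unfolding c_def using assms(3) by (metis eq_iff_diff_eq_0 less_irrefl)
  have R2: "(Re w - c)\<^sup>2 + (Im w)\<^sup>2 = R"
    using cc unfolding R_def cmod_power2 by (simp add: power2_eq_square algebra_simps)
  have R0: "R > 0" unfolding R_def using assms(1) by (simp add: add_nonneg_pos)
  define r where "r = sqrt R"
  have r: "r > 0" "r\<^sup>2 = R" using R0 by (auto simp: r_def)
  have cr: "cross z w p = (Re w - Re z) * ((Im p)\<^sup>2 - (r\<^sup>2 - (Re p - c)\<^sup>2))" for p
  proof -
    have "cross z w p = (Re w - Re z) * (cmod p)\<^sup>2 - 2 * c * (Re w - Re z) * Re p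
      + (2 * c * (Re w - Re z) + (cmod z)\<^sup>2) * Re z - (cmod z)\<^sup>2 * Re w"
      unfolding cross_def cc by simp
    then show ?thesis unfolding r(2) R_def cmod_power2 by (simp add: power2_eq_square algebra_simps)
  qed
  have Y: "r\<^sup>2 - (x - c)\<^sup>2 > 0" if "Re z \<le> x" "x \<le> Re w" for x
  proof -
    have "\<bar>x - c\<bar> \<le> \<bar>Re z - c\<bar> \<or> \<bar>x - c\<bar> \<le> \<bar>Re w - c\<bar>" using that by linarith
    then have "(x - c)\<^sup>2 \<le> (Re z - c)\<^sup>2 \<or> (x - c)\<^sup>2 \<le> (Re w - c)\<^sup>2" by (simp add: abs_le_square_iff)
    moreover have "(Re z - c)\<^sup>2 < r\<^sup>2" "(Re w - c)\<^sup>2 < r\<^sup>2"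
      using R2 R_def r(2) zero_less_power[OF assms(1), of 2] zero_less_power[OF assms(2), of 2] by linarith+
    ultimately show ?thesis by linarith
  qed
  have meas: "(\<lambda>p. ennreal (1 / (Im p)\<^sup>2) * indicator (above z w) p) \<in> borel_measurable borel"
  proof -
    have "open (above z w)"
      unfolding above_def cross_def by (intro open_Collect_conj open_Collect_less continuous_intros)
    then have [measurable]: "above z w \<in> sets borel" by simp
    show ?thesis by measurable
  qed
  \<comment> \<open>Each vertical line meets the region in a ray that starts on the circle, so the
    inner integral is the reciprocal of the height there.\<close>
  have inner: "(\<integral>\<^sup>+y. ennreal (1 / (Im (Complex x y))\<^sup>2) * indicator (above z w) (Complex x y) \<partial>lborel) =
     ennreal (1 / sqrt (r\<^sup>2 - (x - c)\<^sup>2)) * indicator {Re z<..<Re w} x" for x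
  proof (cases "Re z < x \<and> x < Re w")
    case True
    then have y: "r\<^sup>2 - (x - c)\<^sup>2 > 0" using Y by simp
    have "indicator (above z w) (Complex x y) = (indicator {sqrt (r\<^sup>2 - (x - c)\<^sup>2)<..} y :: ennreal)" for y
    proof -
      have "Complex x y \<in> above z w \<longleftrightarrow> 0 < y \<and> r\<^sup>2 - (x - c)\<^sup>2 < y\<^sup>2"
        using True by (auto simp: above_def cr zero_less_mult_iff)
      also have "\<dots> \<longleftrightarrow> sqrt (r\<^sup>2 - (x - c)\<^sup>2) < y"
        using sqrt_less_iff_square[of "r\<^sup>2 - (x - c)\<^sup>2" y] y by simp
      finally show ?thesis by (simp add: indicator_def)
    qed
    then show ?thesis using nn_integral_inverse_square[of "sqrt (r\<^sup>2 - (x - c)\<^sup>2)"] y True by simp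
  next
    case False
    then have "Complex x y \<notin> above z w" for y by (auto simp: above_def)
    then show ?thesis using False by auto
  qed
  have "(\<integral>\<^sup>+p. ennreal (1 / (Im p)\<^sup>2) * indicator (above z w) p \<partial>lborel) =
     (\<integral>\<^sup>+x. ennreal (1 / sqrt (r\<^sup>2 - (x - c)\<^sup>2)) * indicator {Re z<..<Re w} x \<partial>lborel)"
    unfolding nn_integral_complex[OF meas] inner ..
  also have "\<dots> = (\<integral>\<^sup>+x. ennreal (1 / sqrt (r\<^sup>2 - (x - c)\<^sup>2)) * indicator {Re z..Re w} x \<partial>lborel)"
  proof (rule nn_integral_cong_AE)
    have "AE x in lborel. x \<noteq> Re z" "AE x in lborel. x \<noteq> Re w" by (rule AE_lborel_singleton)+
    then show "AE x in lborel. ennreal (1 / sqrt (r\<^sup>2 - (x - c)\<^sup>2)) * indicator {Re z<..<Re w} x =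
       ennreal (1 / sqrt (r\<^sup>2 - (x - c)\<^sup>2)) * indicator {Re z..Re w} x"
      by eventually_elim (auto simp: indicator_def)
  qed
  also have "\<dots> = ennreal (arcsin ((Re w - c) / r) - arcsin ((Re z - c) / r))"
  proof (rule nn_integral_FTC_Icc)
    fix x assume "x \<in> {Re z..Re w}"
    then have x: "Re z \<le> x" "x \<le> Re w" by auto
    then have y: "(x - c)\<^sup>2 < r\<^sup>2" using Y by simp
    then have l: "- 1 < (x - c) / r" "(x - c) / r < 1" using r(1) square_less_bounds by blast+
    have "1 - ((x - c) / r)\<^sup>2 = (r\<^sup>2 - (x - c)\<^sup>2) / r\<^sup>2" using r(1) by (simp add: power_divide field_simps)
    then have s: "sqrt (1 - ((x - c) / r)\<^sup>2) = sqrt (r\<^sup>2 - (x - c)\<^sup>2) / r"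
      using r(1) by (simp add: real_sqrt_divide)
    have "((\<lambda>x. arcsin ((x - c) / r)) has_real_derivative inverse (sqrt (1 - ((x - c) / r)\<^sup>2)) * (1 / r)) (at x)"
    proof (rule DERIV_chain2[where f = arcsin and g = "\<lambda>x. (x - c) / r"])
      show "(arcsin has_real_derivative inverse (sqrt (1 - ((x - c) / r)\<^sup>2))) (at ((x - c) / r))"
        by (rule DERIV_arcsin[OF l])
      show "((\<lambda>x. (x - c) / r) has_real_derivative 1 / r) (at x)"
        using r(1) by (auto intro!: derivative_eq_intros)
    qed
    then show "((\<lambda>x. arcsin ((x - c) / r)) has_real_derivative 1 / sqrt (r\<^sup>2 - (x - c)\<^sup>2)) (at x)"
      unfolding s using r(1) by (simp add: field_simps)
    show "0 \<le> 1 / sqrt (r\<^sup>2 - (x - c)\<^sup>2)" using Y[OF x] by simp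
  qed (use assms(3) in auto)
  also have "arcsin ((Re w - c) / r) - arcsin ((Re z - c) / r) = edge_area z w"
    unfolding edge_area_def
    by (rule arcsin_diff_half_plane) (use assms r R2 R_def in auto)
  finally show ?thesis .
qed

lemma has_integral_above:
  assumes "Im z > 0" "Im w > 0"
  shows "has_bochner_integral lborel (\<lambda>p. (indicator (above z w) p - indicator (above w z) p) / (Im p)\<^sup>2)
    (edge_area z w)"
proof -
  have one: "has_bochner_integral lborel (\<lambda>p. (indicator (above z w) p - indicator (above w z) p) / (Im p)\<^sup>2)
    (edge_area z w)" if zw: "Im z > 0" "Im w > 0" "Re z < Re w" for z w
  proof -
    have e: "above w z = {}" using zw by (auto simp: above_def)
    have "open (above z w)"
      unfolding above_def cross_def by (intro open_Collect_conj open_Collect_less continuous_intros)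
    then have [measurable]: "above z w \<in> sets borel" by simp
    have nn: "(\<integral>\<^sup>+p. ennreal (indicator (above z w) p / (Im p)\<^sup>2) \<partial>lborel) = ennreal (edge_area z w)"
      unfolding nn_integral_above[OF zw, symmetric]
      by (intro nn_integral_cong) (auto simp: indicator_def)
    have "edge_area z w \<ge> 0"
      unfolding edge_area_def using zw by simp
    then have "has_bochner_integral lborel (\<lambda>p. indicator (above z w) p / (Im p)\<^sup>2) (edge_area z w)"
      by (intro has_bochner_integral_nn_integral nn) auto
    then show ?thesis by (simp add: e)
  qed
  consider "Re z < Re w" | "Re w < Re z" | "Re z = Re w" by linarith
  then show ?thesis
  proof cases
    case 1
    then show ?thesis using one assms by blast
  next
    case 2
    have "has_bochner_integral lborel (\<lambda>p. - ((indicator (above w z) p - indicator (above z w) p) / (Im p)\<^sup>2))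
      (- edge_area w z)"
      by (intro has_bochner_integral_minus one assms 2)
    then show ?thesis by (simp add: edge_area_sym[of z w] minus_divide_left)
  next
    case 3
    then have "above z w = {}" "above w z = {}" by (auto simp: above_def)
    then show ?thesis using 3 by (simp add: edge_area_def has_bochner_integral_zero)
  qed
qed

lemma negligible_hyp_segment:
  assumes "Im z > 0" "Im w > 0"
  shows "negligible (hyp_segment z w)"
  unfolding hyp_segment_eq_image[OF assms]
proof (rule negligible_differentiable_image_lowdim)
  show "(\<lambda>t. undisc z (of_real t * disc z w)) differentiable_on {0..1}"
    unfolding differentiable_on_def
  proof
    fix t :: real assume t: "t \<in> {0..1}"
    have nz: "1 - of_real t * disc z w \<noteq> 0" using norm_scaled_disc_less_1[OF assms t] by auto
    have "(undisc z has_field_derivative ((- cnj z) * (1 - of_real t * disc z w) +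
        (z - cnj z * (of_real t * disc z w))) / ((1 - of_real t * disc z w) * (1 - of_real t * disc z w)))
        (at (of_real t * disc z w))"
      unfolding undisc_def using nz by (auto intro!: derivative_eq_intros)
    moreover have "((\<lambda>t. of_real t * disc z w) has_vector_derivative disc z w) (at t)"
      by (auto intro!: derivative_eq_intros)
    ultimately have "(undisc z \<circ> (\<lambda>t. of_real t * disc z w) has_vector_derivative disc z w * 
      (((- cnj z) * (1 - of_real t * disc z w) +
        (z - cnj z * (of_real t * disc z w))) / ((1 - of_real t * disc z w) * (1 - of_real t * disc z w)))) (at t)"
      by (rule field_vector_diff_chain_at[rotated])
    then show "(\<lambda>t. undisc z (of_real t * disc z w)) differentiable at t within {0..1}"
      by (auto simp: o_def intro: differentiableI_vector differentiable_at_withinI)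
  qed
qed auto

context polygon
begin

lemma negligible_B: "negligible B"
  unfolding B_eq by (intro negligible_Union) (auto simp: negligible_hyp_segment Im_V)

lemma compact_B: "compact B"
  using compact_path_image[OF loop_basic(1)] loop_basic(4) by simp

lemma closed_B: "closed B"
  by (rule compact_imp_closed[OF compact_B])

lemma borel_region: "poly_region vs \<in> sets borel"
proof -
  have "B \<in> sets borel" by (rule borel_closed[OF closed_B])
  moreover have "inside B \<in> sets borel" by (rule borel_open[OF open_inside[OF closed_B]])
  ultimately show ?thesis unfolding poly_region_def by (rule sets.Un)
qed

text \<open>Vertical lines through vertices are discarded because the count in
  \<open>Arg_quotient_cross\<close> assumes that \<open>p\<close> has no vertex on its vertical
  line.\<close>

lemma AE_generic: "AE p in lborel. p \<notin> B \<and> (\<forall>i<n. Re p \<noteq> Re (V i))"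
proof -
  have 1: "AE p in lborel. p \<notin> S" if "negligible S" "closed S" for S :: "complex set"
  proof -
    have "S \<in> null_sets lborel"
      using that by (simp add: negligible_iff_null_sets null_sets_completion_iff)
    then show ?thesis by (rule AE_not_in)
  qed
  have "AE p in lborel. Re p \<noteq> Re (V i)" for i
  proof -
    have e: "{p. Re p = Re (V i)} = {p. 1 \<bullet> p = Re (V i)}" by (simp add: inner_complex_def)
    have "AE p in lborel. p \<notin> {p. Re p = Re (V i)}"
      unfolding e by (intro 1 negligible_hyperplane closed_hyperplane) simp
    then show ?thesis by simp
  qed
  then have "AE p in lborel. \<forall>i<n. Re p \<noteq> Re (V i)" by (simp add: AE_all_countable)
  moreover have "AE p in lborel. p \<notin> B" by (rule 1[OF negligible_B closed_B])
  ultimately show ?thesis by eventually_elim auto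
qed

text \<open>Almost everywhere, the signed number of edges below a point is its winding number, which
  is \<open>e\<close> inside and 0 outside. Weighting by \<open>1 / (Im p)\<^sup>2\<close> and
  integrating turns this pointwise identity into the formula.\<close>

lemma Area_eq:
  assumes o: "orientation e"
  shows "Area vs = e * (\<Sum>i<n. edge_area (V i) (V (Suc i)))"
proof -
  have e: "e \<in> {1, -1}"
    and w: "\<And>p. Im p > 0 \<Longrightarrow> p \<notin> B \<Longrightarrow> wsum p = 2 * pi * (if p \<in> inside B then e else 0)"
    using o unfolding orientation_def by blast+
  define s where "s i p = (indicator (above (V i) (V (Suc i))) p - indicator (above (V (Suc i)) (V i)) p :: real)" for i p
  have s_hb: "has_bochner_integral lborel (\<lambda>p. e * (\<Sum>i<n. s i p / (Im p)\<^sup>2))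
      (e * (\<Sum>i<n. edge_area (V i) (V (Suc i))))"
    unfolding s_def by (intro has_bochner_integral_mult_right has_bochner_integral_sum has_integral_above Im_V)
  have "AE p in lborel. indicator (poly_region vs) p *\<^sub>R (1 / (Im p)\<^sup>2) = e * (\<Sum>i<n. s i p / (Im p)\<^sup>2)"
    using AE_generic
  proof eventually_elim
    case (elim p)
    show ?case
    proof (cases "Im p > 0")
      case False
      then have "p \<notin> poly_region vs"
        using B_subset inside_subset by (auto simp: poly_region_def hyp_plane_iff)
      moreover have "s i p = 0" for i using False by (auto simp: s_def above_def)
      ultimately show ?thesis by simp
    next
      case True
      have ns: "p \<notin> hyp_segment (V i) (V (Suc i))" if "i < n" for i
        using elim that by (auto simp: B_eq)
      have re: "Re p \<noteq> Re (V i)" for i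
        using elim n0 V_mod[of i] by (metis mod_less_divisor)
      have "wsum p = (\<Sum>i<n. Arg (disc p (V (Suc i))) - Arg (disc p (V i)) + 2 * pi * s i p)"
        unfolding wsum_def s_def
        by (intro sum.cong refl Arg_quotient_cross True Im_V ns re) auto
      \<comment> \<open>The single-vertex arguments cancel around the cycle, leaving only the
        jumps.\<close>
      also have "\<dots> = 2 * pi * (\<Sum>i<n. s i p)"
        unfolding sum.distrib sum_subtractf
        using sum_Suc_cyclic[of "\<lambda>i. Arg (disc p (V i))" n] by (simp add: sum_distrib_left)
      finally have "(\<Sum>i<n. s i p) = (if p \<in> inside B then e else 0)"
        using w[OF True] elim by simp
      then have "e * (\<Sum>i<n. s i p) = indicator (poly_region vs) p"
        using e elim by (auto simp: poly_region_def indicator_def)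
      then show ?thesis by (simp add: sum_divide_distrib[symmetric] mult.assoc[symmetric])
    qed
  qed
  moreover have "(\<lambda>p. indicator (poly_region vs) p *\<^sub>R (1 / (Im p)\<^sup>2)) \<in> borel_measurable lborel"
    using borel_region by measurable
  ultimately have "has_bochner_integral lborel (\<lambda>p. indicator (poly_region vs) p *\<^sub>R (1 / (Im p)\<^sup>2))
      (e * (\<Sum>i<n. edge_area (V i) (V (Suc i))))"
    using s_hb by (subst has_bochner_integral_cong_AE) (auto intro: borel_measurable_has_bochner_integral)
  then show ?thesis
    unfolding Area_def hyp_area_def set_lebesgue_integral_def
    by (rule has_bochner_integral_integral_eq)
qed

end

section \<open>Interior angles\<close>

text \<open>\<open>\<eta> t\<close> is the angle of direction \<open>t\<close> measured from
  direction \<open>b\<close>. The arc from \<open>c\<close> to \<open>d\<close> may stay below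
  \<open>2 * pi\<close>, be cut by it, or lie wholly beyond it, which gives the three cases.\<close>

lemma measure_arc_mod:
  fixes b c d :: real
  assumes "0 \<le> b" "b < 2 * pi" "0 \<le> c" "c \<le> d" "d \<le> 2 * pi"
  defines "\<eta> \<equiv> \<lambda>t. if b \<le> t then t - b else t - b + 2 * pi"
  shows "{t \<in> {0..<2 * pi}. c < \<eta> t \<and> \<eta> t < d} \<in> lmeasurable"
    and "measure lebesgue {t \<in> {0..<2 * pi}. c < \<eta> t \<and> \<eta> t < d} = d - c"
proof -
  let ?S = "{t \<in> {0..<2 * pi}. c < \<eta> t \<and> \<eta> t < d}"
  consider "b + d \<le> 2 * pi" | "b + c < 2 * pi" "2 * pi < b + d" | "2 * pi \<le> b + c" by linarith
  then have "?S \<in> lmeasurable \<and> measure lebesgue ?S = d - c"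
  proof cases
    case 1
    have "?S = {b + c<..<b + d}" using assms(1-5) 1 by (auto simp: \<eta>_def split: if_splits)
    then show ?thesis using assms(4) by simp
  next
    case 2
    have S: "?S = {b + c<..<2 * pi} \<union> {0..<b + d - 2 * pi}"
      using assms(1-5) 2 by (auto simp: \<eta>_def split: if_splits)
    have m: "{0..<b + d - 2 * pi} \<in> lmeasurable"
      by (rule bounded_set_imp_lmeasurable) auto
    have "measure lebesgue ?S = measure lebesgue {b + c<..<2 * pi} + measure lebesgue {0..<b + d - 2 * pi}"
    proof -
      have "{b + c<..<2 * pi} \<inter> {0..<b + d - 2 * pi} = {}" using assms(1-5) by auto
      then show ?thesis unfolding S using m by (subst measure_Un3) auto
    qed
    then show ?thesis using 2 m unfolding S by (auto intro!: fmeasurable.Un)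
  next
    case 3
    have "?S = {b + c - 2 * pi<..<b + d - 2 * pi}" using assms(1-5) 3 by (auto simp: \<eta>_def split: if_splits)
    then show ?thesis using assms(4) by simp
  qed
  then show "?S \<in> lmeasurable" "measure lebesgue ?S = d - c" by blast+
qed

lemma Arg2pi_cis_div:
  assumes "a \<noteq> 0" "t \<in> {0..<2 * pi}"
  shows "Arg2pi (cis t / a) = (if Arg2pi a \<le> t then t - Arg2pi a else t - Arg2pi a + 2 * pi)"
proof -
  let ?A = "Arg2pi a"
  have a: "a = rcis (cmod a) ?A" using Arg2pi_eq unfolding rcis_def cis_conv_exp by blast
  define k where "k = (if ?A \<le> t then 0 else 2 * pi)"
  have "cis t / a = rcis 1 t / rcis (cmod a) ?A" by (simp only: a[symmetric] cis_rcis_eq)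
  also have "\<dots> = of_real (1 / cmod a) * cis (t - ?A)" unfolding rcis_divide by (simp add: rcis_def)
  also have "cis (t - ?A) = cis (t - ?A + k)" by (simp add: k_def complex_eq_iff)
  finally have "of_real (1 / cmod a) * exp (\<i> * of_real (t - ?A + k)) = cis t / a"
    by (simp add: cis_conv_exp)
  then have "Arg2pi (cis t / a) = t - ?A + k"
    by (rule Arg2pi_unique) (use assms Arg2pi_ge_0[of a] Arg2pi_lt_2pi[of a] in \<open>auto simp: k_def\<close>)
  then show ?thesis by (simp add: k_def)
qed

text \<open>\<open>u\<close> is the direction of a ray relative to the next side and
  \<open>q\<close> that of the previous side. The two arguments are the limits of the angles that
  the next and the previous side subtend at a point running along the ray into the vertex; their sum
  jumps by a full turn as the ray passes the previous side.\<close>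

lemma Arg_cis_Arg2pi:
  assumes "u \<noteq> 0" "q \<noteq> 0" "0 < Arg2pi u" "Arg2pi u \<noteq> Arg2pi q"
  shows "- inverse u \<notin> \<real>\<^sub>\<le>\<^sub>0" "- (u / q) \<notin> \<real>\<^sub>\<le>\<^sub>0"
    "Arg (- inverse u) + Arg (- (u / q)) = (if Arg2pi u < Arg2pi q then 2 * pi - Arg2pi q else - Arg2pi q)"
proof -
  let ?h = "Arg2pi u" and ?T = "Arg2pi q"
  have u: "u = rcis (cmod u) ?h" and q: "q = rcis (cmod q) ?T"
    using Arg2pi_eq unfolding rcis_def cis_conv_exp by blast+
  have b: "0 \<le> ?T" "?T < 2 * pi" "?h < 2 * pi" using Arg2pi_ge_0 Arg2pi_lt_2pi by auto

  have "- inverse u = rcis (inverse (cmod u)) (pi - ?h)"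
  proof -
    have "cis (pi - ?h) = - cis (- ?h)" by (simp add: complex_eq_iff)
    then show ?thesis by (subst u) (simp add: rcis_inverse rcis_def)
  qed
  then have A: "Arg (- inverse u) = pi - ?h"
    using b assms(1,3) by (simp add: Arg_rcis)
  define k where "k = (if ?h < ?T then pi else - pi)"
  have "- (u / q) = rcis (cmod u / cmod q) (?h - ?T + k)"
  proof -
    have "cis (?h - ?T + k) = - cis (?h - ?T)" by (simp add: k_def complex_eq_iff cos_diff sin_diff)
    moreover have "u / q = rcis (cmod u / cmod q) (?h - ?T)"
      using u q rcis_divide by metis
    ultimately show ?thesis by (simp add: rcis_def)
  qed
  then have B: "Arg (- (u / q)) = ?h - ?T + k"
    using b assms by (simp add: Arg_rcis k_def)
  have nonpos: "z \<notin> \<real>\<^sub>\<le>\<^sub>0" if "z \<noteq> 0" "Arg z \<noteq> pi" for z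
    using that by (auto simp: complex_nonpos_Reals_iff Arg_eq_pi complex_eq_iff order_le_less)
  have ne: "Arg (- inverse u) \<noteq> pi" "Arg (- (u / q)) \<noteq> pi"
    unfolding A B k_def using b assms(3,4) by auto
  show "- inverse u \<notin> \<real>\<^sub>\<le>\<^sub>0" by (rule nonpos[OF _ ne(1)]) (use assms in simp)
  show "- (u / q) \<notin> \<real>\<^sub>\<le>\<^sub>0" by (rule nonpos[OF _ ne(2)]) (use assms in simp)
  show "Arg (- inverse u) + Arg (- (u / q)) = (if ?h < ?T then 2 * pi - ?T else - ?T)"
    unfolding A B k_def by simp
qed

lemma eventually_notin_nonpos:
  assumes "(f \<longlongrightarrow> l) F" "(l::complex) \<notin> \<real>\<^sub>\<le>\<^sub>0"
  shows "\<forall>\<^sub>F x in F. f x \<notin> \<real>\<^sub>\<le>\<^sub>0"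
proof -
  have "open (- (\<real>\<^sub>\<le>\<^sub>0 :: complex set))" by (simp add: closed_nonpos_Reals_complex open_Compl)
  from topological_tendstoD[OF assms(1) this] assms(2) show ?thesis by auto
qed

lemma disc_tendsto:
  assumes "(f \<longlongrightarrow> v) F" "Im v > 0" "Im a > 0"
  shows "((\<lambda>r. disc (f r) a) \<longlongrightarrow> disc v a) F"
  unfolding disc_def by (intro tendsto_intros assms diff_cnj_nonzero)

text \<open>
  The interior angle is read off the limit of the winding number along a ray into the vertex: the two
  sides at the vertex contribute angles whose sum jumps by \<open>2\<pi>\<close> when the ray crosses a side.
\<close>

context polygon
begin

lemma prev_neq:
  assumes "i < n"
  shows "V (i + (n - 1)) \<noteq> V i" "V (i + (n - 1)) \<noteq> V (Suc i)" "V (Suc (i + (n - 1))) = V i"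
proof -
  have e: "Suc (i + (n - 1)) = i + n" using n0 by simp
  show s: "V (Suc (i + (n - 1))) = V i" unfolding e by simp
  show "V (i + (n - 1)) \<noteq> V i" using V_Suc_neq[of "i + (n - 1)"] s by simp
  have "(i + (n - 1)) mod n \<noteq> Suc i mod n"
  proof
    assume "(i + (n - 1)) mod n = Suc i mod n"
    then have "n dvd (i + (n - 1)) - Suc i" by (rule mod_eq_dvd_iff_nat[THEN iffD1, rotated]) (use n3 in auto)
    then have "n dvd n - 2" using n3 by simp
    then show False using n3 by (auto dest: dvd_imp_le)
  qed
  then show "V (i + (n - 1)) \<noteq> V (Suc i)"
    using V_eq_iff[of "(i + (n - 1)) mod n" "Suc i mod n"] n0 by (simp add: V_mod)
qed

lemma V_notin_side:
  assumes "i < n" "k < n" "k \<noteq> i" "k \<noteq> (i + (n - 1)) mod n"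
  shows "V i \<notin> hyp_segment (V k) (V (Suc k))"
proof
  assume "V i \<in> hyp_segment (V k) (V (Suc k))"
  moreover have "V i \<in> hyp_segment (V i) (V (Suc i))" using hyp_segment_ends Im_V by blast
  ultimately have "V i = V k \<or> V i = V (Suc k)" using sides_Int[OF assms(2,1,3)] by blast
  then have "V i = V (Suc k)" using V_eq_iff assms by auto
  then have "V i = V (Suc k mod n)" by (simp add: V_mod)
  then have "i = Suc k mod n" using V_eq_iff assms n0 by simp
  then have "(i + (n - 1)) mod n = (Suc k + (n - 1)) mod n" by (simp add: mod_add_left_eq)
  also have "Suc k + (n - 1) = k + n" using n0 by simp
  finally show False using assms by simp
qed

text \<open>With a zero angle both sides would lie on one radius, and the far end of the shorter
  would lie on the longer, against simplicity.\<close>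

lemma vertex_quotient:
  assumes "i < n"
  defines "P \<equiv> disc (V i) (V (i + (n - 1)))" and "Q \<equiv> disc (V i) (V (Suc i))"
  shows "P \<noteq> 0" "Q \<noteq> 0" "0 < Arg2pi (P / Q)"
proof -
  show nz: "P \<noteq> 0" "Q \<noteq> 0"
    unfolding P_def Q_def using prev_neq[OF assms(1)] V_Suc_neq[of i] disc_eq_0_iff Im_V by metis+
  show "0 < Arg2pi (P / Q)"
  proof (rule ccontr)
    assume "\<not> ?thesis"
    then have "Arg2pi (P / Q) = 0" using Arg2pi_ge_0[of "P / Q"] by linarith
    then have "P / Q \<in> \<real> \<and> 0 \<le> Re (P / Q)" by (simp only: Arg2pi_eq_0)
    then obtain s where s: "P / Q = of_real s" "s \<ge> 0" by (metis Reals_cases Re_complex_of_real)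
    then have PQ: "P = of_real s * Q" using nz by (simp add: field_simps)
    have s0: "s > 0" using s nz by (cases "s = 0") auto
    let ?j = "(i + (n - 1)) mod n"
    have Vj: "V ?j = V (i + (n - 1))" "V (Suc ?j) = V i"
      using prev_neq(3)[OF assms(1)] V_mod[of "i + (n - 1)"] V_mod[of "Suc (i + (n - 1))"] V_mod[of "Suc ?j"]
      by (simp_all add: mod_Suc_eq)
    have j: "?j < n" "?j \<noteq> i" using n0 prev_neq(1)[OF assms(1)] Vj by auto
    have int: "hyp_segment (V (i + (n - 1))) (V i) \<inter> hyp_segment (V i) (V (Suc i)) \<subseteq> {V i}"
      using sides_Int[OF j(1) assms(1) j(2)] prev_neq[OF assms(1)] unfolding Vj by auto
    have ends: "V (i + (n - 1)) \<in> hyp_segment (V (i + (n - 1))) (V i)" "V (Suc i) \<in> hyp_segment (V i) (V (Suc i))"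
      using hyp_segment_ends Im_V by blast+
    show False
    proof (cases "s \<le> 1")
      case True
      then have "V (i + (n - 1)) \<in> hyp_segment (V i) (V (Suc i))"
        using PQ s0 Im_V by (subst in_hyp_segment_iff) (auto simp: P_def Q_def)
      then show False using int ends prev_neq(1)[OF assms(1)] by blast
    next
      case False
      have "Q = of_real (1 / s) * P" using PQ s0 by simp
      then have "V (Suc i) \<in> hyp_segment (V i) (V (i + (n - 1)))"
        using False s0 Im_V by (subst in_hyp_segment_iff) (auto simp: P_def Q_def intro!: bexI[of _ "1 / s"])
      then show False using int ends V_Suc_neq[of i] hyp_segment_sym by blast
    qed
  qed
qed

text \<open>The derivative of \<open>disc v\<close> at \<open>v\<close> is a positive multiple of
  \<open>1 / \<i>\<close>, hence the factor \<open>\<i>\<close> in \<open>u\<close>, which is the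
  ray's direction relative to the next side. \<open>L\<close> is the limit of \<open>wsum\<close>
  along the ray and \<open>K\<close> the share of the sides not meeting the vertex. Off the boundary
  \<open>wsum\<close> has only the values 0 and \<open>2 * pi * e\<close>, so the limit decides on
  which side the ray starts.\<close>

lemma ray_limit:
  fixes t :: real
  assumes i: "i < n"
    and o: "orientation e"
  defines "P \<equiv> disc (V i) (V (i + (n - 1)))" and "Q \<equiv> disc (V i) (V (Suc i))"
  defines "K \<equiv> \<Sum>k\<in>{..<n} - {i} - {(i + (n - 1)) mod n}. Arg (disc (V i) (V (Suc k)) / disc (V i) (V k))"
  defines "u \<equiv> cis t / (\<i> * Q)"
  assumes u: "0 < Arg2pi u" "Arg2pi u \<noteq> Arg2pi (P / Q)"
  defines "L \<equiv> K + (if Arg2pi u < Arg2pi (P / Q) then 2 * pi - Arg2pi (P / Q) else - Arg2pi (P / Q))"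
  shows "L \<in> {0, 2 * pi * e}"
    and "(\<forall>\<^sub>F r in at_right 0. V i + of_real r * cis t \<in> poly_region vs) \<longleftrightarrow> L = 2 * pi * e"
proof -
  have e: "e \<in> {1, -1}"
    and w: "\<And>p. Im p > 0 \<Longrightarrow> p \<notin> B \<Longrightarrow> wsum p = 2 * pi * (if p \<in> inside B then e else 0)"
    using o unfolding orientation_def by blast+
  let ?v = "V i" and ?F = "at_right (0::real)" and ?j = "(i + (n - 1)) mod n"
  let ?p = "\<lambda>r::real. ?v + of_real r * cis t"
  note nz = vertex_quotient[OF i, folded P_def Q_def]
  have v: "Im ?v > 0" by (rule Im_V)
  have c: "cis t \<noteq> 0" by simp
  have u0: "u \<noteq> 0" using nz c by (simp add: u_def)
  have Vj: "V ?j = V (i + (n - 1))" "V (Suc ?j) = V i"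
    using prev_neq(3)[OF i] V_mod[of "i + (n - 1)"] V_mod[of "Suc (i + (n - 1))"] V_mod[of "Suc ?j"]
    by (simp_all add: mod_Suc_eq)
  have j: "?j < n" "?j \<noteq> i" using n0 prev_neq(1)[OF i] Vj by auto
  have "((\<lambda>r. ?p r) \<longlongrightarrow> ?v + of_real 0 * cis t) ?F"
    by (intro tendsto_intros)
  then have p: "(?p \<longlongrightarrow> ?v) ?F" by simp
  have rpos: "\<forall>\<^sub>F r in ?F. r > 0" by (simp add: eventually_at_right_less)
  note A = Arg_cis_Arg2pi[OF u0 _ u]
  have "P / Q \<noteq> 0" using nz by simp
  note A = A[OF this]
  have y: "?v - cnj ?v = of_real (2 * Im ?v) * \<i>" by (simp add: complex_diff_cnj)
  have pc: "((\<lambda>r. ?v - cnj (?p r)) \<longlongrightarrow> ?v - cnj ?v) ?F" by (intro tendsto_intros p)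
  have Q': "- inverse u = - (\<i> * Q / cis t)" unfolding u_def using nz c by simp
  have P': "- (u / (P / Q)) = \<i> * cis t / P" unfolding u_def using nz c by (simp add: field_simps)
  have scale: "of_real x * z \<notin> \<real>\<^sub>\<le>\<^sub>0 \<longleftrightarrow> z \<notin> \<real>\<^sub>\<le>\<^sub>0" if "x > 0" for x and z :: complex
    using that by (simp add: complex_nonpos_Reals_iff mult_le_0_iff)
  have lim1: "((\<lambda>r. Arg (disc (?p r) (V (Suc i)) / disc (?p r) ?v)) \<longlongrightarrow> Arg (- inverse u)) ?F"
  proof -
    \<comment> \<open>\<open>disc (?p r) ?v\<close> vanishes in the limit like a multiple of
      \<open>r\<close>. \<open>Arg\<close> ignores positive factors, so \<open>r\<close> is divided
      out first.\<close>
    have "((\<lambda>r. - (disc (?p r) (V (Suc i)) * (?v - cnj (?p r)) / cis t)) \<longlongrightarrow>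
        - (Q * (?v - cnj ?v) / cis t)) ?F"
      unfolding Q_def by (intro tendsto_intros disc_tendsto p pc v Im_V c)
    moreover have l: "- (Q * (?v - cnj ?v) / cis t) = of_real (2 * Im ?v) * (- inverse u)"
      unfolding y Q' by simp
    ultimately have "((\<lambda>r. Arg (- (disc (?p r) (V (Suc i)) * (?v - cnj (?p r)) / cis t))) \<longlongrightarrow>
        Arg (of_real (2 * Im ?v) * (- inverse u))) ?F"
    proof (intro tendsto_Arg)
      have "2 * Im ?v > 0" using v by simp
      then show "of_real (2 * Im ?v) * (- inverse u) \<notin> \<real>\<^sub>\<le>\<^sub>0" using A(1) by (rule scale[THEN iffD2])
    qed (simp only: l)
    moreover have "Arg (of_real (2 * Im ?v) * (- inverse u)) = Arg (- inverse u)"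
      using v by (intro Arg_times_of_real) simp
    moreover have "\<forall>\<^sub>F r in ?F. Arg (- (disc (?p r) (V (Suc i)) * (?v - cnj (?p r)) / cis t)) =
        Arg (disc (?p r) (V (Suc i)) / disc (?p r) ?v)"
      using rpos
    proof eventually_elim
      case (elim r)
      have "disc (?p r) (V (Suc i)) / disc (?p r) ?v =
          - (disc (?p r) (V (Suc i)) * (?v - cnj (?p r)) / cis t) / of_real r"
        unfolding disc_def[of "?p r" ?v] using elim c by simp
      then show ?case using elim by (simp only: Arg_divide_of_real)
    qed
    ultimately show ?thesis by (simp only: Lim_transform_eventually)
  qed
  have lim2: "((\<lambda>r. Arg (disc (?p r) ?v / disc (?p r) (V (i + (n - 1))))) \<longlongrightarrow> Arg (- (u / (P / Q)))) ?F"
  proof -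
    have "?v - cnj ?v \<noteq> 0" using diff_cnj_nonzero v by blast
    then have "((\<lambda>r. - (cis t / ((?v - cnj (?p r)) * disc (?p r) (V (i + (n - 1)))))) \<longlongrightarrow>
        - (cis t / ((?v - cnj ?v) * P))) ?F"
      unfolding P_def by (intro tendsto_intros disc_tendsto p pc v Im_V) (use nz P_def in auto)
    moreover have l: "- (cis t / ((?v - cnj ?v) * P)) = of_real (1 / (2 * Im ?v)) * (- (u / (P / Q)))"
      unfolding y P' using v nz by (simp add: field_simps)
    ultimately have "((\<lambda>r. Arg (- (cis t / ((?v - cnj (?p r)) * disc (?p r) (V (i + (n - 1))))))) \<longlongrightarrow>
        Arg (of_real (1 / (2 * Im ?v)) * (- (u / (P / Q))))) ?F"
    proof (intro tendsto_Arg)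
      have "1 / (2 * Im ?v) > 0" using v by simp
      then show "of_real (1 / (2 * Im ?v)) * (- (u / (P / Q))) \<notin> \<real>\<^sub>\<le>\<^sub>0" using A(2) by (rule scale[THEN iffD2])
    qed (simp only: l)
    moreover have "Arg (of_real (1 / (2 * Im ?v)) * (- (u / (P / Q)))) = Arg (- (u / (P / Q)))"
      using v by (intro Arg_times_of_real) simp
    moreover have "\<forall>\<^sub>F r in ?F. Arg (- (cis t / ((?v - cnj (?p r)) * disc (?p r) (V (i + (n - 1)))))) =
        Arg (disc (?p r) ?v / disc (?p r) (V (i + (n - 1))))"
      using rpos
    proof eventually_elim
      case (elim r)
      have "disc (?p r) ?v / disc (?p r) (V (i + (n - 1))) =
          of_real r * - (cis t / ((?v - cnj (?p r)) * disc (?p r) (V (i + (n - 1)))))"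
        unfolding disc_def[of "?p r" ?v] by simp
      then show ?case using elim by (simp only: Arg_times_of_real)
    qed
    ultimately show ?thesis by (simp only: Lim_transform_eventually)
  qed
  let ?I = "{..<n} - {i} - {?j}"
  have "((\<lambda>r. \<Sum>k\<in>?I. Arg (disc (?p r) (V (Suc k)) / disc (?p r) (V k))) \<longlongrightarrow> K) ?F"
    unfolding K_def
  proof (rule tendsto_sum)
    fix k assume k: "k \<in> ?I"
    have "V i \<notin> hyp_segment (V k) (V (Suc k))" using V_notin_side[OF i] k by auto
    from disc_quotient_not_nonpos[OF Im_V Im_V Im_V this]
    show "((\<lambda>r. Arg (disc (?p r) (V (Suc k)) / disc (?p r) (V k))) \<longlongrightarrow>
       Arg (disc (V i) (V (Suc k)) / disc (V i) (V k))) ?F"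
      by (intro tendsto_Arg tendsto_divide disc_tendsto p Im_V) auto
  qed
  from tendsto_add[OF this tendsto_add[OF lim1 lim2]]
  have "((\<lambda>r. (\<Sum>k\<in>?I. Arg (disc (?p r) (V (Suc k)) / disc (?p r) (V k))) +
      (Arg (disc (?p r) (V (Suc i)) / disc (?p r) ?v) +
       Arg (disc (?p r) ?v / disc (?p r) (V (i + (n - 1)))))) \<longlongrightarrow> L) ?F"
    unfolding L_def A(3) .
  moreover have "(\<Sum>k\<in>?I. Arg (disc q (V (Suc k)) / disc q (V k))) +
      (Arg (disc q (V (Suc i)) / disc q ?v) + Arg (disc q ?v / disc q (V (i + (n - 1))))) = wsum q" for q
  proof -
    have "wsum q = Arg (disc q (V (Suc i)) / disc q ?v) +
        (\<Sum>k\<in>{..<n} - {i}. Arg (disc q (V (Suc k)) / disc q (V k)))"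
      unfolding wsum_def using i by (intro sum.remove) auto
    also have "(\<Sum>k\<in>{..<n} - {i}. Arg (disc q (V (Suc k)) / disc q (V k))) =
        Arg (disc q (V (Suc ?j)) / disc q (V ?j)) + (\<Sum>k\<in>?I. Arg (disc q (V (Suc k)) / disc q (V k)))"
      using j by (intro sum.remove) auto
    finally show ?thesis unfolding Vj by simp
  qed
  ultimately have wl: "((\<lambda>r. wsum (?p r)) \<longlongrightarrow> L) ?F" by simp
  have notB: "\<forall>\<^sub>F r in ?F. ?p r \<notin> B"
  proof -
    have far: "\<forall>\<^sub>F r in ?F. ?p r \<notin> hyp_segment (V k) (V (Suc k))" if k: "k \<in> ?I" for k
    proof -
      have "V i \<notin> hyp_segment (V k) (V (Suc k))" using V_notin_side[OF i] k by auto
      moreover have "closed (hyp_segment (V k) (V (Suc k)))"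
        using path_image_edge_path[OF Im_V Im_V] valid_path_edge_path[OF Im_V Im_V]
        by (metis closed_path_image valid_path_imp_path)
      ultimately have "\<forall>\<^sub>F r in ?F. ?p r \<in> - hyp_segment (V k) (V (Suc k))"
        by (intro topological_tendstoD[OF p]) auto
      then show ?thesis by simp
    qed
    \<comment> \<open>Points of a side tend to the vertex in the direction of that side, so a ray in
      any other direction leaves the side.\<close>
    have near: "\<forall>\<^sub>F r in ?F. ?p r \<notin> hyp_segment ?v a"
      if a: "Im a > 0" "- (\<i> * disc ?v a / cis t) \<notin> \<real>\<^sub>\<le>\<^sub>0" for a
    proof -
      have "((\<lambda>r. - (disc ?v a * (?p r - cnj ?v) / cis t)) \<longlongrightarrow> - (disc ?v a * (?v - cnj ?v) / cis t)) ?F"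
        by (intro tendsto_intros p c)
      moreover have l: "- (disc ?v a * (?v - cnj ?v) / cis t) = of_real (2 * Im ?v) * (- (\<i> * disc ?v a / cis t))"
        unfolding y by simp
      have "2 * Im ?v > 0" using v by simp
      then have "- (disc ?v a * (?v - cnj ?v) / cis t) \<notin> \<real>\<^sub>\<le>\<^sub>0"
        unfolding l using a(2) by (rule scale[THEN iffD2])
      ultimately have "\<forall>\<^sub>F r in ?F. - (disc ?v a * (?p r - cnj ?v) / cis t) \<notin> \<real>\<^sub>\<le>\<^sub>0"
        by (rule eventually_notin_nonpos)
      then show ?thesis using rpos
      proof eventually_elim
        case (elim r)
        show ?case
        proof
          assume s: "?p r \<in> hyp_segment ?v a"
          then obtain s where s: "s \<in> {0..1}" "disc ?v (?p r) = of_real s * disc ?v a" "Im (?p r) > 0"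
            using in_hyp_segment_iff[OF v a(1)] by blast
          have d: "?p r - cnj ?v \<noteq> 0" using diff_cnj_nonzero[OF v s(3)] .
          have "disc ?v (?p r) = of_real r * cis t / (?p r - cnj ?v)" by (simp add: disc_def)
          then have eq: "of_real r * cis t = of_real s * (disc ?v a * (?p r - cnj ?v))"
            using s(2) d by (simp add: field_simps)
          have "s \<noteq> 0" using eq elim c by auto
          then have "disc ?v a * (?p r - cnj ?v) / cis t = of_real (r / s)"
            using eq c by (simp add: field_simps)
          then have "- (disc ?v a * (?p r - cnj ?v) / cis t) = of_real (- (r / s))" by simp
          moreover have "- (r / s) \<le> 0" using elim s(1) by simp
          ultimately show False using elim(1) by (metis nonpos_Reals_of_real_iff)
        qed
      qed
    qed
    have n1: "\<forall>\<^sub>F r in ?F. ?p r \<notin> hyp_segment ?v (V (Suc i))"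
      using A(1) unfolding Q' Q_def by (intro near Im_V) simp
    have "- (\<i> * P / cis t) = inverse (\<i> * cis t / P)" using nz c by (simp add: field_simps)
    then have "- (\<i> * P / cis t) \<notin> \<real>\<^sub>\<le>\<^sub>0"
      using A(2) unfolding P' by (metis inverse_inverse_eq nonpos_Reals_inverse_I)
    then have n2: "\<forall>\<^sub>F r in ?F. ?p r \<notin> hyp_segment (V ?j) (V (Suc ?j))"
      unfolding Vj hyp_segment_sym[of _ ?v] P_def by (intro near Im_V) simp
    have "\<forall>\<^sub>F r in ?F. \<forall>k\<in>?I. ?p r \<notin> hyp_segment (V k) (V (Suc k))"
      using far by (intro eventually_ball_finite) auto
    then show ?thesis using n1 n2
    proof eventually_elim
      case (elim r)
      then have "\<forall>k<n. ?p r \<notin> hyp_segment (V k) (V (Suc k))" by auto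
      then show ?case by (auto simp: B_eq)
    qed
  qed
  have "((\<lambda>r. Im (?p r)) \<longlongrightarrow> Im ?v) ?F" by (intro tendsto_intros p)
  then have "\<forall>\<^sub>F r in ?F. Im (?p r) > 0" using v by (rule order_tendstoD)
  then have ev: "\<forall>\<^sub>F r in ?F. wsum (?p r) = 2 * pi * (if ?p r \<in> poly_region vs then e else 0)"
    using notB by eventually_elim (use w in \<open>auto simp: poly_region_def\<close>)
  have "closed {0, 2 * pi * e}" by simp
  then show L: "L \<in> {0, 2 * pi * e}"
  proof (rule Lim_in_closed_set)
    show "\<forall>\<^sub>F r in ?F. wsum (?p r) \<in> {0, 2 * pi * e}" using ev by eventually_elim auto
  qed (use wl in auto)
  have e0: "2 * pi * e \<noteq> 0" using e by auto
  show "(\<forall>\<^sub>F r in ?F. ?p r \<in> poly_region vs) \<longleftrightarrow> L = 2 * pi * e"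
  proof
    assume L: "L = 2 * pi * e"
    have "\<forall>\<^sub>F r in ?F. dist (wsum (?p r)) L < \<bar>2 * pi * e\<bar>" using tendstoD[OF wl] e0 by simp
    then show "\<forall>\<^sub>F r in ?F. ?p r \<in> poly_region vs"
      using ev by eventually_elim (use L e0 in \<open>auto simp: dist_real_def split: if_splits\<close>)
  next
    assume "\<forall>\<^sub>F r in ?F. ?p r \<in> poly_region vs"
    then have "\<forall>\<^sub>F r in ?F. wsum (?p r) = 2 * pi * e" using ev by eventually_elim auto
    then have "((\<lambda>r. wsum (?p r)) \<longlongrightarrow> 2 * pi * e) ?F" by (rule tendsto_eventually)
    then show "L = 2 * pi * e" using wl tendsto_unique by (metis trivial_limit_at_right_real)
  qed
qed

text \<open>Rays within the angle \<open>T\<close> have limit \<open>K + 2 * pi - T\<close>, the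
  others \<open>K - T\<close>. Both lie in the two-element set of \<open>ray_limit\<close> and
  differ by \<open>2 * pi\<close>, which determines \<open>K\<close> and thereby which of the two
  arcs points inwards.\<close>

lemma interior_angle_eq:
  assumes i: "i < n"
    and o: "orientation e"
  defines "T \<equiv> Arg2pi (disc (V i) (V (i + (n - 1))) / disc (V i) (V (Suc i)))"
  shows "interior_angle vs i = (if e = 1 then T else 2 * pi - T)"
proof -
  have e: "e \<in> {1, -1}" using o by (simp add: orientation_def)
  define P where "P = disc (V i) (V (i + (n - 1)))"
  define Q where "Q = disc (V i) (V (Suc i))"
  define K where "K = (\<Sum>k\<in>{..<n} - {i} - {(i + (n - 1)) mod n}. Arg (disc (V i) (V (Suc k)) / disc (V i) (V k)))"
  note nz = vertex_quotient[OF i, folded P_def Q_def]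
  have T: "T = Arg2pi (P / Q)" by (simp add: T_def P_def Q_def)
  have T2: "0 < T" "T < 2 * pi" using nz Arg2pi_lt_2pi by (auto simp: T)
  define b where "b = Arg2pi (\<i> * Q)"
  have b: "0 \<le> b" "b < 2 * pi" using Arg2pi_ge_0 Arg2pi_lt_2pi by (auto simp: b_def)
  have iQ: "\<i> * Q \<noteq> 0" using nz by simp
  define h where "h = (\<lambda>t. if b \<le> t then t - b else t - b + 2 * pi)"
  have h: "Arg2pi (cis t / (\<i> * Q)) = h t" if "t \<in> {0..<2 * pi}" for t
    using Arg2pi_cis_div[OF iQ that] by (simp add: h_def b_def)
  define S where "S = {t \<in> {0..<2 * pi}. \<forall>\<^sub>F r in at_right 0. V i + of_real r * cis t \<in> poly_region vs}"
  have ray: "K + (if h t < T then 2 * pi - T else - T) \<in> {0, 2 * pi * e}"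
       "t \<in> S \<longleftrightarrow> K + (if h t < T then 2 * pi - T else - T) = 2 * pi * e"
    if "t \<in> {0..<2 * pi}" "0 < h t" "h t \<noteq> T" for t
    using ray_limit[OF i o, of t, folded P_def Q_def, folded K_def T, unfolded h[OF that(1)]] that
    by (simp_all add: S_def)
  have ex: "\<exists>t\<in>{0..<2 * pi}. h t = x" if "0 \<le> x" "x < 2 * pi" for x
    using that b by (intro bexI[of _ "if b + x < 2 * pi then b + x else b + x - 2 * pi"]) (auto simp: h_def)
  have K1: "K + (2 * pi - T) \<in> {0, 2 * pi * e}"
  proof -
    obtain t where "t \<in> {0..<2 * pi}" "h t = T / 2" using ex[of "T / 2"] T2 by auto
    then show ?thesis using ray(1)[of t] T2 by simp
  qed
  have K2: "K - T \<in> {0, 2 * pi * e}"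
  proof -
    obtain t where "t \<in> {0..<2 * pi}" "h t = (T + 2 * pi) / 2" using ex[of "(T + 2 * pi) / 2"] T2 by auto
    then show ?thesis using ray(1)[of t] T2 by simp
  qed
  define c where "c = (if e = 1 then 0 else T)"
  define d where "d = (if e = 1 then T else 2 * pi)"
  have K: "K = (if e = 1 then T else T - 2 * pi)"
    using e K1 K2 pi_gt_zero by auto
  have S: "t \<in> S \<longleftrightarrow> c < h t \<and> h t < d" if "t \<in> {0..<2 * pi}" "0 < h t" "h t \<noteq> T" for t
  proof -
    have "h t < 2 * pi" using that(1) b by (auto simp: h_def)
    then show ?thesis unfolding ray(2)[OF that] using that e by (auto simp: K c_def d_def)
  qed
  let ?S' = "{t \<in> {0..<2 * pi}. c < h t \<and> h t < d}"
  have cd: "0 \<le> c" "c \<le> d" "d \<le> 2 * pi" using T2 by (auto simp: c_def d_def)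
  have S': "?S' \<in> lmeasurable" "measure lebesgue ?S' = d - c"
    using measure_arc_mod[OF b cd] by (auto simp: h_def)
  \<comment> \<open>Only the two tangent directions, with \<open>h t\<close> equal to 0 or
    \<open>T\<close>, escape the analysis.\<close>
  have "(?S' - S) \<union> (S - ?S') \<subseteq> {b, b - 2 * pi, b + T, b + T - 2 * pi}"
  proof
    fix t assume t: "t \<in> (?S' - S) \<union> (S - ?S')"
    then have t0: "t \<in> {0..<2 * pi}" by (auto simp: S_def)
    moreover have "h t \<ge> 0" using t0 b by (auto simp: h_def)
    moreover have "t \<in> S \<longleftrightarrow> \<not> (c < h t \<and> h t < d)" using t t0 by auto
    ultimately have "h t = 0 \<or> h t = T" using S[OF t0] by fastforce
    then show "t \<in> {b, b - 2 * pi, b + T, b + T - 2 * pi}" by (auto simp: h_def split: if_splits)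
  qed
  then have "negligible ((?S' - S) \<union> (S - ?S'))" by (rule negligible_subset[rotated]) simp
  then have "measure lebesgue S = measure lebesgue ?S'"
    by (rule measure_negligible_symdiff[OF S'(1)])
  then have "interior_angle vs i = d - c"
    unfolding S'(2) S_def interior_angle_def V_less[OF i] .
  then show ?thesis by (simp add: c_def d_def)
qed

end

section \<open>Isometries\<close>

lemma hyp_dist_cong_disc:
  assumes "Im c > 0" "Im z > 0" "Im w > 0" "Im c' > 0" "Im z' > 0" "Im w' > 0"
    and "cmod (disc c' z') = cmod (disc c z)" "cmod (disc c' w') = cmod (disc c w)"
    and "cmod (disc c' z' - disc c' w') = cmod (disc c z - disc c w)"
  shows "hyp_dist z' w' = hyp_dist z w"
  using assms by (simp add: hyp_dist_disc[of c z w] hyp_dist_disc[of c' z' w'])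

text \<open>The orientation-preserving isometry that takes \<open>c\<close> to \<open>d\<close>,
  acting as the rotation by \<open>u\<close> between the two discs.\<close>

definition mob :: "complex \<Rightarrow> complex \<Rightarrow> complex \<Rightarrow> complex \<Rightarrow> complex" where
  "mob c d u z = undisc d (u * disc c z)"

lemma disc_mob:
  assumes "Im c > 0" "Im d > 0" "cmod u = 1" "Im z > 0"
  shows "Im (mob c d u z) > 0" "disc d (mob c d u z) = u * disc c z"
proof -
  have "cmod (u * disc c z) < 1" using assms norm_disc_less_1 by (simp add: norm_mult)
  then show "Im (mob c d u z) > 0" "disc d (mob c d u z) = u * disc c z"
    unfolding mob_def using assms Im_undisc_pos disc_undisc by auto
qed

lemma mob_mob:
  assumes "Im c > 0" "Im d > 0" "cmod u = 1" "Im z > 0"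
  shows "mob d c (cnj u) (mob c d u z) = z"
proof -
  have "cnj u * u = 1" using assms(3) by (metis complex_norm_square mult.commute of_real_1 power_one)
  then have "mob d c (cnj u) (mob c d u z) = undisc c (disc c z)"
    unfolding mob_def[of d c] disc_mob[OF assms] by (simp add: mult.assoc[symmetric])
  then show ?thesis using undisc_disc assms by simp
qed

lemma hyp_dist_mob:
  assumes "Im c > 0" "Im d > 0" "cmod u = 1" "Im z > 0" "Im w > 0"
  shows "hyp_dist (mob c d u z) (mob c d u w) = hyp_dist z w"
proof (rule hyp_dist_cong_disc[of c z w d])
  have "u * disc c z - u * disc c w = u * (disc c z - disc c w)" by (simp add: algebra_simps)
  then show "cmod (disc d (mob c d u z) - disc d (mob c d u w)) = cmod (disc c z - disc c w)"
    using assms by (simp only: disc_mob norm_mult mult_1)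
qed (use assms disc_mob in \<open>auto simp: norm_mult\<close>)

lemma hyp_isometry_mob:
  assumes "Im c > 0" "Im d > 0" "cmod u = 1"
  shows "hyp_isometry (mob c d u)"
  unfolding hyp_isometry_def
proof
  have u': "cmod (cnj u) = 1" using assms(3) by simp
  show "bij_betw (mob c d u) hyp_plane hyp_plane"
    by (rule bij_betw_byWitness[of _ "mob d c (cnj u)"])
      (use mob_mob[OF assms] mob_mob[OF assms(2,1) u'] disc_mob(1)[OF assms] disc_mob(1)[OF assms(2,1) u']
        in \<open>auto simp: hyp_plane_iff\<close>)
qed (use hyp_dist_mob[OF assms] in \<open>auto simp: hyp_plane_iff\<close>)

lemma hyp_dist_reflect: "hyp_dist (- cnj z) (- cnj w) = hyp_dist z w"
proof -
  have "cmod (- cnj z - - cnj w) = cmod (cnj (z - w))" by (simp add: norm_minus_commute)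
  then show ?thesis unfolding hyp_dist_def by (simp only: complex_mod_cnj) simp
qed

lemma hyp_isometry_reflect: "hyp_isometry (\<lambda>z. - cnj z)"
  unfolding hyp_isometry_def
proof
  show "bij_betw (\<lambda>z. - cnj z) hyp_plane hyp_plane"
    by (rule bij_betw_byWitness[of _ "\<lambda>z. - cnj z"]) (auto simp: hyp_plane_iff)
qed (simp add: hyp_dist_reflect)

lemma hyp_isometry_comp: "hyp_isometry f \<Longrightarrow> hyp_isometry g \<Longrightarrow> hyp_isometry (g \<circ> f)"
  unfolding hyp_isometry_def by (auto intro: bij_betw_trans dest: bij_betwE)

lemma disc_reflect: "disc (- cnj v) (- cnj z) = cnj (disc v z)"
proof -
  have "disc (- cnj v) (- cnj z) = - (cnj z - cnj v) / - (cnj z - v)"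
    unfolding disc_def by simp
  also have "\<dots> = (cnj z - cnj v) / (cnj z - v)" by (rule minus_divide_divide)
  finally show ?thesis unfolding disc_def by simp
qed

lemma edge_area_reflect: "edge_area (- cnj z) (- cnj w) = - edge_area z w"
proof -
  have "(Re (- cnj w) - Re (- cnj z)) / (Im (- cnj z) + Im (- cnj w)) = - ((Re w - Re z) / (Im z + Im w))"
    by (simp add: minus_divide_left)
  then show ?thesis unfolding edge_area_def by (simp only: arctan_minus)
qed

lemma hyp_isometry_Im: "hyp_isometry f \<Longrightarrow> Im z > 0 \<Longrightarrow> Im (f z) > 0"
  unfolding hyp_isometry_def by (auto simp: hyp_plane_iff dest: bij_betwE)

lemma hyp_isometry_dist: "hyp_isometry f \<Longrightarrow> Im z > 0 \<Longrightarrow> Im w > 0 \<Longrightarrow> hyp_dist (f z) (f w) = hyp_dist z w"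
  by (simp add: hyp_isometry_def hyp_plane_iff)

section \<open>Classification of the isometries\<close>

lemma Re_mult_cnj_eq: "2 * Re (a * cnj b) = (cmod a)\<^sup>2 + (cmod b)\<^sup>2 - (cmod (a - b))\<^sup>2"
  unfolding cmod_power2 by (simp add: power2_eq_square algebra_simps)

lemma isometry_inner:
  assumes f: "hyp_isometry f" and "Im c > 0" "Im z > 0" "Im w > 0"
  shows "cmod (disc (f c) (f z)) = cmod (disc c z)"
    "Re (disc (f c) (f z) * cnj (disc (f c) (f w))) = Re (disc c z * cnj (disc c w))"
proof -
  note I = hyp_isometry_Im[OF f]
  have n: "cmod (disc (f c) (f z)) = cmod (disc c z)" if "Im z > 0" for z
    using hyp_dist_eq_iff_radius[of "f c" "f z" c z] hyp_isometry_dist[OF f] I assms that by simp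
  show "cmod (disc (f c) (f z)) = cmod (disc c z)" by (rule n[OF assms(3)])
  let ?p = "(1 - (cmod (disc c z))\<^sup>2) * (1 - (cmod (disc c w))\<^sup>2)"
  have "?p \<noteq> 0" using norm_disc_sq_less_1[of c z] norm_disc_sq_less_1[of c w] assms by auto
  moreover have "cosh (hyp_dist (f z) (f w)) = cosh (hyp_dist z w)"
    using hyp_isometry_dist[OF f] assms by simp
  then have "2 * (cmod (disc (f c) (f z) - disc (f c) (f w)))\<^sup>2 / ?p = 2 * (cmod (disc c z - disc c w))\<^sup>2 / ?p"
    unfolding cosh_hyp_dist_disc[OF assms(2-4)] cosh_hyp_dist_disc[OF I[OF assms(2)] I[OF assms(3)] I[OF assms(4)]]
      n[OF assms(3)] n[OF assms(4)] by simp
  ultimately have "(cmod (disc (f c) (f z) - disc (f c) (f w)))\<^sup>2 = (cmod (disc c z - disc c w))\<^sup>2" by simp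
  then show "Re (disc (f c) (f z) * cnj (disc (f c) (f w))) = Re (disc c z * cnj (disc c w))"
    using Re_mult_cnj_eq[of "disc (f c) (f z)" "disc (f c) (f w)"] Re_mult_cnj_eq[of "disc c z" "disc c w"]
      n[OF assms(3)] n[OF assms(4)] by simp
qed

lemma complex_eq_of_inner:
  assumes "Re (x * cnj a) = Re (y * cnj a)" "Re (x * cnj b) = Re (y * cnj b)" "Im (a * cnj b) \<noteq> 0"
  shows "x = y"
proof -
  define d where "d = x - y"
  have 1: "Re d * Re a + Im d * Im a = 0" "Re d * Re b + Im d * Im b = 0"
    using assms(1,2) by (simp_all add: d_def algebra_simps)
  have D: "Im a * Re b - Re a * Im b \<noteq> 0" using assms(3) by (simp add: algebra_simps)
  have "Re d * (Im a * Re b - Re a * Im b) = 0" "Im d * (Im a * Re b - Re a * Im b) = 0"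
    using 1 by algebra+
  then have "d = 0" using D by (simp add: complex_eq_iff)
  then show ?thesis by (simp add: d_def)
qed

text \<open>Distances determine norms and inner products in the disc centred at \<open>c\<close>.
  The images of two perpendicular points \<open>a\<close> and \<open>b\<close> are again
  perpendicular, which leaves two choices, \<open>k = \<i>\<close> and \<open>k = - \<i>\<close>;
  inner products with these images then determine every other image.\<close>

lemma hyp_isometry_classify:
  assumes f: "hyp_isometry f" and c: "Im c > 0"
  obtains u where "cmod u = 1" "\<And>z. Im z > 0 \<Longrightarrow> disc (f c) (f z) = u * disc c z"
  | u where "cmod u = 1" "\<And>z. Im z > 0 \<Longrightarrow> disc (f c) (f z) = u * cnj (disc c z)"
proof -
  define G where "G z = disc (f c) (f z)" for z
  define a where "a = undisc c (1/2)"
  define b where "b = undisc c (\<i>/2)"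
  have ab: "Im a > 0" "Im b > 0" "disc c a = 1/2" "disc c b = \<i>/2"
    using c Im_undisc_pos[of c] disc_undisc[of c] by (auto simp: a_def b_def norm_divide)
  have n: "cmod (G z) = cmod (disc c z)" if "Im z > 0" for z
    using isometry_inner(1)[OF f c that that] by (simp add: G_def)
  have inn: "Re (G z * cnj (G w)) = Re (disc c z * cnj (disc c w))" if "Im z > 0" "Im w > 0" for z w
    using isometry_inner(2)[OF f c that] by (simp add: G_def)
  define u where "u = 2 * G a"
  have u: "cmod u = 1" using n[OF ab(1)] ab by (simp add: u_def norm_mult)
  have uu: "u * cnj u = 1" using u by (simp add: complex_norm_square[symmetric])
  define k where "k = 2 * G b * cnj u"
  have Gb: "G b = u * k / 2" using uu by (simp add: k_def algebra_simps)
  have "cmod k = 1" using n[OF ab(2)] ab u by (simp add: k_def norm_mult norm_divide)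
  moreover have "Re k = 0"
  proof -
    have "Re (G b * cnj (G a)) = 0" using inn[OF ab(2,1)] ab by simp
    then show ?thesis by (simp add: k_def u_def algebra_simps)
  qed
  ultimately have k: "k = \<i> \<or> k = - \<i>"
  proof -
    assume "cmod k = 1" "Re k = 0"
    then have "(Im k)\<^sup>2 = 1" using cmod_power2[of k] by simp
    then show ?thesis using \<open>Re k = 0\<close> by (auto simp: power2_eq_1_iff complex_eq_iff)
  qed
  have Ga: "G a = u / 2" by (simp add: u_def)
  have nz: "Im (G a * cnj (G b)) \<noteq> 0"
  proof -
    have "G a * cnj (G b) = (u * cnj u) * cnj k / 4" unfolding Ga Gb by simp
    also have "\<dots> = cnj k / 4" unfolding uu by simp
    finally show ?thesis using k by (auto simp only:) simp_all
  qed
  have ua: "u * w * cnj (G a) = w / 2" for w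
    using uu unfolding Ga by (simp add: mult.commute mult.left_commute)
  have ub: "u * w * cnj (G b) = w * cnj k / 2" for w
    using uu unfolding Gb by (simp add: mult.commute mult.left_commute)
  from k show thesis
  proof
    assume k: "k = \<i>"
    have "G z = u * disc c z" if "Im z > 0" for z
    proof (rule complex_eq_of_inner[OF _ _ nz])
      show "Re (G z * cnj (G a)) = Re (u * (disc c z) * cnj (G a))"
        unfolding inn[OF that ab(1)] ab(3) ua by simp
      show "Re (G z * cnj (G b)) = Re (u * (disc c z) * cnj (G b))"
        unfolding inn[OF that ab(2)] ab(4) ub k by simp
    qed
    then show thesis using that(1) u by (simp add: G_def)
  next
    assume k: "k = - \<i>"
    have "G z = u * cnj (disc c z)" if "Im z > 0" for z
    proof (rule complex_eq_of_inner[OF _ _ nz])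
      show "Re (G z * cnj (G a)) = Re (u * (cnj (disc c z)) * cnj (G a))"
        unfolding inn[OF that ab(1)] ab(3) ua by simp
      show "Re (G z * cnj (G b)) = Re (u * (cnj (disc c z)) * cnj (G b))"
        unfolding inn[OF that ab(2)] ab(4) ub k by simp
    qed
    then show thesis using that(2) u by (simp add: G_def)
  qed
qed

section \<open>The area sum under isometries\<close>

lemma sum_edge_area_disc:
  assumes "\<And>i. Im (v i) > 0" "v n = v 0" "Im c > 0"
  shows "(\<Sum>i<n. edge_area (v i) (v (Suc i))) =
    (\<Sum>i<n. - 2 * Arg (1 - disc c (v (Suc i)) * cnj (disc c (v i))))"
proof -
  have "(\<Sum>i<n. edge_area (v i) (v (Suc i))) =
      (\<Sum>i<n. - 2 * Arg (1 - disc c (v (Suc i)) * cnj (disc c (v i)))) +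
      (\<Sum>i<n. 2 * Arg (1 - disc c (v (Suc i))) - 2 * Arg (1 - disc c (v i)))"
    unfolding sum.distrib[symmetric]
    by (intro sum.cong refl) (simp add: edge_area_disc[OF assms(3) assms(1) assms(1)])
  also have "(\<Sum>i<n. 2 * Arg (1 - disc c (v (Suc i))) - 2 * Arg (1 - disc c (v i))) = 0"
    using assms(2) sum_lessThan_telescope[of "\<lambda>i. 2 * Arg (1 - disc c (v i))" n] by simp
  finally show ?thesis by simp
qed

lemma sum_edge_area_rotate:
  assumes "\<And>i. Im (v i) > 0" "v n = v 0" "Im c > 0" "\<And>i. Im (w i) > 0" "w n = w 0" "Im d > 0" "cmod u = 1"
    and "\<And>i. disc d (w i) = u * disc c (v i)"
  shows "(\<Sum>i<n. edge_area (w i) (w (Suc i))) = (\<Sum>i<n. edge_area (v i) (v (Suc i)))"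
proof -
  have uu: "u * cnj u = 1" using assms(7) by (simp add: complex_norm_square[symmetric])
  have "u * a * cnj (u * b) = (u * cnj u) * (a * cnj b)" for a b by (simp add: mult_ac)
  then show ?thesis
    unfolding sum_edge_area_disc[of v, OF assms(1-3)] sum_edge_area_disc[of w, OF assms(4-6)] assms(8)
    by (simp only: uu) simp
qed

text \<open>Absolute values absorb the change of sign under orientation-reversing
  isometries.\<close>

lemma sum_edge_area_isometry:
  assumes f: "hyp_isometry f" and v: "\<And>i. Im (v i) > 0" "v n = v 0"
  shows "\<bar>\<Sum>i<n. edge_area (f (v i)) (f (v (Suc i)))\<bar> = \<bar>\<Sum>i<n. edge_area (v i) (v (Suc i))\<bar>"
proof -
  have c: "Im \<i> > 0" by simp
  note I = hyp_isometry_Im[OF f]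
  have v': "f (v n) = f (v 0)" using v by simp
  show ?thesis
  proof (rule hyp_isometry_classify[OF f c])
    fix u assume u: "cmod u = 1" "\<And>z. Im z > 0 \<Longrightarrow> disc (f \<i>) (f z) = u * disc \<i> z"
    show ?thesis
      using sum_edge_area_rotate[of v n \<i> "\<lambda>i. f (v i)" "f \<i>" u] u v I by simp
  next
    fix u assume u: "cmod u = 1" "\<And>z. Im z > 0 \<Longrightarrow> disc (f \<i>) (f z) = u * cnj (disc \<i> z)"
    have "disc (f \<i>) (f (v i)) = u * disc (- cnj \<i>) (- cnj (v i))" for i
      unfolding disc_reflect using u(2) v by simp
    then have "(\<Sum>i<n. edge_area (f (v i)) (f (v (Suc i)))) =
        (\<Sum>i<n. edge_area (- cnj (v i)) (- cnj (v (Suc i))))"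
      using sum_edge_area_rotate[of "\<lambda>i. - cnj (v i)" n "- cnj \<i>" "\<lambda>i. f (v i)" "f \<i>" u] u v I by simp
    then show ?thesis by (simp add: edge_area_reflect sum_negf)
  qed
qed

section \<open>Isometries applied to segments, interiors and polygons\<close>

lemma hyp_isometry_inv:
  assumes "hyp_isometry f"
  shows "hyp_isometry (inv_into hyp_plane f)"
proof -
  have b: "bij_betw f hyp_plane hyp_plane" using assms by (simp add: hyp_isometry_def)
  have "bij_betw (inv_into hyp_plane f) hyp_plane hyp_plane" using b by (rule bij_betw_inv_into)
  moreover have "hyp_dist (inv_into hyp_plane f z) (inv_into hyp_plane f w) = hyp_dist z w"
    if "z \<in> hyp_plane" "w \<in> hyp_plane" for z w
  proof -
    have "inv_into hyp_plane f z \<in> hyp_plane" "inv_into hyp_plane f w \<in> hyp_plane"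
      using that b by (metis bij_betw_def inv_into_into)+
    then show ?thesis using that b assms
      by (metis bij_betw_inv_into_right hyp_isometry_def)
  qed
  ultimately show ?thesis by (simp add: hyp_isometry_def)
qed

lemma hyp_isometry_continuous:
  assumes f: "hyp_isometry f"
  shows "continuous_on hyp_plane f"
proof -
  have c: "Im \<i> > 0" by simp
  have fc: "Im (f \<i>) > 0" using hyp_isometry_Im[OF f] by simp
  have und: "continuous_on hyp_plane (\<lambda>z. undisc (f \<i>) (g z))"
    if "continuous_on hyp_plane g" "\<And>z. z \<in> hyp_plane \<Longrightarrow> cmod (g z) < 1" for g
    unfolding undisc_def by (intro continuous_intros that(1)) (use that(2) in fastforce)
  have d: "continuous_on hyp_plane (disc \<i>)"
    unfolding disc_def by (intro continuous_intros) (auto simp: hyp_plane_iff complex_eq_iff)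
  have eq: "f z = undisc (f \<i>) (disc (f \<i>) (f z))" if "z \<in> hyp_plane" for z
    using that undisc_disc[OF fc, of "f z"] hyp_isometry_Im[OF f] by (simp add: hyp_plane_iff)
  show ?thesis
  proof (rule hyp_isometry_classify[OF f c])
    fix u assume u: "cmod u = 1" "\<And>z. Im z > 0 \<Longrightarrow> disc (f \<i>) (f z) = u * disc \<i> z"
    have "continuous_on hyp_plane (\<lambda>z. undisc (f \<i>) (u * disc \<i> z))"
    proof (rule und)
      show "cmod (u * disc \<i> z) < 1" if "z \<in> hyp_plane" for z
        using that u(1) norm_disc_less_1[OF c] by (simp add: norm_mult hyp_plane_iff)
    qed (rule continuous_on_mult_left[OF d])
    then show ?thesis
    proof (rule continuous_on_eq)
      show "undisc (f \<i>) (u * disc \<i> z) = f z" if "z \<in> hyp_plane" for z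
        using eq[OF that] u(2)[of z] that unfolding hyp_plane_iff by metis
    qed
  next
    fix u assume u: "cmod u = 1" "\<And>z. Im z > 0 \<Longrightarrow> disc (f \<i>) (f z) = u * cnj (disc \<i> z)"
    have "continuous_on hyp_plane (\<lambda>z. undisc (f \<i>) (u * cnj (disc \<i> z)))"
    proof (rule und)
      show "cmod (u * cnj (disc \<i> z)) < 1" if "z \<in> hyp_plane" for z
        using that u(1) norm_disc_less_1[OF c] by (simp add: norm_mult hyp_plane_iff)
    qed (rule continuous_on_mult_left[OF continuous_on_cnj[OF d]])
    then show ?thesis
    proof (rule continuous_on_eq)
      show "undisc (f \<i>) (u * cnj (disc \<i> z)) = f z" if "z \<in> hyp_plane" for z
        using eq[OF that] u(2)[of z] that unfolding hyp_plane_iff by metis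
    qed
  qed
qed

lemma hyp_isometry_segment:
  assumes f: "hyp_isometry f" and "Im a > 0" "Im b > 0"
  shows "f ` hyp_segment a b = hyp_segment (f a) (f b)"
proof (intro equalityI subsetI)
  fix z assume "z \<in> f ` hyp_segment a b"
  then show "z \<in> hyp_segment (f a) (f b)"
    using hyp_isometry_Im[OF f] hyp_isometry_dist[OF f] assms by (auto simp: hyp_segment_def hyp_plane_iff)
next
  fix z assume z: "z \<in> hyp_segment (f a) (f b)"
  then have "z \<in> hyp_plane" by (simp add: hyp_segment_def)
  then obtain y where y: "y \<in> hyp_plane" "z = f y"
    using f by (metis hyp_isometry_def bij_betw_imp_surj_on imageE)
  then have "y \<in> hyp_segment a b"
    using z hyp_isometry_dist[OF f] assms by (auto simp: hyp_segment_def hyp_plane_iff)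
  then show "z \<in> f ` hyp_segment a b" using y by blast
qed

text \<open>Let \<open>C\<close> be the component of \<open>p\<close> in the complement of
  \<open>B\<close>. Its image is open by invariance of domain, and together with the image of
  \<open>B\<close> it is compact; so \<open>f\<close>
  C\<open>is open and closed relative to the complement of\<close>f \<open>B\<close>. It therefore
  contains the whole component of \<open>q\<close>, which is then bounded.\<close>

lemma homeomorphism_inside_subset:
  fixes f :: "complex \<Rightarrow> complex"
  assumes f: "continuous_on H f" "inj_on f H" and B: "compact B" "inside B \<subseteq> H" "B \<subseteq> H"
  shows "f ` inside B \<subseteq> inside (f ` B)"
proof
  fix q assume "q \<in> f ` inside B"
  then obtain p where p: "p \<in> inside B" "q = f p" by blast
  let ?C = "connected_component_set (- B) p"
  have pB: "p \<notin> B" and bdd: "bounded ?C" using p(1) by (auto simp: inside_def)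
  have CB: "?C \<inter> B = {}" using connected_component_subset[of "- B" p] by blast
  have pC: "p \<in> ?C" using pB by (simp add: connected_component_refl_eq)
  have C_inside: "?C \<subseteq> inside B"
    using p(1) inside_same_component by blast
  then have CH: "?C \<subseteq> H" using B by blast
  have clB: "closed B" using B compact_imp_closed by blast
  then have oC: "open ?C" by (intro open_connected_component) auto
  have ofC: "open (f ` ?C)"
    by (rule invariance_of_domain) (use oC CH f in \<open>auto intro: continuous_on_subset inj_on_subset\<close>)
  have "?C \<in> components (- B)" using pB by (auto simp: components_def)
  then have "closed (B \<union> ?C)" using clB closed_Un_complement_component by blast
  then have "compact (B \<union> ?C)" using bdd B by (simp add: compact_eq_bounded_closed compact_imp_bounded)
  then have "compact (f ` (B \<union> ?C))"
    by (rule compact_continuous_image[rotated]) (use f B CH in \<open>auto intro: continuous_on_subset\<close>)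
  then have cl: "closed (f ` (B \<union> ?C))" and bd: "bounded (f ` (B \<union> ?C))"
    using compact_imp_closed compact_imp_bounded by blast+
  have disj: "f ` ?C \<inter> f ` B = {}"
    unfolding inj_on_image_Int[OF f(2) CH B(3), symmetric] CB by simp
  let ?D = "connected_component_set (- f ` B) q"
  have qD: "q \<in> f ` ?C" using p pC by blast
  have "?D \<subseteq> f ` ?C"
  proof (rule ccontr)
    assume D: "\<not> ?D \<subseteq> f ` ?C"
    have DB: "?D \<inter> f ` B = {}" using connected_component_subset[of "- f ` B" q] by blast
    have "q \<notin> f ` B" using disj qD by blast
    then have q: "q \<in> ?D" by (simp add: connected_component_refl_eq)
    let ?U = "- f ` (B \<union> ?C)"
    have "f ` ?C \<inter> ?D = {} \<or> ?U \<inter> ?D = {}"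
    proof (rule connectedD)
      show "open ?U" using cl by (rule open_Compl)
      show "f ` ?C \<inter> ?U \<inter> ?D = {}" by blast
      show "?D \<subseteq> f ` ?C \<union> ?U" using DB by blast
    qed (rule connected_connected_component ofC)+
    then show False using D DB q qD by blast
  qed
  then have "?D \<subseteq> f ` (B \<union> ?C)" by blast
  with bd have "bounded ?D" by (rule bounded_subset)
  moreover have "q \<notin> f ` B" using disj qD by blast
  ultimately show "q \<in> inside (f ` B)" by (simp add: inside_def)
qed

lemma hyp_isometry_inside:
  assumes f: "hyp_isometry f" and B: "compact B" "B \<subseteq> hyp_plane"
  shows "f ` inside B = inside (f ` B)"
proof
  have ins: "inside A \<subseteq> hyp_plane" if "A \<subseteq> hyp_plane" for A
    using outside_subset_convex[OF convex_hyp_plane that] inside_Int_outside[of A] by blast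
  have b: "bij_betw f hyp_plane hyp_plane" using f by (simp add: hyp_isometry_def)
  let ?g = "inv_into hyp_plane f"
  have g: "hyp_isometry ?g" by (rule hyp_isometry_inv[OF f])
  have bg: "bij_betw ?g hyp_plane hyp_plane" using g by (simp add: hyp_isometry_def)
  show "f ` inside B \<subseteq> inside (f ` B)"
    by (rule homeomorphism_inside_subset[OF hyp_isometry_continuous[OF f] _ B(1) ins[OF B(2)] B(2)])
      (use b in \<open>simp add: bij_betw_def\<close>)
  have fB: "f ` B \<subseteq> hyp_plane" "compact (f ` B)"
    using b B hyp_isometry_continuous[OF f]
    by (auto dest: bij_betwE intro!: compact_continuous_image continuous_on_subset[of hyp_plane f])
  have gf: "?g ` f ` B = B" using b B(2) by (simp add: bij_betw_def inv_into_image_cancel)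
  have "?g ` inside (f ` B) \<subseteq> inside (?g ` f ` B)"
    by (rule homeomorphism_inside_subset[OF hyp_isometry_continuous[OF g] _ fB(2) ins[OF fB(1)] fB(1)])
      (use bg in \<open>simp add: bij_betw_def\<close>)
  then have "f ` ?g ` inside (f ` B) \<subseteq> f ` inside B" unfolding gf by blast
  moreover have "f ` ?g ` inside (f ` B) = inside (f ` B)"
    using b ins[OF fB(1)] by (metis bij_betw_def image_inv_into_cancel)
  ultimately show "inside (f ` B) \<subseteq> f ` inside B" by simp
qed

context polygon
begin

lemma isometry_polygon:
  assumes f: "hyp_isometry f"
  shows "hyp_polygon n (map f vs)" "poly_region (map f vs) = f ` poly_region vs"
proof -
  have b: "bij_betw f hyp_plane hyp_plane" using f by (simp add: hyp_isometry_def)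
  then have inj: "inj_on f hyp_plane" by (simp add: bij_betw_def)
  have vsH: "set vs \<subseteq> hyp_plane" using poly by (simp add: hyp_polygon_def)
  have nth: "map f vs ! i = f (V i)" "next_vertex (map f vs) i = f (V (Suc i))" if "i < n" for i
    using that n0 len by (simp_all add: next_vertex_def V_def)
  have side: "poly_side (map f vs) i = f ` hyp_segment (V i) (V (Suc i))" if "i < n" for i
    unfolding poly_side_def nth[OF that] by (rule hyp_isometry_segment[OF f Im_V Im_V, symmetric])
  have H: "V i \<in> hyp_plane" for i by (simp add: hyp_plane_iff Im_V)
  have S: "hyp_segment a b \<subseteq> hyp_plane" for a b by (auto simp: hyp_segment_def)
  show "hyp_polygon n (map f vs)"
    unfolding hyp_polygon_def
  proof (intro conjI allI impI)
    show "3 \<le> n" "length (map f vs) = n" using n3 len by auto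
    show "distinct (map f vs)" using dist_vs inj vsH by (auto simp: distinct_map intro: inj_on_subset)
    show "set (map f vs) \<subseteq> hyp_plane" using vsH b by (auto dest: bij_betwE)
    fix i j assume ij: "i < n" "j < n" "i \<noteq> j"
    have "f ` hyp_segment (V i) (V (Suc i)) \<inter> f ` hyp_segment (V j) (V (Suc j)) =
        f ` (hyp_segment (V i) (V (Suc i)) \<inter> hyp_segment (V j) (V (Suc j)))"
      by (rule inj_on_image_Int[OF inj S S, symmetric])
    also have "\<dots> = f ` {V i, V (Suc i)} \<inter> f ` {V j, V (Suc j)}"
      unfolding sides_Int[OF ij] by (rule inj_on_image_Int[OF inj]) (use H in auto)
    finally show "poly_side (map f vs) i \<inter> poly_side (map f vs) j =
        {map f vs ! i, next_vertex (map f vs) i} \<inter> {map f vs ! j, next_vertex (map f vs) j}"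
      unfolding side[OF ij(1)] side[OF ij(2)] nth[OF ij(1)] nth[OF ij(2)] by simp
  qed
  have "poly_boundary (map f vs) = f ` B"
    unfolding poly_boundary_def[of "map f vs"] B_eq image_UN using side len by simp
  then show "poly_region (map f vs) = f ` poly_region vs"
    unfolding poly_region_def image_Un using hyp_isometry_inside[OF f compact_B B_subset] by simp
qed

lemma Area_abs: "Area vs = \<bar>\<Sum>i<n. edge_area (V i) (V (Suc i))\<bar>"
proof -
  have "Area vs \<ge> 0"
    unfolding Area_def hyp_area_def set_lebesgue_integral_def
    by (rule integral_nonneg_AE) (auto simp: indicator_def)
  moreover obtain e where e: "e \<in> {1, -1}" "Area vs = e * (\<Sum>i<n. edge_area (V i) (V (Suc i)))"
    using orientation_exists Area_eq by (metis orientation_def)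
  then have "\<bar>Area vs\<bar> = \<bar>\<Sum>i<n. edge_area (V i) (V (Suc i))\<bar>" by (auto simp: abs_mult)
  ultimately show ?thesis by simp
qed

end

text \<open>Being isometric concerns regions, and vertices of \<open>vs\<close> need not go to
  vertices of \<open>ws\<close>. The polygon \<open>map f vs\<close> mediates: it has the region of
  \<open>ws\<close> and the edge terms of an isometric copy of \<open>vs\<close>.\<close>

lemma isometric_polygons_Area:
  assumes "hyp_polygon n vs" "isometric_polygons vs ws"
  shows "Area vs = Area ws"
proof -
  obtain f where f: "hyp_isometry f" "f ` poly_region vs = poly_region ws"
    using assms(2) by (auto simp: isometric_polygons_def)
  interpret P: polygon n vs by unfold_locales (rule assms)
  interpret Q: polygon n "map f vs" by unfold_locales (rule P.isometry_polygon[OF f(1)])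
  have V: "Q.V i = f (P.V i)" for i using P.n0 P.len by (simp add: P.V_def Q.V_def)
  have "Area ws = Area (map f vs)"
    unfolding Area_def using P.isometry_polygon(2)[OF f(1)] f(2) by simp
  also have "\<dots> = Area vs"
    unfolding Q.Area_abs P.Area_abs V by (rule sum_edge_area_isometry[OF f(1) P.Im_V]) simp
  finally show ?thesis by simp
qed

section \<open>Tuples with equal sides and equal angles\<close>

lemma cosh_hyp_dist_coords:
  assumes "Im z > 0" "Im w > 0"
  shows "cosh (hyp_dist z w) = ((Re z - Re w)\<^sup>2 + (Im z)\<^sup>2 + (Im w)\<^sup>2) / (2 * Im z * Im w)"
  unfolding cosh_hyp_dist[OF assms] cmod_power2
  using assms by (simp add: field_simps power2_eq_square)

text \<open>In the hyperboloid model this says that a sum of timelike vectors is a timelike vector,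
  \<open>K\<close> being its length. In coordinates, \<open>Im z\<close> times the sum is a
  quadratic polynomial in \<open>Re z\<close> and \<open>Im z\<close>, and completing the square
  gives the centre.\<close>

lemma hyp_centroid:
  fixes v :: "nat \<Rightarrow> complex"
  assumes "n > 0" "\<And>i. Im (v i) > 0"
  obtains c K where "Im c > 0" "K > 0"
    "\<And>z. Im z > 0 \<Longrightarrow> (\<Sum>i<n. cosh (hyp_dist z (v i))) = K * cosh (hyp_dist z c)"
proof -
  define A where "A = (\<Sum>i<n. 1 / Im (v i))"
  define B where "B = (\<Sum>i<n. Re (v i) / Im (v i))"
  define C where "C = (\<Sum>i<n. ((Re (v i))\<^sup>2 + (Im (v i))\<^sup>2) / Im (v i))"
  have A: "A > 0" unfolding A_def using assms by (intro sum_pos) auto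
  define x0 where "x0 = B / A"
  have Ax: "A * x0 = B" using A by (simp add: x0_def)
  have "C - B * x0 = (\<Sum>i<n. ((Re (v i) - x0)\<^sup>2 + (Im (v i))\<^sup>2) / Im (v i))"
  proof -
    have "(\<Sum>i<n. ((Re (v i) - x0)\<^sup>2 + (Im (v i))\<^sup>2) / Im (v i)) = 
      (\<Sum>i<n. ((Re (v i))\<^sup>2 + (Im (v i))\<^sup>2) / Im (v i) - 2 * x0 * (Re (v i) / Im (v i)) + x0\<^sup>2 * (1 / Im (v i)))"
    proof (intro sum.cong refl)
      fix i
      show "((Re (v i) - x0)\<^sup>2 + (Im (v i))\<^sup>2) / Im (v i) =
        ((Re (v i))\<^sup>2 + (Im (v i))\<^sup>2) / Im (v i) - 2 * x0 * (Re (v i) / Im (v i)) + x0\<^sup>2 * (1 / Im (v i))"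
        using assms(2)[of i] by (simp add: field_simps power2_eq_square)
    qed
    also have "\<dots> = C - 2 * x0 * B + x0\<^sup>2 * A"
      unfolding sum.distrib sum_subtractf sum_distrib_left[symmetric] A_def B_def C_def ..
    also have "\<dots> = C - B * x0" unfolding Ax[symmetric] by (simp add: power2_eq_square)
    finally show ?thesis by simp
  qed
  also have "\<dots> > 0"
  proof (intro sum_pos)
    fix i
    have "(Im (v i))\<^sup>2 > 0" using zero_less_power[OF assms(2)] .
    then show "((Re (v i) - x0)\<^sup>2 + (Im (v i))\<^sup>2) / Im (v i) > 0"
      using assms(2) by (intro divide_pos_pos add_nonneg_pos) auto
  qed (use assms in auto)
  finally have pos: "(C - B * x0) / A > 0" using A by simp
  define y0 where "y0 = sqrt ((C - B * x0) / A)"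
  have y0: "y0 > 0" "A * y0\<^sup>2 = C - B * x0" using pos A by (auto simp: y0_def)
  have "(\<Sum>i<n. cosh (hyp_dist z (v i))) = (A * y0) * cosh (hyp_dist z (Complex x0 y0))" if z: "Im z > 0" for z
  proof -
    have "(\<Sum>i<n. cosh (hyp_dist z (v i))) =
      (\<Sum>i<n. (1 / (2 * Im z)) * (((Re (v i))\<^sup>2 + (Im (v i))\<^sup>2) / Im (v i) - 2 * Re z * (Re (v i) / Im (v i))
         + ((Re z)\<^sup>2 + (Im z)\<^sup>2) * (1 / Im (v i))))"
    proof (intro sum.cong refl)
      fix i
      show "cosh (hyp_dist z (v i)) = (1 / (2 * Im z)) * (((Re (v i))\<^sup>2 + (Im (v i))\<^sup>2) / Im (v i)
          - 2 * Re z * (Re (v i) / Im (v i)) + ((Re z)\<^sup>2 + (Im z)\<^sup>2) * (1 / Im (v i)))"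
        unfolding cosh_hyp_dist_coords[OF z assms(2)]
        using assms(2)[of i] z by (simp add: field_simps power2_eq_square)
    qed
    also have "\<dots> = (1 / (2 * Im z)) * (C - 2 * Re z * B + ((Re z)\<^sup>2 + (Im z)\<^sup>2) * A)"
      unfolding sum_distrib_left[symmetric] sum.distrib sum_subtractf A_def B_def C_def ..
    also have "C - 2 * Re z * B + ((Re z)\<^sup>2 + (Im z)\<^sup>2) * A = A * ((Re z - x0)\<^sup>2 + (Im z)\<^sup>2 + y0\<^sup>2)"
    proof -
      have "C = A * y0\<^sup>2 + A * x0 * x0" using y0(2) Ax by simp
      then show ?thesis unfolding Ax[symmetric] by (simp add: algebra_simps power2_eq_square)
    qed
    finally show ?thesis
      using z y0(1) by (simp add: cosh_hyp_dist_coords)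
  qed
  then show thesis using that[of "Complex x0 y0" "A * y0"] A y0 by simp
qed

text \<open>Seen from \<open>a\<close> and from its image, the map is linear. The multiplier
  \<open>t\<close> cancels in quotients, so the map preserves angles and ratios at every
  vertex.\<close>

lemma disc_mob_mob:
  assumes "Im c > 0" "Im d > 0" "cmod u = 1" "Im a > 0"
  obtains t where "t \<noteq> 0" "\<And>z. Im z > 0 \<Longrightarrow> disc (mob c d u a) (mob c d u z) = t * disc a z"
proof -
  let ?A = "disc c a"
  note m = disc_mob[OF assms(1-3)]
  have uu: "cnj u * u = 1" using assms(3) by (metis complex_norm_square mult.commute of_real_1 power_one)
  have n: "cmod ?A < 1" "cmod (u * ?A) < 1" using norm_disc_less_1 assms by (simp_all add: norm_mult)
  have nz: "1 - ?A \<noteq> 0" "1 - cnj ?A \<noteq> 0" "1 - u * ?A \<noteq> 0" "1 - cnj (u * ?A) \<noteq> 0" "u \<noteq> 0"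
    using n one_minus_nonzero[of ?A] one_minus_nonzero[of "cnj ?A"] one_minus_nonzero[of "u * ?A"]
      one_minus_nonzero[of "cnj (u * ?A)"] assms(3) by (simp_all only: complex_mod_cnj) auto
  let ?t = "(1 - cnj (u * ?A)) / (1 - u * ?A) * u * ((1 - ?A) / (1 - cnj ?A))"
  have "disc (mob c d u a) (mob c d u z) = ?t * disc a z" if z: "Im z > 0" for z
  proof -
    have e: "1 - cnj (u * ?A) * (u * disc c z) = 1 - cnj ?A * disc c z"
    proof -
      have "cnj (u * ?A) * (u * disc c z) = (cnj u * u) * (cnj ?A * disc c z)" by (simp add: mult_ac)
      then show ?thesis unfolding uu by simp
    qed
    have "disc (mob c d u a) (mob c d u z) =
      (1 - cnj (u * ?A)) / (1 - u * ?A) * ((u * disc c z - u * ?A) / (1 - cnj ?A * disc c z))"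
      using disc_change[OF assms(2) m(1)[OF assms(4)] m(1)[OF z]]
      unfolding m(2)[OF assms(4)] m(2)[OF z] e .
    moreover have "disc a z = (1 - cnj ?A) / (1 - ?A) * ((disc c z - ?A) / (1 - cnj ?A * disc c z))"
      by (rule disc_change[OF assms(1,4) z])
    moreover have "u * disc c z - u * ?A = u * (disc c z - ?A)" by (simp add: algebra_simps)
    ultimately show ?thesis using nz by simp
  qed
  moreover have "?t \<noteq> 0" using nz by simp
  ultimately show thesis using that by blast
qed

text \<open>\<open>q\<close> encodes side ratio and angle at a vertex. The map \<open>m\<close> that
  carries the first edge to the second carries every edge to the next one, because the next vertex
  is determined by the two before it and \<open>q\<close>. The centroid is fixed by
  \<open>m\<close>, so around it \<open>m\<close> is a rotation by some \<open>e\<close>, and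
  periodicity makes \<open>e\<close> a root of unity.\<close>

lemma equiangular_centre:
  assumes n: "n > 0" and v: "\<And>i. Im (v i) > 0" "\<And>i. v (i + n) = v i"
    and r: "r > 0" "\<And>i. cmod (disc (v i) (v (Suc i))) = r"
    and q: "q \<noteq> 0" "\<And>i. disc (v (Suc i)) (v i) = q * disc (v (Suc i)) (v (Suc (Suc i)))"
  obtains c a e where "Im c > 0" "a \<noteq> 0" "e ^ n = 1" "e \<noteq> 1" "\<And>i. disc c (v i) = a * e ^ i"
proof -
  define k where "k = disc (v 1) (v 2) / disc (v 0) (v 1)"
  have nz: "disc (v i) (v (Suc i)) \<noteq> 0" for i using r(1) r(2)[of i] by auto
  have k: "cmod k = 1" using r(1) r(2)[of 0] r(2)[of 1] by (simp add: k_def norm_divide numeral_2_eq_2)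
  define m where "m = mob (v 0) (v 1) k"
  note mp = disc_mob[of "v 0" "v 1" k, OF v(1) v(1) k, folded m_def]
  have m01: "m (v i) = v (Suc i) \<and> m (v (Suc i)) = v (Suc (Suc i))" for i
  proof (induction i)
    case 0
    have "k * disc (v 0) (v 1) = disc (v 1) (v 2)" using nz[of 0] by (simp add: k_def)
    then show ?case unfolding m_def mob_def using v(1) by (simp add: undisc_disc numeral_2_eq_2)
  next
    case (Suc i)
    obtain t where t: "t \<noteq> 0" "\<And>z. Im z > 0 \<Longrightarrow> disc (m (v (Suc i))) (m z) = t * disc (v (Suc i)) z"
      using disc_mob_mob[of "v 0" "v 1" k "v (Suc i)", OF v(1) v(1) k v(1), folded m_def] by blast
    have 1: "disc (v (Suc (Suc i))) (m (v (Suc (Suc i)))) = t * disc (v (Suc i)) (v (Suc (Suc i)))"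
      using t(2)[OF v(1)] Suc by metis
    have "disc (v (Suc (Suc i))) (v (Suc i)) = t * disc (v (Suc i)) (v i)"
      using t(2)[OF v(1)] Suc by metis
    then have "q * disc (v (Suc (Suc i))) (v (Suc (Suc (Suc i)))) = q * (t * disc (v (Suc i)) (v (Suc (Suc i))))"
      using q(2)[of "Suc i"] q(2)[of i] by simp
    then have "disc (v (Suc (Suc i))) (v (Suc (Suc (Suc i)))) = disc (v (Suc (Suc i))) (m (v (Suc (Suc i))))"
      using 1 q(1) by simp
    then have "m (v (Suc (Suc i))) = v (Suc (Suc (Suc i)))"
      using disc_inj[OF v(1) v(1) mp(1)[OF v(1)]] by metis
    then show ?case using Suc by simp
  qed
  obtain c K where c: "Im c > 0" "K > 0"
    "\<And>z. Im z > 0 \<Longrightarrow> (\<Sum>i<n. cosh (hyp_dist z (v i))) = K * cosh (hyp_dist z c)"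
    using hyp_centroid[of n v, OF n v(1)] by blast
  have mc: "Im (m c) > 0" by (rule mp(1)[OF c(1)])
  have vn: "v n = v 0" using v(2)[of 0] by simp
  \<comment> \<open>Shifting the vertices leaves the sum unchanged, so \<open>m c\<close> gives the
    same value as \<open>c\<close>. By the formula for the sum that value is attained at
    \<open>c\<close> only.\<close>
  have "K * cosh (hyp_dist (m c) c) = (\<Sum>i<n. cosh (hyp_dist (m c) (v i)))" using c(3)[OF mc] by simp
  also have "\<dots> = (\<Sum>i<n. cosh (hyp_dist (m c) (v (Suc i))))"
    using sum_Suc_cyclic[of "\<lambda>i. cosh (hyp_dist (m c) (v i))" n] vn by simp
  also have "\<dots> = (\<Sum>i<n. cosh (hyp_dist c (v i)))"
  proof (intro sum.cong refl)
    fix i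
    have "hyp_dist (m c) (m (v i)) = hyp_dist c (v i)"
      unfolding m_def by (rule hyp_dist_mob[OF v(1) v(1) k c(1) v(1)])
    then show "cosh (hyp_dist (m c) (v (Suc i))) = cosh (hyp_dist c (v i))" using m01 by metis
  qed
  also have "\<dots> = K" using c(3)[OF c(1)] by simp
  finally have "cosh (hyp_dist (m c) c) = 1" using c(2) by simp
  then have "hyp_dist (m c) c = 0" by simp
  then have mcc: "m c = c" using hyp_dist_eq_0_iff[OF mc c(1)] by simp
  obtain e where e: "e \<noteq> 0" "\<And>z. Im z > 0 \<Longrightarrow> disc (m c) (m z) = e * disc c z"
    using disc_mob_mob[of "v 0" "v 1" k c, OF v(1) v(1) k c(1), folded m_def] by blast
  define a where "a = disc c (v 0)"
  have ai: "disc c (v i) = a * e ^ i" for i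
  proof (induction i)
    case (Suc i)
    have "disc c (v (Suc i)) = e * disc c (v i)" using e(2)[OF v(1)] m01 mcc by metis
    then show ?case using Suc by simp
  qed (simp add: a_def)
  have a0: "a \<noteq> 0"
  proof
    assume "a = 0"
    then have "v i = c" for i using ai[of i] disc_eq_0_iff[OF c(1) v(1)] by simp
    then show False using nz[of 0] by simp
  qed
  have "a * e ^ n = a * e ^ 0" using ai[of n] ai[of 0] vn by simp
  then have "e ^ n = 1" using a0 by simp
  moreover have "e \<noteq> 1"
  proof
    assume "e = 1"
    then have "disc c (v 1) = disc c (v 0)" using ai[of 1] ai[of 0] by simp
    then have "v 1 = v 0" using disc_inj[OF c(1) v(1) v(1)] by blast
    then show False using nz[of 0] by simp
  qed
  ultimately show thesis using that[of c a e] c(1) a0 ai by blast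
qed

text \<open>In a central triangle with angle \<open>psi\<close> at the centre, \<open>C\<close> is
  the cosh of half the base. The right triangle cut off by the height gives sin(base angle) =
  cos(psi/2)/C, so \<open>arcsin (x / C)\<close> is the base angle, and twice the right-hand side is
  the defect pi - psi - 2 * (base angle). Computing sine and cosine of the difference also covers
  \<open>psi > pi\<close>, where the term is a signed area.\<close>

lemma Arg_one_minus_scaled:
  fixes p x s C :: real
  assumes "0 < p" "p < 1" "0 < psi" "psi < 2 * pi"
  defines "s \<equiv> sin (psi / 2)" and "x \<equiv> cos (psi / 2)"
  assumes C: "C > 1" "C\<^sup>2 = 1 + 4 * p * s\<^sup>2 / (1 - p)\<^sup>2"
  shows "- Arg (1 - of_real p * cis psi) = arcsin x - arcsin (x / C)"
proof -
  have s: "s > 0" unfolding s_def using assms(3,4) by (intro sin_gt_zero) auto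
  have sx: "s\<^sup>2 + x\<^sup>2 = 1" by (simp add: s_def x_def)
  have x1: "- 1 < x" "x < 1"
  proof -
    have "x\<^sup>2 < 1" using sx s zero_less_power[of s 2] by linarith
    then have "\<bar>x\<bar> < 1" by (simp add: abs_square_less_1)
    then show "- 1 < x" "x < 1" by auto
  qed
  have xC: "- 1 < x / C" "x / C < 1"
    using x1 C(1) by (simp_all add: pos_less_divide_eq pos_divide_less_eq)
  define b where "b = arcsin (x / C)"
  have arcx: "arcsin x = pi / 2 - psi / 2"
  proof -
    have "x = sin (pi / 2 - psi / 2)" by (simp add: x_def sin_diff)
    then show ?thesis using assms(3,4) by (simp only:) (rule arcsin_sin; simp)
  qed
  have sb: "sin b = x / C" unfolding b_def using xC by simp
  have C2: "C\<^sup>2 * (1 - p)\<^sup>2 = (1 - p)\<^sup>2 + 4 * p * s\<^sup>2"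
    unfolding C(2) using assms(2) by (simp add: distrib_right)
  have cb: "cos b = (1 + p) * s / ((1 - p) * C)"
  proof -
    have "(C\<^sup>2 - x\<^sup>2) * (1 - p)\<^sup>2 = ((1 + p) * s)\<^sup>2"
    proof -
      have "(C\<^sup>2 - x\<^sup>2) * (1 - p)\<^sup>2 = (1 - p)\<^sup>2 + 4 * p * s\<^sup>2 - (1 - s\<^sup>2) * (1 - p)\<^sup>2"
      proof -
        have x2: "x\<^sup>2 = 1 - s\<^sup>2" using sx by simp
        show ?thesis unfolding x2 C2[symmetric] by (simp add: left_diff_distrib)
      qed
      then show ?thesis by (simp add: power2_eq_square algebra_simps)
    qed
    then have "C\<^sup>2 - x\<^sup>2 = ((1 + p) * s)\<^sup>2 / (1 - p)\<^sup>2" using assms(2) by (simp add: eq_divide_eq)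
    moreover have "1 - (x / C)\<^sup>2 = (C\<^sup>2 - x\<^sup>2) / C\<^sup>2"
      using C(1) by (simp add: power_divide diff_divide_distrib)
    ultimately have "1 - (x / C)\<^sup>2 = ((1 + p) * s / ((1 - p) * C))\<^sup>2"
      by (simp add: power_divide power_mult_distrib)
    moreover have "(1 + p) * s / ((1 - p) * C) \<ge> 0" using assms s C by simp
    ultimately have "sqrt (1 - (x / C)\<^sup>2) = (1 + p) * s / ((1 - p) * C)" by (simp only: real_sqrt_unique)
    then show ?thesis unfolding b_def using xC by (simp add: cos_arcsin)
  qed
  define t where "t = arcsin x - b"
  have trig: "sin psi = 2 * s * x" "cos psi = x\<^sup>2 - s\<^sup>2"
    using sin_double[of "psi / 2"] cos_double[of "psi / 2"] by (simp_all add: s_def x_def)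
  have st: "sin t = (p * sin psi) / ((1 - p) * C)"
  proof -
    have "sin t = x * cos b - s * sin b"
      unfolding t_def arcx sin_diff by (simp add: sin_diff cos_diff s_def x_def)
    also have "\<dots> = (x * ((1 + p) * s) - s * x * (1 - p)) / ((1 - p) * C)"
      unfolding sb cb using assms(2) C(1) by (simp add: diff_divide_distrib)
    also have "x * ((1 + p) * s) - s * x * (1 - p) = p * sin psi"
      unfolding trig by (simp add: algebra_simps)
    finally show ?thesis .
  qed
  have ct: "cos t = (1 - p * cos psi) / ((1 - p) * C)"
  proof -
    have "cos t = s * cos b + x * sin b"
      unfolding t_def arcx cos_diff by (simp add: sin_diff cos_diff s_def x_def)
    also have "\<dots> = (s\<^sup>2 * (1 + p) + x\<^sup>2 * (1 - p)) / ((1 - p) * C)"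
      unfolding sb cb using assms(2) C(1) by (simp add: field_simps power2_eq_square)
    also have "s\<^sup>2 * (1 + p) + x\<^sup>2 * (1 - p) = 1 - p * cos psi"
      unfolding trig using sx by (simp add: algebra_simps)
    finally show ?thesis .
  qed
  have re: "1 - p * cos psi > 0"
  proof -
    have "p * cos psi \<le> p * 1" using assms(1) by (intro mult_left_mono) auto
    then show ?thesis using assms(2) by linarith
  qed
  then have ct0: "cos t > 0" unfolding ct using assms(2) C(1) by simp
  \<comment> \<open>A difference of two arcsines is at most pi in absolute value, and a positive
    cosine then confines it to the range of \<open>arctan\<close>.\<close>
  have "\<bar>t\<bar> < pi / 2"
  proof (rule ccontr)
    assume "\<not> \<bar>t\<bar> < pi / 2"
    moreover have "\<bar>t\<bar> \<le> pi"
      using arcsin_bounded[of x] arcsin_bounded[of "x / C"] x1 xC unfolding t_def b_def by (auto simp: abs_le_iff)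
    ultimately have "0 \<le> cos (pi - \<bar>t\<bar>)" by (intro cos_ge_zero) auto
    moreover have "cos (pi - \<bar>t\<bar>) = - cos t" by (simp add: cos_diff abs_if)
    ultimately show False using ct0 by simp
  qed
  moreover have "tan t = p * sin psi / (1 - p * cos psi)"
    unfolding tan_def st ct using assms(2) C(1) by simp
  ultimately have "arctan (p * sin psi / (1 - p * cos psi)) = t"
    by (intro arctan_unique) (auto simp: abs_less_iff)
  moreover have "Arg (1 - of_real p * cis psi) = arctan (- (p * sin psi / (1 - p * cos psi)))"
    using re by (subst Arg_eq_arctan) auto
  ultimately show ?thesis unfolding arctan_minus t_def b_def by simp
qed

lemma equiangular_edge_area:
  assumes v: "\<And>i. Im (v i) > 0" "v n = v 0" and c: "Im c > 0" "a \<noteq> 0"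
    and ai: "\<And>i. disc c (v i) = a * cis psi ^ i"
    and psi: "0 < psi" "psi < 2 * pi"
  shows "\<And>i. (cosh (hyp_dist (v i) (v (Suc i)) / 2))\<^sup>2 = 1 + 4 * (cmod a)\<^sup>2 * (sin (psi / 2))\<^sup>2 / (1 - (cmod a)\<^sup>2)\<^sup>2"
    and "(\<Sum>i<n. edge_area (v i) (v (Suc i))) =
    2 * real n * (arcsin (cos (psi / 2)) - arcsin (cos (psi / 2) / cosh (hyp_dist (v 0) (v 1) / 2)))"
proof -
  define p where "p = (cmod a)\<^sup>2"
  have p: "0 < p" "p < 1"
    using c norm_disc_sq_less_1[OF c(1) v(1)[of 0]] ai[of 0] by (auto simp: p_def)
  have nrm: "(cmod (disc c (v i)))\<^sup>2 = p" for i unfolding ai p_def by (simp add: norm_mult norm_power)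
  have e1: "(cmod (1 - cis psi))\<^sup>2 = 4 * (sin (psi / 2))\<^sup>2"
  proof -
    have "(cmod (1 - cis psi))\<^sup>2 = 1 - 2 * cos psi + ((cos psi)\<^sup>2 + (sin psi)\<^sup>2)"
      unfolding cmod_power2 by (simp add: power2_eq_square algebra_simps)
    also have "\<dots> = 2 - 2 * cos psi" by simp
    also have "cos psi = 1 - 2 * (sin (psi / 2))\<^sup>2" using cos_double_sin[of "psi / 2"] by simp
    finally show ?thesis by simp
  qed
  have ch: "(cosh (hyp_dist (v i) (v (Suc i)) / 2))\<^sup>2 = 1 + 4 * p * (sin (psi / 2))\<^sup>2 / (1 - p)\<^sup>2" for i
  proof -
    have "disc c (v i) - disc c (v (Suc i)) = a * cis psi ^ i * (1 - cis psi)"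
      unfolding ai by (simp add: algebra_simps)
    then have "(cmod (disc c (v i) - disc c (v (Suc i))))\<^sup>2 = p * (4 * (sin (psi / 2))\<^sup>2)"
      by (simp add: norm_mult norm_power power_mult_distrib p_def e1)
    then have "cosh (hyp_dist (v i) (v (Suc i))) = 1 + 2 * (p * (4 * (sin (psi / 2))\<^sup>2)) / ((1 - p) * (1 - p))"
      unfolding cosh_hyp_dist_disc[OF c(1) v(1) v(1)] nrm by simp
    moreover have "cosh (hyp_dist (v i) (v (Suc i))) = 2 * (cosh (hyp_dist (v i) (v (Suc i)) / 2))\<^sup>2 - 1"
      using cosh_double_cosh[of "hyp_dist (v i) (v (Suc i)) / 2"] by simp
    ultimately show ?thesis by (simp add: power2_eq_square)
  qed
  then show "(cosh (hyp_dist (v i) (v (Suc i)) / 2))\<^sup>2 = 1 + 4 * (cmod a)\<^sup>2 * (sin (psi / 2))\<^sup>2 / (1 - (cmod a)\<^sup>2)\<^sup>2" for i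
    by (simp add: p_def)
  let ?C = "cosh (hyp_dist (v 0) (v 1) / 2)"
  have "v 0 \<noteq> v 1"
  proof
    assume "v 0 = v 1"
    then have "cis psi = 1" using ai[of 0] ai[of 1] c(2) by simp
    then have "cos psi = 1" by (metis cis.simps(1) one_complex.simps(1))
    then have "sin (psi / 2) = 0" using cos_double_sin[of "psi / 2"] by simp
    moreover have "sin (psi / 2) > 0" using psi by (intro sin_gt_zero) auto
    ultimately show False by simp
  qed
  then have "hyp_dist (v 0) (v 1) / 2 > 0" using hyp_dist_pos[OF v(1) v(1)] by simp
  then have C1: "?C > 1" using cosh_real_nonneg_less_iff[of 0 "hyp_dist (v 0) (v 1) / 2"] by simp
  have "disc c (v (Suc i)) * cnj (disc c (v i)) = of_real p * cis psi" for i
  proof -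
    have "disc c (v (Suc i)) * cnj (disc c (v i)) = (a * cis psi ^ i) * cnj (a * cis psi ^ i) * cis psi"
      unfolding ai by (simp add: mult_ac)
    also have "(a * cis psi ^ i) * cnj (a * cis psi ^ i) = of_real ((cmod (a * cis psi ^ i))\<^sup>2)"
      by (rule complex_norm_square[symmetric])
    finally show ?thesis by (simp add: p_def norm_mult norm_power)
  qed
  then have "(\<Sum>i<n. edge_area (v i) (v (Suc i))) = 2 * real n * (- Arg (1 - of_real p * cis psi))"
    unfolding sum_edge_area_disc[of v, OF v c(1)] by simp
  also have "- Arg (1 - of_real p * cis psi) = arcsin (cos (psi / 2)) - arcsin (cos (psi / 2) / ?C)"
    by (rule Arg_one_minus_scaled[OF p psi C1]) (use ch[of 0] in simp)
  finally show "(\<Sum>i<n. edge_area (v i) (v (Suc i))) =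
    2 * real n * (arcsin (cos (psi / 2)) - arcsin (cos (psi / 2) / ?C))" .
qed

text \<open>The derivative is 1/sqrt(1 - t^2) - 1/sqrt(C^2 - t^2), positive as \<open>C > 1\<close>.
  With x = cos(psi/2) it says that for a given side the area falls as the central angle
  grows.\<close>

lemma arcsin_diff_strict_mono:
  assumes "C > 1" "- 1 < x" "x < y" "y < 1"
  shows "arcsin x - arcsin (x / C) < arcsin y - arcsin (y / C)"
proof (rule DERIV_pos_imp_increasing[OF assms(3)])
  fix t assume t: "x \<le> t" "t \<le> y"
  have t1: "- 1 < t" "t < 1" using t assms by auto
  have tC: "- 1 < t / C" "t / C < 1" using t1 assms(1) by (simp_all add: pos_less_divide_eq pos_divide_less_eq)
  have "((\<lambda>t. arcsin t - arcsin (t / C)) has_real_derivative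
      inverse (sqrt (1 - t\<^sup>2)) - inverse (sqrt (1 - (t / C)\<^sup>2)) * (1 / C)) (at t)"
    using assms(1) by (intro DERIV_diff DERIV_arcsin t1 DERIV_chain2[where f = arcsin] tC)
      (auto intro!: derivative_eq_intros)
  moreover have "inverse (sqrt (1 - (t / C)\<^sup>2)) * (1 / C) < inverse (sqrt (1 - t\<^sup>2))"
  proof -
    have t2: "t\<^sup>2 < 1" using t1 by (simp add: abs_square_less_1 abs_less_iff)
    have "1 < C\<^sup>2" using assms(1) by (simp add: one_less_power)
    then have "sqrt (1 - t\<^sup>2) < sqrt (C\<^sup>2 - t\<^sup>2)" by simp
    also have "C\<^sup>2 - t\<^sup>2 = C\<^sup>2 * (1 - (t / C)\<^sup>2)" using assms(1) by (simp add: power_divide right_diff_distrib)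
    also have "sqrt \<dots> = C * sqrt (1 - (t / C)\<^sup>2)" using assms(1) by (simp add: real_sqrt_mult)
    finally have "inverse (C * sqrt (1 - (t / C)\<^sup>2)) < inverse (sqrt (1 - t\<^sup>2))"
      using t2 by (intro less_imp_inverse_less) auto
    then show ?thesis by (simp add: divide_inverse mult.commute)
  qed
  ultimately show "\<exists>y. ((\<lambda>t. arcsin t - arcsin (t / C)) has_real_derivative y) (at t) \<and> 0 < y"
    by (intro exI conjI) auto
qed

lemma root_of_unity_cis:
  assumes "e ^ n = 1" "e \<noteq> 1" "n > 0"
  obtains m where "0 < m" "m < n" "e = cis (2 * pi * real m / real n)"
proof -
  have "e \<in> (\<lambda>k. cis (2 * pi * real k / real n)) ` {..<n}"
    using Complex.bij_betw_roots_unity[OF assms(3)] assms(1) by (simp add: bij_betw_def)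
  then obtain m where m: "m < n" "e = cis (2 * pi * real m / real n)" by auto
  moreover have "m > 0" using m(2) assms(2) by (cases m) auto
  ultimately show thesis using that by blast
qed

text \<open>The root of unity \<open>e\<close> is \<open>cis (2 * pi * m / n)\<close> for some
  \<open>m\<close>, the number of turns about the centre. Since cos(pi * m / n) decreases in
  \<open>m\<close>, every star with \<open>m > 1\<close> has smaller area than \<open>m = 1\<close>
  with the same side.\<close>

lemma equiangular_area_le:
  assumes n: "n \<ge> 2" and v: "\<And>i. Im (v i) > 0" "v n = v 0" and c: "Im c > 0" "a \<noteq> 0"
    and e: "e ^ n = 1" "e \<noteq> 1" and ai: "\<And>i. disc c (v i) = a * e ^ i"
  defines "l \<equiv> hyp_dist (v 0) (v 1)"
  defines "R \<equiv> 2 * real n * (arcsin (cos (pi / real n)) - arcsin (cos (pi / real n) / cosh (l / 2)))"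
  shows "(\<Sum>i<n. edge_area (v i) (v (Suc i))) \<le> R"
    and "(\<Sum>i<n. edge_area (v i) (v (Suc i))) = R \<Longrightarrow> e = cis (2 * pi / real n)"
proof -
  have n0: "n > 0" using n by simp
  obtain m where m: "0 < m" "m < n" "e = cis (2 * pi * real m / real n)"
    using root_of_unity_cis[OF e n0] by metis
  define psi where "psi = 2 * pi * real m / real n"
  have psi: "0 < psi" "psi < 2 * pi" using m n0 by (auto simp: psi_def field_simps)
  have psi2: "psi / 2 = pi * real m / real n" by (simp add: psi_def)
  have S: "(\<Sum>i<n. edge_area (v i) (v (Suc i))) =
    2 * real n * (arcsin (cos (psi / 2)) - arcsin (cos (psi / 2) / cosh (l / 2)))"
    unfolding l_def using ai unfolding m(3) psi_def[symmetric]
    by (rule equiangular_edge_area(2)[OF v c _ psi])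
  have "v 0 \<noteq> v 1" using ai[of 0] ai[of 1] c(2) e(2) by auto
  then have "l / 2 > 0" unfolding l_def using hyp_dist_pos[OF v(1) v(1)] by simp
  then have C1: "cosh (l / 2) > 1" using cosh_real_nonneg_less_iff[of 0 "l / 2"] by simp
  have lt: "(\<Sum>i<n. edge_area (v i) (v (Suc i))) < R" if "m \<noteq> 1"
  proof -
    have m1: "m > 1" using m that by simp
    have a: "pi / real n < psi / 2" "psi / 2 < pi" using m1 m psi n0 by (auto simp: psi2 field_simps)
    have b: "0 < pi / real n" using n0 by simp
    have "cos (psi / 2) < cos (pi / real n)" using a b by (intro cos_monotone_0_pi) auto
    moreover have "- 1 < cos (psi / 2)" using a b psi cos_monotone_0_pi[of "psi / 2" pi] by simp
    moreover have "cos (pi / real n) < 1"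
      using a b cos_monotone_0_pi[of 0 "pi / real n"] unfolding cos_zero by linarith
    ultimately show ?thesis
      unfolding S R_def using n0 arcsin_diff_strict_mono[OF C1] by simp
  qed
  have eq: "(\<Sum>i<n. edge_area (v i) (v (Suc i))) = R" if "m = 1"
    unfolding S R_def psi2 using that by simp
  show "(\<Sum>i<n. edge_area (v i) (v (Suc i))) \<le> R" using lt eq by (cases "m = 1") auto
  show "e = cis (2 * pi / real n)" if "(\<Sum>i<n. edge_area (v i) (v (Suc i))) = R"
  proof -
    have "m = 1" using lt that by (cases "m = 1") auto
    then show ?thesis using m(3) by simp
  qed
qed

context polygon
begin

text \<open>Simplicity excludes stars: the winding number about the centre is
  \<open>n * Arg e / (2 * pi)\<close>, it can only be 0 or \<open>s\<close>, and 0 would make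
  consecutive vertices equal.\<close>

lemma equiangular_turn:
  assumes c: "Im c > 0" "a \<noteq> 0" and e: "e ^ n = 1" and ai: "\<And>i. disc c (V i) = a * e ^ i"
    and o: "orientation s"
  shows "e = cis (2 * pi * s / real n)"
proof -
  have s: "s \<in> {1, -1}"
    and w: "\<And>p. Im p > 0 \<Longrightarrow> p \<notin> B \<Longrightarrow> wsum p = 2 * pi * (if p \<in> inside B then s else 0)"
    using o unfolding orientation_def by blast+
  have e0: "e \<noteq> 0" using e n0 by (cases "e = 0") (simp_all add: power_0_left)
  have "cmod e ^ n = 1 ^ n" using e by (simp flip: norm_power)
  then have ne: "cmod e = 1" by (rule power_eq_imp_eq_base) (use n0 in auto)
  have e1: "e \<noteq> 1"
  proof
    assume "e = 1"
    then have "disc c (V 1) = disc c (V 0)" using ai[of 1] ai[of 0] by simp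
    then have "V 1 = V 0" using disc_inj[OF c(1) Im_V Im_V] by blast
    then show False using V_Suc_neq[of 0] by simp
  qed
  have em1: "e \<noteq> - 1"
  proof
    assume "e = - 1"
    then have "disc c (V 2) = disc c (V 0)" using ai[of 2] ai[of 0] by simp
    then have "V 2 = V 0" using disc_inj[OF c(1) Im_V Im_V] by blast
    then show False using V_eq_iff[of 2 0] n3 by simp
  qed
  have "c \<notin> hyp_segment (V i) (V (Suc i))" for i
  proof
    assume "c \<in> hyp_segment (V i) (V (Suc i))"
    then have "cmod (disc c (V i) - disc c (V (Suc i))) = cmod (disc c (V i)) + cmod (disc c (V (Suc i)))"
      using in_hyp_segment_iff_opposite[OF c(1) Im_V Im_V] by blast
    moreover have "disc c (V i) - disc c (V (Suc i)) = a * e ^ i * (1 - e)" unfolding ai by (simp add: algebra_simps)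
    ultimately have "cmod a * cmod (1 - e) = 2 * cmod a" by (simp add: ai norm_mult norm_power ne)
    then have "cmod (1 - e) = 2" using c(2) by simp
    then have "(1 - Re e)\<^sup>2 + (Im e)\<^sup>2 = 4" using cmod_power2[of "1 - e"] by simp
    moreover have "(Re e)\<^sup>2 + (Im e)\<^sup>2 = 1" using ne cmod_power2[of e] by simp
    moreover have "(1 - Re e)\<^sup>2 = 1 - 2 * Re e + (Re e)\<^sup>2" by (simp add: power2_eq_square algebra_simps)
    ultimately have "Re e = - 1" by linarith
    moreover from this have "(Im e)\<^sup>2 = 0" using \<open>(Re e)\<^sup>2 + (Im e)\<^sup>2 = 1\<close> by simp
    ultimately show False using em1 by (simp add: complex_eq_iff)
  qed
  then have "c \<notin> B" by (auto simp: B_eq)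
  moreover have "wsum c = real n * Arg e"
    unfolding wsum_def ai using c(2) e0 by simp
  ultimately have "real n * Arg e = 2 * pi * (if c \<in> inside B then s else 0)" using w[OF c(1)] by simp
  moreover have "Arg e \<noteq> 0"
  proof
    assume "Arg e = 0"
    then have "e = 1" using rcis_cmod_Arg[of e] ne by simp
    then show False using e1 by simp
  qed
  ultimately have "Arg e = 2 * pi * s / real n" using n0 by (auto simp: field_simps split: if_splits)
  then show ?thesis using rcis_cmod_Arg[of e] ne by (simp add: rcis_def)
qed

end

section \<open>Gradients and the multiplier condition\<close>

lemma norm_diff_cnj_sq:
  "(cmod (w - cnj z))\<^sup>2 = (Re w - Re z)\<^sup>2 + (Im w + Im z)\<^sup>2"
  by (simp add: cmod_power2)

lemma Re_disc:
  assumes "Im z > 0" "Im w > 0"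
  shows "Re (disc z w) = ((Re w - Re z)\<^sup>2 + ((Im w)\<^sup>2 - (Im z)\<^sup>2)) / (cmod (w - cnj z))\<^sup>2"
proof -
  have "disc z w = (w - z) * cnj (w - cnj z) / of_real ((cmod (w - cnj z))\<^sup>2)"
    using diff_cnj_nonzero[OF assms] unfolding disc_def by (metis complex_div_cnj)
  then have "Re (disc z w) = Re ((w - z) * cnj (w - cnj z)) / (cmod (w - cnj z))\<^sup>2"
    by (simp only: Re_divide_of_real)
  also have "Re ((w - z) * cnj (w - cnj z)) = (Re w - Re z)\<^sup>2 + ((Im w)\<^sup>2 - (Im z)\<^sup>2)"
    by (simp add: algebra_simps power2_eq_square)
  finally show ?thesis .
qed

text \<open>Gradient with respect to the first endpoint, in half-plane coordinates. The summand -1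
  cancels between the two edges at a vertex, which leaves the difference of the neighbours in the
  disc.\<close>

definition area_grad :: "complex \<Rightarrow> complex \<Rightarrow> complex" where
  "area_grad z w = (disc z w - 1) / of_real (Im z)"

text \<open>A vector of Euclidean length \<open>1 / Im z\<close> pointing away from
  \<open>w\<close>. The factor \<open>\<i>\<close> is the rotation between the half-plane at
  \<open>z\<close> and its disc.\<close>

definition dist_grad :: "complex \<Rightarrow> complex \<Rightarrow> complex" where
  "dist_grad z w = - \<i> * disc z w / of_real (cmod (disc z w) * Im z)"

lemma edge_area_deriv:
  assumes "Im z > 0" "Im w > 0"
  shows "((\<lambda>s. edge_area (z + of_real s * a) (w + of_real s * b)) has_real_derivative
    area_grad z w \<bullet> a - area_grad w z \<bullet> b) (at 0)"
proof -
  define X where "X = Re w - Re z"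
  define Y where "Y = Im z + Im w"
  have Y: "Y > 0" using assms by (simp add: Y_def)
  define N where "N = X\<^sup>2 + Y\<^sup>2"
  have N: "N > 0" unfolding N_def using Y by (intro add_nonneg_pos) auto
  have N1: "(cmod (w - cnj z))\<^sup>2 = N" and N2: "(cmod (z - cnj w))\<^sup>2 = N"
    unfolding norm_diff_cnj_sq N_def X_def Y_def by (simp_all add: power2_commute add.commute)
  have "((\<lambda>s. 2 * arctan ((X + s * (Re b - Re a)) / (Y + s * (Im a + Im b)))) has_real_derivative
      2 * (inverse (1 + ((X + 0 * (Re b - Re a)) / (Y + 0 * (Im a + Im b)))\<^sup>2) *
        (((Re b - Re a) * Y - X * (Im a + Im b)) / (Y * Y)))) (at 0)"
    by (rule DERIV_cmult, rule DERIV_chain2[where f = arctan], rule DERIV_arctan)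
      (use Y in \<open>auto intro!: derivative_eq_intros simp: power2_eq_square\<close>)
  moreover have "edge_area (z + of_real s * a) (w + of_real s * b) =
      2 * arctan ((X + s * (Re b - Re a)) / (Y + s * (Im a + Im b)))" for s
  proof -
    have "Re (w + of_real s * b) - Re (z + of_real s * a) = X + s * (Re b - Re a)"
      "Im (z + of_real s * a) + Im (w + of_real s * b) = Y + s * (Im a + Im b)"
      by (simp_all add: X_def Y_def algebra_simps)
    then show ?thesis unfolding edge_area_def by simp
  qed
  moreover have "2 * (inverse (1 + ((X + 0 * (Re b - Re a)) / (Y + 0 * (Im a + Im b)))\<^sup>2) *
        (((Re b - Re a) * Y - X * (Im a + Im b)) / (Y * Y))) =
      2 * ((Re b - Re a) * Y - X * (Im a + Im b)) / N"
  proof -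
    have "1 + (X / Y)\<^sup>2 = N / (Y * Y)" using Y by (simp add: N_def power2_eq_square field_simps)
    then show ?thesis using Y N by simp
  qed
  moreover have "area_grad z w \<bullet> a - area_grad w z \<bullet> b = 2 * ((Re b - Re a) * Y - X * (Im a + Im b)) / N"
  proof -
    have g: "area_grad p q \<bullet> c = (- 2 * (Im p + Im q) * Re c - 2 * (Re q - Re p) * Im c) / (cmod (q - cnj p))\<^sup>2"
      if pq: "Im p > 0" "Im q > 0" for p q c
    proof -
      let ?M = "(cmod (q - cnj p))\<^sup>2"
      have M: "?M > 0" using diff_cnj_nonzero[OF pq] by simp
      have gen: "((- 2 * y * s / m) * x + (- 2 * y * d / m) * x') / y = (- 2 * s * x - 2 * d * x') / m"
        if "y > 0" "m > 0" for y s m x d x' :: real using that by (simp add: field_simps)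
      have "area_grad p q \<bullet> c = ((Re (disc p q) - 1) * Re c + Im (disc p q) * Im c) / Im p"
        unfolding area_grad_def inner_complex_def by (simp add: Re_divide_of_real Im_divide_of_real add_divide_distrib)
      also have "Re (disc p q) - 1 = - 2 * Im p * (Im p + Im q) / ?M"
      proof -
        have "Re (disc p q) - 1 = ((Re q - Re p)\<^sup>2 + ((Im q)\<^sup>2 - (Im p)\<^sup>2) - ?M) / ?M"
          unfolding Re_disc[OF pq] using M by (simp add: diff_divide_distrib)
        also have "(Re q - Re p)\<^sup>2 + ((Im q)\<^sup>2 - (Im p)\<^sup>2) - ?M = - 2 * Im p * (Im p + Im q)"
          unfolding norm_diff_cnj_sq by (simp add: power2_eq_square algebra_simps)
        finally show ?thesis .
      qed
      also have "Im (disc p q) = - 2 * Im p * (Re q - Re p) / ?M"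
        unfolding Im_disc[OF pq] by (simp add: algebra_simps)
      also have "(- 2 * Im p * (Im p + Im q) / ?M * Re c + - 2 * Im p * (Re q - Re p) / ?M * Im c) / Im p =
        (- 2 * (Im p + Im q) * Re c - 2 * (Re q - Re p) * Im c) / ?M" by (rule gen[OF pq(1) M])
      finally show ?thesis .
    qed
    show ?thesis
      unfolding g[OF assms] g[OF assms(2,1)] N1 N2 diff_divide_distrib[symmetric]
      by (simp add: X_def Y_def algebra_simps)
  qed
  ultimately show ?thesis by simp
qed

lemma sinh_hyp_dist_disc:
  assumes "Im z > 0" "Im w > 0"
  shows "sinh (hyp_dist z w) = cmod (disc z w) * (cmod (w - cnj z))\<^sup>2 / (2 * Im z * Im w)"
  unfolding cosh_hyp_dist_radius(2)[OF assms] one_minus_disc_sq[OF assms] by simp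

lemma dist_grad_inner:
  assumes "Im z > 0" "Im w > 0" "z \<noteq> w"
  shows "sinh (hyp_dist z w) * (dist_grad z w \<bullet> a) =
    (- 2 * (Re w - Re z) * Re a - ((Re w - Re z)\<^sup>2 + ((Im w)\<^sup>2 - (Im z)\<^sup>2)) / Im z * Im a) / (2 * Im z * Im w)"
proof -
  let ?Q = "disc z w" and ?N = "(cmod (w - cnj z))\<^sup>2"
  have N: "?N > 0" using diff_cnj_nonzero[OF assms(1,2)] by simp
  have Q: "cmod ?Q > 0" using disc_eq_0_iff assms by simp
  have "dist_grad z w \<bullet> a = (Im ?Q * Re a - Re ?Q * Im a) / (cmod ?Q * Im z)"
    unfolding dist_grad_def inner_complex_def
    by (simp only: Re_divide_of_real Im_divide_of_real) (simp add: diff_divide_distrib)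
  then have "sinh (hyp_dist z w) * (dist_grad z w \<bullet> a) = ?N * (Im ?Q * Re a - Re ?Q * Im a) / (2 * Im z * Im z * Im w)"
    unfolding sinh_hyp_dist_disc[OF assms(1,2)] using Q assms by simp
  also have "?N * (Im ?Q * Re a - Re ?Q * Im a) = (?N * Im ?Q) * Re a - (?N * Re ?Q) * Im a"
    by (simp add: algebra_simps)
  also have "?N * Im ?Q = - 2 * Im z * (Re w - Re z)"
  proof -
    have "?N * Im ?Q = ?N * (2 * Im z * (Re z - Re w) / ?N)" by (simp only: Im_disc[OF assms(1,2)])
    also have "\<dots> = 2 * Im z * (Re z - Re w)" using N by simp
    finally show ?thesis by (simp add: algebra_simps)
  qed
  also have "?N * Re ?Q = (Re w - Re z)\<^sup>2 + ((Im w)\<^sup>2 - (Im z)\<^sup>2)"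
    unfolding Re_disc[OF assms(1,2)] using N by simp
  finally show ?thesis using assms by (simp add: field_simps)
qed

text \<open>The distance has no derivative at coinciding points. This is why a maximal tuple is
  first freed from sides of length zero.\<close>

lemma hyp_dist_deriv:
  assumes "Im z > 0" "Im w > 0" "z \<noteq> w"
  shows "((\<lambda>s. hyp_dist (z + of_real s * a) (w + of_real s * b)) has_real_derivative
    dist_grad z w \<bullet> a + dist_grad w z \<bullet> b) (at 0)"
proof -
  define X where "X = Re w - Re z"
  define V where "V = Im w - Im z"
  define y where "y = Im z"
  define y' where "y' = Im w"
  have y: "y > 0" "y' > 0" using assms by (simp_all add: y_def y'_def)
  define u where "u s = 1 + ((X + s * (Re b - Re a))\<^sup>2 + (V + s * (Im b - Im a))\<^sup>2) / (2 * ((y + s * Im a) * (y' + s * Im b)))" for s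
  have dist: "hyp_dist (z + of_real s * a) (w + of_real s * b) = arcosh (u s)" for s
  proof -
    have "(cmod (z + of_real s * a - (w + of_real s * b)))\<^sup>2 =
        (X + s * (Re b - Re a))\<^sup>2 + (V + s * (Im b - Im a))\<^sup>2"
      unfolding cmod_power2 X_def V_def by (simp add: power2_eq_square algebra_simps)
    moreover have "Im (z + of_real s * a) = y + s * Im a" "Im (w + of_real s * b) = y' + s * Im b"
      by (simp_all add: y_def y'_def)
    ultimately show ?thesis unfolding hyp_dist_def u_def by (simp only: mult.assoc)
  qed
  define u' where "u' = ((2 * X * (Re b - Re a) + 2 * V * (Im b - Im a)) * (2 * (y * y')) -
      (X\<^sup>2 + V\<^sup>2) * (2 * (Im a * y' + y * Im b))) / ((2 * (y * y')) * (2 * (y * y')))"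
  have du: "(u has_real_derivative u') (at 0)"
    unfolding u_def u'_def using y
    by (auto intro!: derivative_eq_intros simp: power2_eq_square algebra_simps)
  have pos: "hyp_dist z w > 0" using hyp_dist_pos assms by blast
  have ch: "cosh (hyp_dist z w) = u 0"
  proof -
    have "(cmod (z - w))\<^sup>2 = X\<^sup>2 + V\<^sup>2"
      unfolding cmod_power2 X_def V_def by (simp add: power2_commute)
    then show ?thesis unfolding cosh_hyp_dist[OF assms(1,2)] u_def y_def y'_def by (simp add: mult.assoc)
  qed
  then have u1: "u 0 > 1" using pos cosh_real_nonneg_less_iff[of 0 "hyp_dist z w"] by simp
  have sh: "sqrt ((u 0)\<^sup>2 - 1) = sinh (hyp_dist z w)"
    unfolding ch[symmetric] cosh_square_eq using pos by simp
  have "((\<lambda>s. arcosh (u s)) has_real_derivative (1 / sqrt ((u 0)\<^sup>2 - 1)) * u') (at 0)"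
    by (rule DERIV_chain2[where f = arcosh, OF arcosh_real_has_field_derivative[OF u1] du])
  moreover have "(1 / sqrt ((u 0)\<^sup>2 - 1)) * u' = dist_grad z w \<bullet> a + dist_grad w z \<bullet> b"
  proof -
    have s0: "sinh (hyp_dist z w) > 0" using pos by simp
    have "sinh (hyp_dist z w) * (dist_grad w z \<bullet> b) =
      (2 * X * Re b - (X\<^sup>2 - (y'\<^sup>2 - y\<^sup>2)) / y' * Im b) / (2 * y * y')"
      using dist_grad_inner[OF assms(2,1), of b] assms(3)
      unfolding hyp_dist_sym[of w z] X_def y_def y'_def
      by (simp add: power2_commute[of "Re z"] algebra_simps)
    moreover have "sinh (hyp_dist z w) * (dist_grad z w \<bullet> a) =
      (- 2 * X * Re a - (X\<^sup>2 + (y'\<^sup>2 - y\<^sup>2)) / y * Im a) / (2 * y * y')"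
      using dist_grad_inner[OF assms, of a] unfolding X_def y_def y'_def .
    ultimately have "sinh (hyp_dist z w) * (dist_grad z w \<bullet> a + dist_grad w z \<bullet> b) =
      (- 2 * X * Re a - (X\<^sup>2 + (y'\<^sup>2 - y\<^sup>2)) / y * Im a) / (2 * y * y') +
      (2 * X * Re b - (X\<^sup>2 - (y'\<^sup>2 - y\<^sup>2)) / y' * Im b) / (2 * y * y')"
      by (simp add: distrib_left)
    also have "\<dots> = u'"
    proof -
      have V: "V = y' - y" by (simp add: V_def y_def y'_def)
      show ?thesis unfolding u'_def V using y
        by (simp add: divide_simps) (simp add: algebra_simps power2_eq_square)
    qed
    finally show ?thesis unfolding sh using s0 by (simp add: field_simps)
  qed
  ultimately show ?thesis unfolding dist by simp
qed

text \<open>The multiplier rule needs one direction along which the length decreases; translation upwards is one.\<close>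

lemma dist_grad_up_neg:
  assumes "Im z > 0" "Im w > 0" "z \<noteq> w"
  shows "dist_grad z w \<bullet> \<i> + dist_grad w z \<bullet> \<i> < 0"
proof -
  define X where "X = Re w - Re z"
  define y where "y = Im z"
  define y' where "y' = Im w"
  have y: "y > 0" "y' > 0" using assms by (simp_all add: y_def y'_def)
  have s0: "sinh (hyp_dist z w) > 0" using hyp_dist_pos assms by simp
  have e1: "sinh (hyp_dist z w) * (dist_grad z w \<bullet> \<i>) = - ((X\<^sup>2 + (y'\<^sup>2 - y\<^sup>2)) / y) / (2 * y * y')"
    using dist_grad_inner[OF assms, of \<i>] unfolding X_def y_def y'_def by simp
  have e2: "sinh (hyp_dist z w) * (dist_grad w z \<bullet> \<i>) = - ((X\<^sup>2 + (y\<^sup>2 - y'\<^sup>2)) / y') / (2 * y * y')"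
    using dist_grad_inner[OF assms(2,1), of \<i>] assms(3) unfolding hyp_dist_sym[of w z] X_def y_def y'_def
    by (simp add: power2_commute[of "Re z"] mult.commute mult.left_commute)
  have "sinh (hyp_dist z w) * (dist_grad z w \<bullet> \<i> + dist_grad w z \<bullet> \<i>) =
     - ((X\<^sup>2 + (y' - y)\<^sup>2) * (y + y')) / (y * y' * (2 * y * y'))"
    unfolding distrib_left[of "sinh (hyp_dist z w)"] e1 e2 using y
    by (simp add: divide_simps) (simp add: algebra_simps power2_eq_square)
  also have "\<dots> < 0"
  proof -
    have "X \<noteq> 0 \<or> y' \<noteq> y" using assms(3) by (auto simp: X_def y_def y'_def complex_eq_iff)
    then have "X\<^sup>2 + (y' - y)\<^sup>2 > 0" by (auto simp: add_pos_nonneg add_nonneg_pos)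
    then have "(X\<^sup>2 + (y' - y)\<^sup>2) * (y + y') / (y * y' * (2 * y * y')) > 0" using y by simp
    then show ?thesis by simp
  qed
  finally show ?thesis using s0 by (simp add: mult_less_0_iff)
qed

text \<open>Where \<open>h\<close> vanishes, so does \<open>g\<close>: if \<open>g u > 0\<close> and
  \<open>h u = 0\<close>, a small multiple of \<open>w\<close> added to \<open>u\<close> makes
  \<open>h\<close> negative and keeps \<open>g\<close> positive. A linear functional vanishing on
  the kernel of \<open>h\<close> is a multiple of \<open>h\<close>.\<close>

lemma lagrange_sum:
  fixes G H :: "nat \<Rightarrow> complex"
  assumes no: "\<And>u. \<not> ((\<Sum>i<n. G i \<bullet> u i) > 0 \<and> (\<Sum>i<n. H i \<bullet> u i) < 0)"
    and w: "(\<Sum>i<n. H i \<bullet> w i) < 0"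
  obtains l :: real where "\<And>i. i < n \<Longrightarrow> G i = of_real l * H i"
proof -
  define g where "g u = (\<Sum>i<n. G i \<bullet> u i)" for u
  define h where "h u = (\<Sum>i<n. H i \<bullet> u i)" for u
  have lin: "g (\<lambda>i. u i + of_real t * x i) = g u + t * g x" "h (\<lambda>i. u i + of_real t * x i) = h u + t * h x" for u t x
    by (simp_all add: g_def h_def inner_add_right sum.distrib sum_distrib_left scaleR_conv_of_real[symmetric])
  have neg: "g (\<lambda>i. - u i) = - g u" "h (\<lambda>i. - u i) = - h u" for u
    by (simp_all add: g_def h_def sum_negf)
  have hw: "h w < 0" using w by (simp add: h_def)
  have npos: "\<not> g u > 0" if hu: "h u = 0" for u
  proof
    assume gu: "g u > 0"
    \<comment> \<open>Small enough that adding \<open>t\<close> times \<open>w\<close> costs less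
      than \<open>g u\<close>; the 1 keeps the denominator positive.\<close>
    define t where "t = g u / (2 * (\<bar>g w\<bar> + 1))"
    have t: "t > 0" using gu by (simp add: t_def)
    have "t * \<bar>g w\<bar> < g u"
    proof -
      have "t * (2 * (\<bar>g w\<bar> + 1)) = g u" by (simp add: t_def)
      moreover have "t * \<bar>g w\<bar> < t * (2 * (\<bar>g w\<bar> + 1))" using t by (intro mult_strict_left_mono) auto
      ultimately show ?thesis by simp
    qed
    moreover have "t * (- \<bar>g w\<bar>) \<le> t * g w" using t by (intro mult_left_mono) auto
    ultimately have "g u + t * g w > 0" by simp
    moreover have "h u + t * h w < 0" using hu hw t by (simp add: mult_pos_neg)
    ultimately show False using no[of "\<lambda>i. u i + of_real t * w i"] lin[of u t w] by (simp add: g_def h_def)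
  qed
  have zero: "g u = 0" if "h u = 0" for u
    using npos[OF that] npos[of "\<lambda>i. - u i"] neg that by (simp add: not_less)
  define l where "l = g w / h w"
  have gl: "g u = l * h u" for u
  proof -
    have "h (\<lambda>i. u i + of_real (- (h u / h w)) * w i) = 0" unfolding lin using hw by simp
    then have "g u + (- (h u / h w)) * g w = 0" using zero lin by metis
    then show ?thesis using hw by (simp add: l_def field_simps)
  qed
  have "G i = of_real l * H i" if i: "i < n" for i
  proof -
    define d where "d = G i - of_real l * H i"
    \<comment> \<open>Testing with the defect itself, placed at index \<open>i\<close>, makes its
      norm vanish.\<close>
    define u where "u j = (if j = i then d else 0)" for j
    have s: "(\<Sum>j<n. F j \<bullet> u j) = F i \<bullet> d" for F :: "nat \<Rightarrow> complex"
    proof -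
      have "(\<Sum>j<n. F j \<bullet> u j) = (\<Sum>j<n. if j = i then F i \<bullet> d else 0)"
        by (intro sum.cong) (auto simp: u_def)
      then show ?thesis using i by simp
    qed
    have "G i \<bullet> d = l * (H i \<bullet> d)" using gl[of u] unfolding g_def h_def s .
    then have "d \<bullet> d = 0" by (simp add: d_def inner_diff_left scaleR_conv_of_real[symmetric])
    then show ?thesis by (simp add: d_def)
  qed
  then show thesis using that by blast
qed

section \<open>Closed tuples and the extremal problem\<close>

definition closed_tuple :: "nat \<Rightarrow> (nat \<Rightarrow> complex) \<Rightarrow> bool" where
  "closed_tuple n v \<longleftrightarrow> (\<forall>i. Im (v i) > 0) \<and> (\<forall>i. v (i + n) = v i)"

definition tuple_area :: "nat \<Rightarrow> (nat \<Rightarrow> complex) \<Rightarrow> real" where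
  "tuple_area n v = (\<Sum>i<n. edge_area (v i) (v (Suc i)))"

definition tuple_length :: "nat \<Rightarrow> (nat \<Rightarrow> complex) \<Rightarrow> real" where
  "tuple_length n v = (\<Sum>i<n. hyp_dist (v i) (v (Suc i)))"

text \<open>Length at most \<open>L\<close> instead of exactly \<open>L\<close>: a perturbation that
  shortens the tuple stays admissible, so no constraint has to be solved along a variation.\<close>

definition maximal_tuple :: "nat \<Rightarrow> real \<Rightarrow> (nat \<Rightarrow> complex) \<Rightarrow> bool" where
  "maximal_tuple n L v \<longleftrightarrow> closed_tuple n v \<and> tuple_length n v \<le> L \<and>
     (\<forall>w. closed_tuple n w \<and> tuple_length n w \<le> L \<longrightarrow> tuple_area n w \<le> tuple_area n v)"

lemma closed_tupleD:
  assumes "closed_tuple n v"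
  shows "Im (v i) > 0" "v (i + n) = v i" "v n = v 0"
  using assms unfolding closed_tuple_def by (simp, simp, metis add_0)

lemma closed_tuple_mod:
  assumes "closed_tuple n v"
  shows "v (i mod n) = v i"
proof (induction i rule: less_induct)
  case (less i)
  show ?case
  proof (cases "i < n \<or> n = 0")
    case False
    then have "v i = v (i - n)" using closed_tupleD(2)[OF assms, of "i - n"] by simp
    also have "\<dots> = v ((i - n) mod n)" using False by (intro less[symmetric]) auto
    finally show ?thesis using False by (simp add: mod_if[of i])
  qed auto
qed

text \<open>Collects at vertex \<open>i\<close> the contribution of the edge that ends there;
  \<open>i + (n - 1)\<close> is its predecessor.\<close>

lemma sum_cyclic_gradient:
  fixes v u :: "nat \<Rightarrow> complex"
  assumes "n > 0" "\<And>i. v (i + n) = v i" "u n = u 0"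
  shows "(\<Sum>i<n. F (v (Suc i)) (v i) \<bullet> u (Suc i)) = (\<Sum>i<n. F (v i) (v (i + (n - 1))) \<bullet> u i)"
proof -
  have "Suc i + (n - 1) = i + n" for i using assms(1) by simp
  then have "v (Suc i + (n - 1)) = v i" for i using assms(2) by metis
  then have "(\<Sum>i<n. F (v (Suc i)) (v i) \<bullet> u (Suc i)) =
      (\<Sum>i<n. F (v (Suc i)) (v (Suc i + (n - 1))) \<bullet> u (Suc i))" by (simp only:)
  also have "\<dots> = (\<Sum>i<n. F (v i) (v (i + (n - 1))) \<bullet> u i)"
  proof (rule sum_Suc_cyclic[of "\<lambda>i. F (v i) (v (i + (n - 1))) \<bullet> u i"])
    have "v (n + (n - 1)) = v (0 + (n - 1))" using assms(2)[of "n - 1"] by (simp add: add.commute)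
    moreover have "v n = v 0" using assms(2)[of 0] by simp
    ultimately show "F (v n) (v (n + (n - 1))) \<bullet> u n = F (v 0) (v (0 + (n - 1))) \<bullet> u 0"
      using assms(3) by metis
  qed
  finally show ?thesis .
qed

lemma maximal_tuple_lagrange:
  assumes n: "n > 0" and m: "maximal_tuple n L v" and nz: "\<And>i. v i \<noteq> v (Suc i)"
  obtains l :: real where "\<And>i. i < n \<Longrightarrow> area_grad (v i) (v (Suc i)) - area_grad (v i) (v (i + (n - 1))) =
    of_real l * (dist_grad (v i) (v (Suc i)) + dist_grad (v i) (v (i + (n - 1))))"
proof -
  have cl: "closed_tuple n v" using m by (simp add: maximal_tuple_def)
  note v = closed_tupleD[OF cl]
  define G where "G i = area_grad (v i) (v (Suc i)) - area_grad (v i) (v (i + (n - 1)))" for i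
  define H where "H i = dist_grad (v i) (v (Suc i)) + dist_grad (v i) (v (i + (n - 1)))" for i
  have sums: "(\<Sum>i<n. area_grad (v i) (v (Suc i)) \<bullet> u i - area_grad (v (Suc i)) (v i) \<bullet> u (Suc i)) = (\<Sum>i<n. G i \<bullet> u i)"
    "(\<Sum>i<n. dist_grad (v i) (v (Suc i)) \<bullet> u i + dist_grad (v (Suc i)) (v i) \<bullet> u (Suc i)) = (\<Sum>i<n. H i \<bullet> u i)"
    if "u n = u 0" for u
    using sum_cyclic_gradient[of n v u area_grad, OF n v(2) that] sum_cyclic_gradient[of n v u dist_grad, OF n v(2) that]
    by (simp_all add: G_def H_def sum_subtractf sum.distrib inner_diff_left inner_add_left)
  have no: "\<not> ((\<Sum>i<n. G i \<bullet> u i) > 0 \<and> (\<Sum>i<n. H i \<bullet> u i) < 0)" for u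
  proof
    assume gh: "(\<Sum>i<n. G i \<bullet> u i) > 0 \<and> (\<Sum>i<n. H i \<bullet> u i) < 0"
    \<comment> \<open>The direction is made periodic so that the perturbed tuple stays
      closed.\<close>
    define x where "x i = u (i mod n)" for i
    have ux: "(\<Sum>i<n. F i \<bullet> u i) = (\<Sum>i<n. F i \<bullet> x i)" for F :: "nat \<Rightarrow> complex"
      by (simp add: x_def)
    have g: "(\<Sum>i<n. G i \<bullet> x i) > 0" and h: "(\<Sum>i<n. H i \<bullet> x i) < 0"
      using gh unfolding ux by blast+
    have xn: "x (i + n) = x i" "x n = x 0" for i by (simp_all add: x_def)
    define y where "y s i = v i + of_real s * x i" for s i
    have dA: "((\<lambda>s. tuple_area n (y s)) has_real_derivative (\<Sum>i<n. G i \<bullet> x i)) (at 0)"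
      unfolding tuple_area_def y_def sums(1)[OF xn(2), symmetric]
      by (intro DERIV_sum edge_area_deriv v)
    have dL: "((\<lambda>s. tuple_length n (y s)) has_real_derivative (\<Sum>i<n. H i \<bullet> x i)) (at 0)"
      unfolding tuple_length_def y_def sums(2)[OF xn(2), symmetric]
      by (intro DERIV_sum hyp_dist_deriv v nz)
    obtain d1 where d1: "d1 > 0" "\<And>s. 0 < s \<Longrightarrow> s < d1 \<Longrightarrow> tuple_area n (y 0) < tuple_area n (y s)"
      using DERIV_pos_inc_right[OF dA g] by auto
    obtain d2 where d2: "d2 > 0" "\<And>s. 0 < s \<Longrightarrow> s < d2 \<Longrightarrow> tuple_length n (y s) < tuple_length n (y 0)"
      using DERIV_neg_dec_right[OF dL h] by auto
    have "\<forall>\<^sub>F s in at_right 0. \<forall>i\<in>{..<n}. Im (y s i) > 0"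
    proof (intro eventually_ball_finite ballI)
      fix i
      have "((\<lambda>s. Im (y s i)) \<longlongrightarrow> Im (v i + of_real 0 * x i)) (at_right 0)"
        unfolding y_def by (intro tendsto_intros)
      then show "\<forall>\<^sub>F s in at_right 0. Im (y s i) > 0" using v(1)[of i] by (intro order_tendstoD) auto
    qed simp
    moreover have "\<forall>\<^sub>F s in at_right 0. 0 < s \<and> s < min d1 d2"
      using d1(1) d2(1) by (auto simp: eventually_at_right_field intro!: exI[of _ "min d1 d2"])
    ultimately have "\<forall>\<^sub>F s in at_right 0. (\<forall>i\<in>{..<n}. Im (y s i) > 0) \<and> 0 < s \<and> s < min d1 d2"
      by eventually_elim simp
    then obtain s where s: "\<forall>i\<in>{..<n}. Im (y s i) > 0" "0 < s" "s < d1" "s < d2"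
      using eventually_happens' trivial_limit_at_right_real by fastforce
    have y0: "y 0 = v" by (simp add: y_def fun_eq_iff)
    have per: "y s (i + n) = y s i" for i using v(2) xn(1) by (simp add: y_def)
    have "y s i = y s (i mod n)" for i
    proof -
      have "v i = v (i mod n)" using closed_tuple_mod[OF cl] by simp
      then show ?thesis by (simp add: y_def x_def)
    qed
    then have "closed_tuple n (y s)"
      unfolding closed_tuple_def using s(1) per n by (metis lessThan_iff mod_less_divisor)
    moreover have "tuple_length n (y s) \<le> L"
      using d2(2)[OF s(2,4)] m unfolding y0 maximal_tuple_def by simp
    ultimately have "tuple_area n (y s) \<le> tuple_area n v" using m by (simp add: maximal_tuple_def)
    then show False using d1(2)[OF s(2,3)] by (simp add: y0)
  qed
  have "(\<Sum>i<n. H i \<bullet> \<i>) = (\<Sum>i<n. dist_grad (v i) (v (Suc i)) \<bullet> \<i> + dist_grad (v (Suc i)) (v i) \<bullet> \<i>)"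
    using sums(2)[of "\<lambda>_. \<i>"] by simp
  also have "\<dots> < (\<Sum>i<n. 0)"
    using n dist_grad_up_neg[OF v(1) v(1) nz] by (intro sum_strict_mono) auto
  finally have neg: "(\<Sum>i<n. H i \<bullet> \<i>) < 0" by simp
  show thesis
  proof (rule lagrange_sum[where n = n and G = G and H = H and w = "\<lambda>_. \<i>", OF no neg])
    fix l assume "\<And>i. i < n \<Longrightarrow> G i = of_real l * H i"
    then show thesis unfolding G_def H_def by (rule that)
  qed
qed

text \<open>
  The multiplier equation at a vertex, in the disc centred at that vertex. Taking absolute values in
  \<open>Q (1 + \<i> l / |Q|) = P (1 - \<i> l / |P|)\<close> yields \<open>|P| = |Q|\<close>, and then \<open>P / Q\<close> depends on \<open>l\<close> and
  \<open>|Q|\<close> only.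
\<close>

lemma lagrange_vertex:
  assumes "Im v > 0" "Im p > 0" "Im q > 0" "v \<noteq> p" "v \<noteq> q"
    and e: "area_grad v q - area_grad v p = of_real l * (dist_grad v q + dist_grad v p)"
  shows "cmod (disc v p) = cmod (disc v q)"
    and "disc v p = (of_real (cmod (disc v q)) + \<i> * of_real l) / (of_real (cmod (disc v q)) - \<i> * of_real l) * disc v q"
proof -
  let ?P = "disc v p" and ?Q = "disc v q" and ?y = "complex_of_real (Im v)"
  have P: "cmod ?P > 0" and Q: "cmod ?Q > 0" using assms disc_eq_0_iff by auto
  have y: "?y \<noteq> 0" using assms by simp
  have "(?Q - ?P) / ?y = area_grad v q - area_grad v p"
    by (simp add: area_grad_def diff_divide_distrib)
  also have "\<dots> = (of_real l * (- \<i> * ?Q / of_real (cmod ?Q) + - \<i> * ?P / of_real (cmod ?P))) / ?y"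
    unfolding e dist_grad_def using y P Q by (simp add: field_simps)
  finally have "?Q - ?P = of_real l * (- \<i> * ?Q / of_real (cmod ?Q) + - \<i> * ?P / of_real (cmod ?P))"
    using y by simp
  then have eq: "?Q * (1 + \<i> * of_real (l / cmod ?Q)) = ?P * (1 - \<i> * of_real (l / cmod ?P))"
    by (simp add: algebra_simps)
  have nrm: "cmod (1 + \<i> * of_real t) = sqrt (1 + t\<^sup>2)" "cmod (1 - \<i> * of_real t) = sqrt (1 + t\<^sup>2)" for t
    by (simp_all add: cmod_def)
  have "cmod ?Q * sqrt (1 + (l / cmod ?Q)\<^sup>2) = cmod ?P * sqrt (1 + (l / cmod ?P)\<^sup>2)"
    using arg_cong[OF eq, of cmod] by (simp only: norm_mult nrm)
  then have sq: "(cmod ?Q * sqrt (1 + (l / cmod ?Q)\<^sup>2))\<^sup>2 = (cmod ?P * sqrt (1 + (l / cmod ?P)\<^sup>2))\<^sup>2" by simp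
  have f: "(c * sqrt (1 + (l / c)\<^sup>2))\<^sup>2 = c\<^sup>2 + l\<^sup>2" if "c > 0" for c
  proof -
    have "0 \<le> 1 + (l / c)\<^sup>2" by simp
    then have "(c * sqrt (1 + (l / c)\<^sup>2))\<^sup>2 = c\<^sup>2 * (1 + (l / c)\<^sup>2)"
      by (simp only: power_mult_distrib real_sqrt_pow2)
    then show ?thesis using that by (simp add: distrib_left power_divide)
  qed
  have "(cmod ?Q)\<^sup>2 = (cmod ?P)\<^sup>2" using sq unfolding f[OF P] f[OF Q] by simp
  then show PQ: "cmod ?P = cmod ?Q" by simp
  let ?r = "complex_of_real (cmod ?Q)"
  have r: "?r \<noteq> 0" using Q by simp
  have nz: "?r - \<i> * of_real l \<noteq> 0" using Q by (auto simp: complex_eq_iff)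
  have "?Q * (1 + \<i> * (of_real l / ?r)) = ?P * (1 - \<i> * (of_real l / ?r))"
    using eq unfolding PQ by simp
  then have "?Q * (?r + \<i> * of_real l) / ?r = ?P * (?r - \<i> * of_real l) / ?r"
    using r by (simp add: field_simps)
  then have "?Q * (?r + \<i> * of_real l) = ?P * (?r - \<i> * of_real l)" using r by simp
  then show "?P = (?r + \<i> * of_real l) / (?r - \<i> * of_real l) * ?Q"
    using nz by (simp add: field_simps)
qed

lemma maximal_tuple_centre:
  assumes n: "n > 0" and m: "maximal_tuple n L v" and nz: "\<And>i. v i \<noteq> v (Suc i)"
  obtains c a e where "Im c > 0" "a \<noteq> 0" "e ^ n = 1" "e \<noteq> 1" "\<And>i. disc c (v i) = a * e ^ i"
proof -
  have cl: "closed_tuple n v" using m by (simp add: maximal_tuple_def)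
  note v = closed_tupleD[OF cl]
  obtain l :: real where l: "\<And>i. i < n \<Longrightarrow> area_grad (v i) (v (Suc i)) - area_grad (v i) (v (i + (n - 1))) =
    of_real l * (dist_grad (v i) (v (Suc i)) + dist_grad (v i) (v (i + (n - 1))))"
    using maximal_tuple_lagrange[OF n m nz] by blast
  note vmod = closed_tuple_mod[OF cl]
  have Suc_mod: "v (Suc (i mod n)) = v (Suc i)" for i
    using vmod[of "Suc (i mod n)"] vmod[of "Suc i"] by (simp add: mod_Suc_eq)
  have pre_mod: "v (i mod n + (n - 1)) = v (i + (n - 1))" for i
    using vmod[of "i mod n + (n - 1)"] vmod[of "i + (n - 1)"] by (simp add: mod_add_left_eq)
  have l': "area_grad (v i) (v (Suc i)) - area_grad (v i) (v (i + (n - 1))) =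
    of_real l * (dist_grad (v i) (v (Suc i)) + dist_grad (v i) (v (i + (n - 1))))" for i
    using l[of "i mod n"] n unfolding vmod Suc_mod pre_mod by simp
  have pre: "v (Suc i + (n - 1)) = v i" for i
  proof -
    have "Suc i + (n - 1) = i + n" using n by simp
    then show ?thesis using v(2) by metis
  qed
  note vtx = lagrange_vertex[OF v(1) v(1) v(1) nz[symmetric] nz l'[of "Suc i" for i, unfolded pre]]
  have "cmod (disc (v i) (v (Suc i))) = cmod (disc (v 0) (v 1))" for i
  proof (induction i)
    case (Suc i)
    have "cmod (disc (v (Suc i)) (v i)) = cmod (disc (v (Suc i)) (v (Suc (Suc i))))" by (rule vtx(1))
    moreover have "cmod (disc (v (Suc i)) (v i)) = cmod (disc (v i) (v (Suc i)))" by (rule norm_disc_sym[OF v(1) v(1)])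
    ultimately show ?case using Suc by simp
  qed simp
  note r = this
  let ?r = "cmod (disc (v 0) (v 1))"
  have r0: "?r > 0" using disc_eq_0_iff[OF v(1) v(1)] nz[of 0] by auto
  define q where "q = (of_real ?r + \<i> * of_real l) / (of_real ?r - \<i> * of_real l)"
  have "of_real ?r + \<i> * of_real l \<noteq> 0" "of_real ?r - \<i> * of_real l \<noteq> 0"
    using r0 by (auto simp: complex_eq_iff)
  then have "q \<noteq> 0" by (simp add: q_def)
  moreover have "disc (v (Suc i)) (v i) = q * disc (v (Suc i)) (v (Suc (Suc i)))" for i
    using vtx(2)[of i] unfolding r q_def .
  ultimately show thesis
    using equiangular_centre[OF n v(1,2) r0 r, of q] that by blast
qed

section \<open>Existence of maximal tuples\<close>

text \<open>These affine maps move any base vertex to \<open>\<i>\<close>, which removes the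
  non-compact group from the extremal problem.\<close>

lemma hyp_dist_affine:
  assumes "t > 0"
  shows "hyp_dist ((z - of_real b) / of_real t) ((w - of_real b) / of_real t) = hyp_dist z w"
proof -
  have "(z - of_real b) / of_real t - (w - of_real b) / of_real t = (z - w) / of_real t"
    by (simp add: diff_divide_distrib)
  then have "(cmod ((z - of_real b) / of_real t - (w - of_real b) / of_real t))\<^sup>2 = (cmod (z - w))\<^sup>2 / t\<^sup>2"
    using assms by (simp add: norm_divide power_divide)
  then show ?thesis unfolding hyp_dist_def using assms by (simp add: Im_divide_of_real power2_eq_square)
qed

lemma edge_area_affine:
  assumes "t > 0"
  shows "edge_area ((z - of_real b) / of_real t) ((w - of_real b) / of_real t) = edge_area z w"
  unfolding edge_area_def using assms
  by (simp add: Im_divide_of_real Re_divide_of_real diff_divide_distrib[symmetric] add_divide_distrib[symmetric])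

lemma hyp_dist_le_chain:
  fixes v :: "nat \<Rightarrow> complex"
  assumes "\<And>i. Im (v i) > 0"
  shows "hyp_dist (v 0) (v k) \<le> (\<Sum>i<k. hyp_dist (v i) (v (Suc i)))"
proof (induction k)
  case (Suc k)
  then show ?case using hyp_dist_triangle[OF assms[of 0] assms[of k] assms[of "Suc k"]] by simp
qed simp

text \<open>From (Re z)^2 + 1 + (Im z)^2 <= 2 * cosh L * Im z. The positive lower bound on
  \<open>Im z\<close> confines hyperbolic balls to a compact box inside the half-plane.\<close>

lemma hyp_ball_bounds:
  assumes "Im z > 0" "hyp_dist \<i> z \<le> L"
  shows "1 / (2 * cosh L) \<le> Im z" "Im z \<le> 2 * cosh L" "\<bar>Re z\<bar> \<le> 2 * cosh L"
proof -
  have c: "cosh L \<ge> 1" by (rule cosh_real_ge_1)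
  have "hyp_dist \<i> z \<ge> 0" using assms(1) by (intro hyp_dist_nonneg) auto
  then have "cosh (hyp_dist \<i> z) \<le> cosh L" using assms(2) by (simp add: cosh_real_nonneg_le_iff)
  then have "((Re z)\<^sup>2 + 1 + (Im z)\<^sup>2) / (2 * Im z) \<le> cosh L"
    using cosh_hyp_dist_coords[of \<i> z] assms(1) by simp
  then have le: "(Re z)\<^sup>2 + 1 + (Im z)\<^sup>2 \<le> 2 * cosh L * Im z"
    using assms(1) by (simp add: pos_divide_le_eq mult.commute mult.left_commute)
  then have "Im z * Im z \<le> (2 * cosh L) * Im z"
    using zero_le_power2[of "Re z"] unfolding power2_eq_square by linarith
  then show y: "Im z \<le> 2 * cosh L" using assms(1) by simp
  have "1 \<le> 2 * cosh L * Im z" using le zero_le_power2[of "Re z"] zero_le_power2[of "Im z"] by linarith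
  then show "1 / (2 * cosh L) \<le> Im z" using c by (simp add: pos_divide_le_eq mult.commute)
  have "(Re z)\<^sup>2 \<le> 2 * cosh L * Im z" using le zero_le_power2[of "Im z"] by linarith
  also have "\<dots> \<le> 2 * cosh L * (2 * cosh L)" using y c by (intro mult_left_mono) auto
  finally have "\<bar>Re z\<bar>\<^sup>2 \<le> (2 * cosh L)\<^sup>2" by (simp add: power2_eq_square)
  then show "\<bar>Re z\<bar> \<le> 2 * cosh L" by (rule power2_le_imp_le) (use c in simp)
qed

lemma tuple_continuous:
  fixes X :: "(nat \<Rightarrow> complex) set"
  assumes X: "\<And>w i. w \<in> X \<Longrightarrow> Im (w i) > 0"
  shows "continuous_on X (\<lambda>w. edge_area (w i) (w j))" "continuous_on X (\<lambda>w. hyp_dist (w i) (w j))"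
proof -
  have c: "continuous_on X (\<lambda>w. w k)" for k
    by (rule continuous_on_subset[OF continuous_on_product_coordinates]) simp
  have "Im (w i) + Im (w j) \<noteq> 0" if "w \<in> X" for w using X[OF that, of i] X[OF that, of j] by linarith
  then show "continuous_on X (\<lambda>w. edge_area (w i) (w j))"
    unfolding edge_area_def by (intro continuous_intros c) auto
  show "continuous_on X (\<lambda>w. hyp_dist (w i) (w j))"
    unfolding hyp_dist_def
  proof (rule continuous_on_compose2[of "{1..}" arcosh])
    show "continuous_on {1..} (arcosh :: real \<Rightarrow> real)" by (rule continuous_on_arcosh) simp
    show "continuous_on X (\<lambda>w. 1 + (cmod (w i - w j))\<^sup>2 / (2 * Im (w i) * Im (w j)))"
      using X by (intro continuous_intros c) (auto simp: less_imp_neq[symmetric])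
    show "(\<lambda>w. 1 + (cmod (w i - w j))\<^sup>2 / (2 * Im (w i) * Im (w j))) ` X \<subseteq> {1..}"
    proof (rule image_subsetI)
      show "1 + (cmod (w i - w j))\<^sup>2 / (2 * Im (w i) * Im (w j)) \<in> {1..}" if "w \<in> X" for w
        using X[OF that, of i] X[OF that, of j] by simp
    qed
  qed
qed

lemma maximal_tuple_exists:
  assumes n: "n > 0" and L: "L \<ge> 0"
  obtains v where "maximal_tuple n L v"
proof -
  define K where "K = cbox (Complex (- 2 * cosh L) (1 / (2 * cosh L))) (Complex (2 * cosh L) (2 * cosh L))"
  have K: "z \<in> K \<longleftrightarrow> \<bar>Re z\<bar> \<le> 2 * cosh L \<and> 1 / (2 * cosh L) \<le> Im z \<and> Im z \<le> 2 * cosh L" for z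
    unfolding K_def in_cbox_complex_iff by auto
  have c: "cosh L \<ge> 1" by (rule cosh_real_ge_1)
  have K0: "Im z > 0" if "z \<in> K" for z
  proof -
    have "0 < 1 / (2 * cosh L)" by simp
    then show ?thesis using that K by (meson less_le_trans)
  qed
  \<comment> \<open>A full product of boxes, compact by Tychonoff's theorem; \<open>P\<close> below
    turns a sequence into a periodic one.\<close>
  define X :: "(nat \<Rightarrow> complex) set" where "X = PiE UNIV (\<lambda>_. K)"
  have Xi: "w \<in> X \<longleftrightarrow> (\<forall>i. w i \<in> K)" for w by (auto simp: X_def)
  have "compactin (product_topology (\<lambda>_. euclidean) UNIV) X"
    unfolding X_def compactin_PiE by (simp add: K_def compact_cbox)
  then have X: "compact X" by (simp add: euclidean_product_topology)
  define P where "P w i = w (i mod n)" for w :: "nat \<Rightarrow> complex" and i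
  have X0: "\<And>w i. w \<in> X \<Longrightarrow> Im (w i) > 0" using K0 Xi by blast
  have cL: "continuous_on X (\<lambda>w. tuple_length n (P w))" and cA: "continuous_on X (\<lambda>w. tuple_area n (P w))"
    unfolding tuple_length_def tuple_area_def P_def
    by (rule continuous_on_sum, rule tuple_continuous, erule X0)+
  have c0: "continuous_on X (\<lambda>w. w 0)"
    by (rule continuous_on_subset[OF continuous_on_product_coordinates]) simp
  define T where "T = (X \<inter> (\<lambda>w. tuple_length n (P w)) -` {..L}) \<inter> (X \<inter> (\<lambda>w. w 0) -` {\<i>})"
  have "compact T"
  proof -
    have "closed (X \<inter> (\<lambda>w. tuple_length n (P w)) -` {..L})"
      using cL compact_imp_closed[OF X] by (intro continuous_closed_preimage) auto
    moreover have "closed (X \<inter> (\<lambda>w. w 0) -` {\<i>})"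
      using c0 compact_imp_closed[OF X] by (intro continuous_closed_preimage) auto
    ultimately have "closed T" unfolding T_def by (rule closed_Int)
    then have "compact (X \<inter> T)" using X by (rule compact_Int_closed[rotated])
    moreover have "X \<inter> T = T" by (auto simp: T_def)
    ultimately show ?thesis by simp
  qed
  moreover have "T \<noteq> {}"
  proof -
    have "\<i> \<in> K" unfolding K using c by (simp add: divide_le_eq)
    then have "(\<lambda>_. \<i>) \<in> T" using L by (auto simp: T_def Xi tuple_length_def P_def)
    then show ?thesis by blast
  qed
  moreover have "continuous_on T (\<lambda>w. tuple_area n (P w))"
    by (rule continuous_on_subset[OF cA]) (auto simp: T_def)
  ultimately obtain w where w: "w \<in> T" "\<And>x. x \<in> T \<Longrightarrow> tuple_area n (P x) \<le> tuple_area n (P w)"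
    using continuous_attains_sup[of T "\<lambda>w. tuple_area n (P w)"] by blast
  have "maximal_tuple n L (P w)"
    unfolding maximal_tuple_def
  proof (intro conjI allI impI)
    show "closed_tuple n (P w)" using w(1) X0 by (auto simp: closed_tuple_def P_def T_def)
    show "tuple_length n (P w) \<le> L" using w(1) by (simp add: T_def)
    fix x assume x: "closed_tuple n x \<and> tuple_length n x \<le> L"
    then have cx: "closed_tuple n x" by simp
    note xD = closed_tupleD[OF cx]
    \<comment> \<open>The competitor is moved so that its base vertex is \<open>\<i>\<close>. All
      its vertices are then within distance \<open>L\<close> of \<open>\<i>\<close>, hence in the
      box.\<close>
    define z where "z i = (x i - of_real (Re (x 0))) / of_real (Im (x 0))" for i
    have Pz: "P z = z" using closed_tuple_mod[OF cx] by (simp add: P_def z_def fun_eq_iff)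
    have zA: "tuple_area n z = tuple_area n x" and zL: "tuple_length n z = tuple_length n x"
      unfolding tuple_area_def tuple_length_def z_def
      using edge_area_affine[OF xD(1)] hyp_dist_affine[OF xD(1)] by simp_all
    have z0: "z 0 = \<i>" using xD(1)[of 0] by (simp add: z_def complex_eq_iff Im_divide_of_real Re_divide_of_real)
    have zI: "Im (z i) > 0" for i using xD(1)[of 0] xD(1)[of i] by (simp add: z_def Im_divide_of_real)
    have "z i \<in> K" for i
    proof -
      have "hyp_dist (z 0) (z (i mod n)) \<le> (\<Sum>j<i mod n. hyp_dist (z j) (z (Suc j)))"
        by (rule hyp_dist_le_chain[of z, OF zI])
      also have "\<dots> \<le> (\<Sum>j<n. hyp_dist (z j) (z (Suc j)))"
        using n mod_less_divisor[OF n, of i] by (intro sum_mono2) (auto intro: hyp_dist_nonneg zI)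
      also have "\<dots> \<le> L" using x zL by (simp add: tuple_length_def)
      finally have "hyp_dist \<i> (z (i mod n)) \<le> L" by (simp add: z0)
      moreover have "z (i mod n) = z i" using Pz by (metis P_def)
      ultimately show ?thesis using hyp_ball_bounds[OF zI] by (simp add: K)
    qed
    then have "z \<in> T" using z0 zL x Pz by (simp add: T_def Xi)
    then show "tuple_area n x \<le> tuple_area n (P w)" using w(2)[of z] Pz zA by simp
  qed
  then show thesis using that by blast
qed

text \<open>The point at half the Euclidean radius, in general not equidistant from the ends. On one
  radius \<open>1 - W * cnj Z\<close> is real and positive, so the edge terms add up along a
  geodesic.\<close>

lemma hyp_midpoint:
  assumes "Im z > 0" "Im w > 0" "z \<noteq> w"
  obtains m where "Im m > 0" "m \<noteq> z" "m \<noteq> w" "hyp_dist z m + hyp_dist m w = hyp_dist z w"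
    "edge_area z m + edge_area m w = edge_area z w"
proof -
  let ?W = "disc z w"
  define m where "m = undisc z (of_real (1/2) * ?W)"
  have W: "?W \<noteq> 0" "cmod ?W < 1" using assms disc_eq_0_iff norm_disc_less_1 by auto
  have lt: "cmod (of_real (1/2) * ?W) < 1" by (rule norm_scaled_disc_less_1[OF assms(1,2)]) simp
  have m: "Im m > 0" "disc z m = of_real (1/2) * ?W"
    unfolding m_def using Im_undisc_pos disc_undisc assms(1) lt by blast+
  have "m \<noteq> z" "m \<noteq> w" using m(2) W by auto
  moreover have "hyp_dist z m + hyp_dist m w = hyp_dist z w"
    using hyp_dist_between_iff[OF assms(1) m(1) assms(2)] m(2) by (auto intro!: bexI[of _ "1/2"])
  moreover have "edge_area z m + edge_area m w = edge_area z w"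
  proof -
    have "?W * cnj (of_real (1/2) * ?W) = of_real (1/2) * (?W * cnj ?W)" by simp
    also have "\<dots> = of_real ((cmod ?W)\<^sup>2 / 2)" by (simp add: complex_norm_square[symmetric])
    finally have e: "1 - ?W * cnj (of_real (1/2) * ?W) = of_real (1 - (cmod ?W)\<^sup>2 / 2)" by simp
    have "(cmod ?W)\<^sup>2 < 1" using norm_disc_sq_less_1 assms by blast
    then have "Arg (1 - ?W * cnj (of_real (1/2) * ?W)) = 0" unfolding e by (subst Arg_of_real) simp
    then show ?thesis
      unfolding edge_area_disc[OF assms(1) assms(1) m(1)] edge_area_disc[OF assms(1) m(1) assms(2)]
        edge_area_disc[OF assms(1) assms(1,2)] m(2) by simp
  qed
  ultimately show thesis using that m(1) by blast
qed

section \<open>Removing sides of length zero\<close>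

lemma sum_shift_cyclic:
  fixes f :: "nat \<Rightarrow> 'a :: ab_group_add"
  assumes "\<And>i. f (i + n) = f i"
  shows "(\<Sum>i<n. f (i + j)) = (\<Sum>i<n. f i)"
proof (induction j)
  case (Suc j)
  have "(\<Sum>i<n. f (Suc i + j)) = (\<Sum>i<n. f (i + j))"
    by (rule sum_Suc_cyclic[of "\<lambda>i. f (i + j)"]) (use assms[of j] in \<open>simp add: add.commute\<close>)
  then show ?case using Suc by simp
qed simp

text \<open>Integer valued because the cyclic shift lemma is stated for groups.\<close>

definition zero_sides :: "nat \<Rightarrow> (nat \<Rightarrow> complex) \<Rightarrow> int" where
  "zero_sides n v = (\<Sum>i<n. if v i = v (Suc i) then 1 else 0)"

lemma zero_sides_nonneg: "zero_sides n v \<ge> 0"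
  unfolding zero_sides_def by (intro sum_nonneg) auto

lemma shift_tuple:
  fixes j :: nat
  assumes v: "closed_tuple n v"
  defines "w \<equiv> \<lambda>i. v (i + j)"
  shows "closed_tuple n w" "tuple_area n w = tuple_area n v" "tuple_length n w = tuple_length n v"
    "zero_sides n w = zero_sides n v"
proof -
  note vD = closed_tupleD[OF v]
  have p: "v (i + n) = v i" "v (Suc (i + n)) = v (Suc i)" for i
    using vD(2)[of i] vD(2)[of "Suc i"] by simp_all
  have "v (i + n + j) = v (i + j)" for i using vD(2)[of "i + j"] by (simp add: add.commute add.left_commute)
  then show "closed_tuple n w" using vD(1) by (simp add: closed_tuple_def w_def)
  show "tuple_area n w = tuple_area n v"
    unfolding tuple_area_def w_def
    using sum_shift_cyclic[of "\<lambda>i. edge_area (v i) (v (Suc i))" n j] p by simp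
  show "tuple_length n w = tuple_length n v"
    unfolding tuple_length_def w_def
    using sum_shift_cyclic[of "\<lambda>i. hyp_dist (v i) (v (Suc i))" n j] p by simp
  show "zero_sides n w = zero_sides n v"
    unfolding zero_sides_def w_def
    using sum_shift_cyclic[of "\<lambda>i. if v i = v (Suc i) then 1 else 0 :: int" n j] p by simp
qed

text \<open>
  A zero side followed by a nonzero one can be replaced by the two halves of the latter, which
  changes neither length nor area.
\<close>

lemma fewer_zero_sides:
  assumes n: "n > 0" and v: "closed_tuple n v" and z: "v j = v (Suc j)" "v (Suc j) \<noteq> v (Suc (Suc j))"
  obtains x where "closed_tuple n x" "tuple_area n x = tuple_area n v" "tuple_length n x = tuple_length n v"
    "zero_sides n x < zero_sides n v"
proof -
  define w where "w = (\<lambda>i. v (i + j))"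
  note sh = shift_tuple[OF v, of j, folded w_def]
  note wD = closed_tupleD[OF sh(1)]
  have w: "w 0 = w 1" "w 1 \<noteq> w 2" using z by (simp_all add: w_def)

  have n3: "n \<ge> 3"
  proof (rule ccontr)
    assume "\<not> n \<ge> 3"
    then consider "n = 0" | "n = 1" | "n = 2" by linarith
    then show False
    proof cases
      case 1
      then show False using n by simp
    next
      case 2
      then show False using wD(2)[of 1] w by (simp add: numeral_2_eq_2)
    next
      case 3
      then show False using wD(2)[of 0] w by (simp add: numeral_2_eq_2)
    qed
  qed
  obtain m where m: "Im m > 0" "m \<noteq> w 1" "m \<noteq> w 2" "hyp_dist (w 1) m + hyp_dist m (w 2) = hyp_dist (w 1) (w 2)"
    "edge_area (w 1) m + edge_area m (w 2) = edge_area (w 1) (w 2)"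
    using hyp_midpoint[OF wD(1) wD(1) w(2)] by metis
  define x where "x i = (if i mod n = 1 then m else w i)" for i
  have x012: "x 0 = w 0" "x 1 = m" "x 2 = w 2" using n3 by (auto simp: x_def)
  have xr: "x i = w i" "x (Suc i) = w (Suc i)" if "i \<in> {2..<n}" for i
  proof -
    show "x i = w i" using that by (simp add: x_def)
    show "x (Suc i) = w (Suc i)"
    proof (cases "Suc i = n")
      case False
      then show ?thesis using that by (simp add: x_def)
    qed (use n3 in \<open>simp add: x_def\<close>)
  qed
  have split: "(\<Sum>i<n. f (y i) (y (Suc i))) = f (y 0) (y 1) + f (y 1) (y 2) + (\<Sum>i\<in>{2..<n}. f (y i) (y (Suc i)))"
    for f :: "complex \<Rightarrow> complex \<Rightarrow> 'a :: ab_group_add" and y :: "nat \<Rightarrow> complex"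
  proof -
    have "{..<n} = insert 0 (insert 1 {2..<n})" using n3 by auto
    then show ?thesis by (simp add: numeral_2_eq_2 add.assoc)
  qed
  have rest: "(\<Sum>i\<in>{2..<n}. f (x i) (x (Suc i))) = (\<Sum>i\<in>{2..<n}. f (w i) (w (Suc i)))"
    for f :: "complex \<Rightarrow> complex \<Rightarrow> 'a :: ab_group_add"
    by (intro sum.cong refl) (use xr in auto)
  have "closed_tuple n x" using wD m(1) by (simp add: closed_tuple_def x_def)
  moreover have "tuple_area n x = tuple_area n w"
    unfolding tuple_area_def split[of edge_area x] split[of edge_area w] rest x012 using m(5) w(1) by simp
  moreover have "tuple_length n x = tuple_length n w"
    unfolding tuple_length_def split[of hyp_dist x] split[of hyp_dist w] rest x012 using m(4) w(1) by simp
  moreover have "zero_sides n x < zero_sides n w"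
    unfolding zero_sides_def split[of "\<lambda>a b. if a = b then 1 else 0" x] split[of "\<lambda>a b. if a = b then 1 else 0" w]
      rest[of "\<lambda>a b. if a = b then 1 else 0"] x012 using m(2,3) w by simp
  ultimately show thesis using that sh by metis
qed

text \<open>Among the maximal tuples take one with fewest zero sides. If it has a zero side and is
  not constant, then somewhere a zero side precedes a nonzero one, and
  \<open>fewer_zero_sides\<close> contradicts minimality.\<close>

lemma nondegenerate_maximal_tuple:
  assumes n: "n > 0" and L: "L \<ge> 0"
  obtains v where "maximal_tuple n L v" "(\<forall>i. v i \<noteq> v (Suc i)) \<or> (\<forall>i. v i = v 0)"
proof -
  obtain v0 where "maximal_tuple n L v0" using maximal_tuple_exists[OF n L] by blast
  then have "\<exists>v. maximal_tuple n L v \<and> (\<forall>w. maximal_tuple n L w \<longrightarrow> nat (zero_sides n v) \<le> nat (zero_sides n w))"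
    by (rule ex_has_least_nat[where m = "\<lambda>v. nat (zero_sides n v)"])
  then obtain v where v: "maximal_tuple n L v"
    "\<And>w. maximal_tuple n L w \<Longrightarrow> nat (zero_sides n v) \<le> nat (zero_sides n w)" by blast
  have cl: "closed_tuple n v" using v(1) by (simp add: maximal_tuple_def)
  have "(\<forall>i. v i \<noteq> v (Suc i)) \<or> (\<forall>i. v i = v 0)"
  proof (rule ccontr)
    assume "\<not> ?thesis"
    then obtain i0 i1 where i: "v i0 = v (Suc i0)" "v i1 \<noteq> v 0" by blast
    have "\<exists>j. v j = v (Suc j) \<and> v (Suc j) \<noteq> v (Suc (Suc j))"
    proof (rule ccontr)
      assume a: "\<not> ?thesis"
      have k: "v (i0 + k) = v i0 \<and> v (i0 + Suc k) = v i0" for k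
      proof (induction k)
        case (Suc k)
        then show ?case using a by (metis add_Suc_right)
      qed (use i in simp)
      have "v x = v i0" for x
      proof -
        have "v x = v (x mod n)" using closed_tuple_mod[OF cl] by simp
        \<comment> \<open>Going forward from \<open>i0\<close> reaches every residue; adding
          \<open>n * i0\<close> keeps the natural subtraction exact.\<close>
        also have "x mod n = (i0 + (n * i0 + x - i0)) mod n"
        proof -
          have "i0 \<le> n * i0" using n by simp
          then have "i0 + (n * i0 + x - i0) = x + n * i0" by linarith
          then show ?thesis by simp
        qed
        also have "v \<dots> = v i0" using closed_tuple_mod[OF cl] k by simp
        finally show ?thesis .
      qed
      then show False using i(2) by metis
    qed
    then obtain j where j: "v j = v (Suc j)" "v (Suc j) \<noteq> v (Suc (Suc j))" by blast
    obtain x where x: "closed_tuple n x" "tuple_area n x = tuple_area n v" "tuple_length n x = tuple_length n v"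
        "zero_sides n x < zero_sides n v"
      using fewer_zero_sides[OF n cl j] by blast
    have "maximal_tuple n L x" using v(1) x(1-3) by (simp add: maximal_tuple_def)
    then show False using v(2) x(4) zero_sides_nonneg[of n x] by fastforce
  qed
  then show thesis using that v(1) by blast
qed

section \<open>The isoperimetric inequality for closed tuples\<close>

definition regular_area :: "nat \<Rightarrow> real \<Rightarrow> real" where
  "regular_area n L = 2 * real n * (arcsin (cos (pi / real n)) - arcsin (cos (pi / real n) / cosh (L / (2 * real n))))"

lemma cos_pi_div_n:
  assumes "n \<ge> 2"
  shows "0 \<le> cos (pi / real n)" "cos (pi / real n) < 1"
proof -
  have n2: "real n \<ge> 2" using assms by simp
  then have a: "0 < pi / real n" "pi / real n \<le> pi / 2" using divide_left_mono[of 2 "real n" pi] by auto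
  then show "0 \<le> cos (pi / real n)" by (intro cos_ge_zero) auto
  have "cos (pi / real n) < cos 0"
    using a pi_gt_zero by (intro cos_monotone_0_pi) linarith+
  then show "cos (pi / real n) < 1" by simp
qed

lemma regular_area_mono:
  assumes "n \<ge> 2" "0 \<le> L" "L \<le> M"
  shows "regular_area n L \<le> regular_area n M" "0 \<le> regular_area n L"
proof -
  let ?k = "cos (pi / real n)"
  note k = cos_pi_div_n[OF assms(1)]
  have "L / (2 * real n) \<le> M / (2 * real n)" using assms by (intro divide_right_mono) auto
  then have "cosh (L / (2 * real n)) \<le> cosh (M / (2 * real n))" using assms by (subst cosh_real_nonneg_le_iff) auto
  then have "?k / cosh (M / (2 * real n)) \<le> ?k / cosh (L / (2 * real n))"
    using k by (intro divide_left_mono) auto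
  moreover have c: "?k / cosh x \<le> ?k" "0 \<le> ?k / cosh x" for x
    using k cosh_real_ge_1[of x] by (auto simp: divide_le_eq mult_le_cancel_left1)
  ultimately have "arcsin (?k / cosh (M / (2 * real n))) \<le> arcsin (?k / cosh (L / (2 * real n)))"
    using k c[of "L / (2 * real n)"] c[of "M / (2 * real n)"] by (intro arcsin_le_arcsin) linarith+
  then show "regular_area n L \<le> regular_area n M" unfolding regular_area_def by (intro mult_left_mono) auto
  have "arcsin (?k / cosh (L / (2 * real n))) \<le> arcsin ?k"
    using k c[of "L / (2 * real n)"] by (intro arcsin_le_arcsin) linarith+
  then show "0 \<le> regular_area n L" unfolding regular_area_def by simp
qed

lemma equiangular_length:
  assumes n: "n > 0" and v: "\<And>i. Im (v i) > 0" and c: "Im c > 0" and e: "e ^ n = 1"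
    and ai: "\<And>i. disc c (v i) = a * e ^ i"
  shows "tuple_length n v = real n * hyp_dist (v 0) (v 1)"
proof -
  have "cmod e ^ n = 1 ^ n" using e by (simp flip: norm_power)
  then have ne: "cmod e = 1" by (rule power_eq_imp_eq_base) (use n in auto)
  have eqs: "hyp_dist (v i) (v (Suc i)) = hyp_dist (v 0) (v 1)" for i
  proof (rule hyp_dist_cong_disc[of c "v 0" "v 1" c])
    have "a * e ^ i - a * e ^ Suc i = e ^ i * (a * e ^ 0 - a * e ^ 1)" by (simp add: algebra_simps)
    then show "cmod (disc c (v i) - disc c (v (Suc i))) = cmod (disc c (v 0) - disc c (v 1))"
      unfolding ai by (simp only: norm_mult norm_power ne) simp
  qed (use v c ai ne in \<open>auto simp: norm_mult norm_power\<close>)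
  have "tuple_length n v = (\<Sum>i<n. hyp_dist (v 0) (v 1))"
    unfolding tuple_length_def by (rule sum.cong[OF refl eqs])
  then show ?thesis by simp
qed

lemma tuple_length_nonneg: "closed_tuple n v \<Longrightarrow> tuple_length n v \<ge> 0"
  unfolding tuple_length_def closed_tuple_def by (intro sum_nonneg hyp_dist_nonneg) auto

text \<open>The argument of cosh in \<open>regular_area\<close> is half the common side. The
  comparison uses the actual length of the tuple, which may be smaller than
  \<open>L\<close>.\<close>

lemma maximal_tuple_regular:
  assumes n: "n \<ge> 2" and m: "maximal_tuple n L v" and nz: "\<And>i. v i \<noteq> v (Suc i)"
  shows "tuple_area n v \<le> regular_area n (tuple_length n v)"
    and "tuple_area n v = regular_area n (tuple_length n v) \<Longrightarrow>
      \<exists>c a. Im c > 0 \<and> a \<noteq> 0 \<and> (\<forall>i. disc c (v i) = a * cis (2 * pi / real n) ^ i)"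
proof -
  have n0: "n > 0" using n by simp
  have cl: "closed_tuple n v" using m by (simp add: maximal_tuple_def)
  note v = closed_tupleD[OF cl]
  obtain c a e where ca: "Im c > 0" "a \<noteq> 0" "e ^ n = 1" "e \<noteq> 1" "\<And>i. disc c (v i) = a * e ^ i"
    using maximal_tuple_centre[OF n0 m nz] by metis
  have l: "tuple_length n v / (2 * real n) = hyp_dist (v 0) (v 1) / 2"
    using equiangular_length[of n v, OF n0 v(1) ca(1,3,5)] n0 by simp
  note r = equiangular_area_le[of n v c a e, OF n v(1,3) ca(1-5), folded tuple_area_def l, folded regular_area_def]
  show "tuple_area n v \<le> regular_area n (tuple_length n v)" by (rule r(1))
  assume "tuple_area n v = regular_area n (tuple_length n v)"
  then have "e = cis (2 * pi / real n)" by (rule r(2))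
  then show "\<exists>c a. Im c > 0 \<and> a \<noteq> 0 \<and> (\<forall>i. disc c (v i) = a * cis (2 * pi / real n) ^ i)"
    using ca by blast
qed

lemma tuple_area_le:
  assumes n: "n \<ge> 2" and v: "closed_tuple n v" and L: "tuple_length n v \<le> L"
  shows "tuple_area n v \<le> regular_area n L"
proof -
  have L0: "L \<ge> 0" using tuple_length_nonneg[OF v] L by simp
  have n0: "n > 0" using n by simp
  obtain w where w: "maximal_tuple n L w" "(\<forall>i. w i \<noteq> w (Suc i)) \<or> (\<forall>i. w i = w 0)"
    using nondegenerate_maximal_tuple[OF n0 L0] by blast
  have cw: "closed_tuple n w" "tuple_length n w \<le> L" using w(1) by (auto simp: maximal_tuple_def)
  have "tuple_area n v \<le> tuple_area n w" using w(1) v L by (simp add: maximal_tuple_def)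
  also have "\<dots> \<le> regular_area n L"
    using w(2)
  proof
    assume "\<forall>i. w i \<noteq> w (Suc i)"
    then have "tuple_area n w \<le> regular_area n (tuple_length n w)"
      using maximal_tuple_regular(1)[OF n w(1)] by blast
    also have "\<dots> \<le> regular_area n L"
      by (rule regular_area_mono(1)[OF n tuple_length_nonneg[OF cw(1)] cw(2)])
    finally show ?thesis .
  next
    assume "\<forall>i. w i = w 0"
    then have "edge_area (w i) (w (Suc i)) = 0" for i by (metis edge_area_self)
    then have "tuple_area n w = 0" by (simp add: tuple_area_def)
    then show ?thesis using regular_area_mono(2)[OF n L0 order_refl] by simp
  qed
  finally show ?thesis .
qed

text \<open>By the inequality for all tuples, equality makes \<open>v\<close> itself maximal for its
  own length, so the structure of maximal tuples applies to \<open>v\<close> directly.\<close>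

lemma tuple_area_eq_imp:
  assumes n: "n \<ge> 2" and v: "closed_tuple n v" and nz: "\<And>i. v i \<noteq> v (Suc i)"
    and eq: "tuple_area n v = regular_area n (tuple_length n v)"
  obtains c a where "Im c > 0" "a \<noteq> 0" "\<And>i. disc c (v i) = a * cis (2 * pi / real n) ^ i"
proof -
  have "maximal_tuple n (tuple_length n v) v"
    unfolding maximal_tuple_def using v tuple_area_le[OF n] eq by auto
  from maximal_tuple_regular(2)[OF n this nz eq] show thesis using that by blast
qed

lemma regular_tuple_area:
  assumes n: "n \<ge> 2" and v: "\<And>i. Im (v i) > 0" "v n = v 0" and c: "Im c > 0" "a \<noteq> 0"
    and ai: "\<And>i. disc c (v i) = a * cis (2 * pi / real n) ^ i"
  shows "tuple_area n v = regular_area n (tuple_length n v)"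
proof -
  have n0: "n > 0" using n by simp
  have e: "cis (2 * pi / real n) ^ n = 1" using n0 by (simp add: Complex.DeMoivre)
  have l: "tuple_length n v / (2 * real n) = hyp_dist (v 0) (v 1) / 2"
    using equiangular_length[of n v, OF n0 v(1) c(1) e ai] n0 by simp
  have "0 < 2 * pi / real n" "2 * pi / real n < 2 * pi" using n by (auto simp: field_simps)
  from equiangular_edge_area(2)[of v n c a, OF v c ai this]
  show ?thesis unfolding tuple_area_def regular_area_def l by simp
qed

text \<open>The side determines p/(1 - p)^2, where \<open>p\<close> is the squared radius in the
  disc. Equal values give (p - q)(1 - pq) = 0, hence p = q.\<close>

lemma regular_tuple_radius:
  assumes n: "n \<ge> 2"
    and v: "\<And>i. Im (v i) > 0" "v n = v 0" "Im c > 0" "a \<noteq> 0" "\<And>i. disc c (v i) = a * cis (2 * pi / real n) ^ i"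
    and w: "\<And>i. Im (w i) > 0" "w n = w 0" "Im d > 0" "b \<noteq> 0" "\<And>i. disc d (w i) = b * cis (2 * pi / real n) ^ i"
    and eq: "tuple_length n v = tuple_length n w"
  shows "cmod a = cmod b"
proof -
  have n0: "n > 0" using n by simp
  have e: "cis (2 * pi / real n) ^ n = 1" using n0 by (simp add: Complex.DeMoivre)
  have psi: "0 < 2 * pi / real n" "2 * pi / real n < 2 * pi" using n by (auto simp: field_simps)
  have l: "hyp_dist (v 0) (v (Suc 0)) = hyp_dist (w 0) (w (Suc 0))"
    using equiangular_length[of n v, OF n0 v(1,3) e v(5)] equiangular_length[of n w, OF n0 w(1,3) e w(5)] eq n0 by simp
  define p where "p = (cmod a)\<^sup>2"
  define q where "q = (cmod b)\<^sup>2"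
  define s where "s = sin (2 * pi / real n / 2)"
  have s: "s > 0" unfolding s_def using psi by (intro sin_gt_zero) auto
  have p: "0 < p" "p < 1" using v(4) norm_disc_sq_less_1[OF v(3) v(1)[of 0]] v(5)[of 0] by (auto simp: p_def)
  have q: "0 < q" "q < 1" using w(4) norm_disc_sq_less_1[OF w(3) w(1)[of 0]] w(5)[of 0] by (auto simp: q_def)
  have "1 + 4 * p * s\<^sup>2 / (1 - p)\<^sup>2 = 1 + 4 * q * s\<^sup>2 / (1 - q)\<^sup>2"
    using equiangular_edge_area(1)[of v n c a, OF v psi, of 0] equiangular_edge_area(1)[of w n d b, OF w psi, of 0]
    unfolding l p_def q_def s_def by simp
  then have "(4 * s\<^sup>2) * (p / (1 - p)\<^sup>2) = (4 * s\<^sup>2) * (q / (1 - q)\<^sup>2)" by (simp add: mult_ac)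
  then have "p / (1 - p)\<^sup>2 = q / (1 - q)\<^sup>2" using s by (simp only: mult_cancel_left) simp
  then have "p * (1 - q)\<^sup>2 = q * (1 - p)\<^sup>2" using p q by (simp add: field_simps)
  then have "(p - q) * (1 - p * q) = 0" by (simp add: power2_eq_square algebra_simps)
  moreover have "p * q < 1" using p q mult_strict_mono[of p 1 q 1] by simp
  ultimately have "p = q" by simp
  then show ?thesis by (simp add: p_def q_def)
qed

section \<open>Concavity and the main theorem\<close>

text \<open>Written in terms of \<open>(cosh x)\<^sup>2\<close> so that monotonicity of the
  derivative becomes a question about a rational function.\<close>

lemma arcsin_cosh_deriv:
  assumes "0 < k" "k < 1" "0 < x"
  shows "((\<lambda>x. arcsin (k / cosh x)) has_real_derivative
    - k * sqrt (((cosh x)\<^sup>2 - 1) / ((cosh x)\<^sup>2 * ((cosh x)\<^sup>2 - k\<^sup>2)))) (at x)"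
proof -
  let ?c = "cosh x"
  have c: "?c \<ge> 1" by (rule cosh_real_ge_1)
  have l: "- 1 < k / ?c" "k / ?c < 1"
  proof -
    have "0 < k / ?c" using assms by simp
    then show "- 1 < k / ?c" by linarith
    show "k / ?c < 1" using assms c by (simp add: divide_less_eq)
  qed
  have s: "sqrt (1 - (k / ?c)\<^sup>2) = sqrt (?c\<^sup>2 - k\<^sup>2) / ?c"
  proof -
    have "1 - (k / ?c)\<^sup>2 = (?c\<^sup>2 - k\<^sup>2) / ?c\<^sup>2" by (simp add: power_divide diff_divide_distrib)
    then show ?thesis by (simp add: real_sqrt_divide)
  qed
  have "((\<lambda>x. k / cosh x) has_real_derivative - k * sinh x / (?c * ?c)) (at x)"
    by (auto intro!: derivative_eq_intros)
  then have "((\<lambda>x. arcsin (k / cosh x)) has_real_derivative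
      inverse (sqrt (1 - (k / ?c)\<^sup>2)) * (- k * sinh x / (?c * ?c))) (at x)"
    by (rule DERIV_chain2[where f = arcsin and g = "\<lambda>x. k / cosh x", OF DERIV_arcsin[OF l]])
  moreover have "inverse (sqrt (1 - (k / ?c)\<^sup>2)) * (- k * sinh x / (?c * ?c)) =
      - k * sqrt ((?c\<^sup>2 - 1) / (?c\<^sup>2 * (?c\<^sup>2 - k\<^sup>2)))"
  proof -
    have "sqrt ((?c\<^sup>2 - 1) / (?c\<^sup>2 * (?c\<^sup>2 - k\<^sup>2))) = sinh x / (?c * sqrt (?c\<^sup>2 - k\<^sup>2))"
    proof -
      have "sqrt (?c\<^sup>2 - 1) = sinh x" using assms(3) by (simp add: cosh_square_eq)
      then show ?thesis unfolding real_sqrt_divide real_sqrt_mult by simp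
    qed
    then show ?thesis unfolding s by (simp add: field_simps)
  qed
  ultimately show ?thesis by simp
qed

text \<open>The source of the perimeter bound. With a < b the squared hyperbolic cosines,
  cross-multiplying (a - 1)/(a (a - k^2)) against the same term in b leaves (b - a)((a - 1)(b - 1) -
  s^2), which is positive as soon as a - 1 >= s.\<close>

lemma arcsin_cosh_deriv_strict_mono:
  fixes k s x y :: real
  assumes "0 < k" "0 < s" "k\<^sup>2 + s\<^sup>2 = 1" "0 < x" "x < y" "1 + s \<le> (cosh x)\<^sup>2"
  shows "- k * sqrt (((cosh x)\<^sup>2 - 1) / ((cosh x)\<^sup>2 * ((cosh x)\<^sup>2 - k\<^sup>2))) <
    - k * sqrt (((cosh y)\<^sup>2 - 1) / ((cosh y)\<^sup>2 * ((cosh y)\<^sup>2 - k\<^sup>2)))"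
proof -
  define a where "a = (cosh x)\<^sup>2"
  define b where "b = (cosh y)\<^sup>2"
  have "cosh x < cosh y" using assms by (simp add: cosh_real_nonneg_less_iff)
  then have ab: "a < b" unfolding a_def b_def by (intro power_strict_mono) auto
  have a: "1 + s \<le> a" using assms(6) by (simp add: a_def)
  have k1: "k\<^sup>2 < 1" using assms(2,3) zero_less_power[of s 2] by linarith
  have pos: "a * (a - k\<^sup>2) > 0" "b * (b - k\<^sup>2) > 0" using a ab assms(2) k1 by simp_all
  have "s * s < (a - 1) * (b - 1)" using a ab assms(2) by (intro mult_le_less_imp_less) auto
  then have "(b - a) * ((a - 1) * (b - 1) - s\<^sup>2) > 0" using ab by (simp add: power2_eq_square)
  moreover have "(a - 1) * (b * (b - k\<^sup>2)) - (b - 1) * (a * (a - k\<^sup>2)) = (b - a) * ((a - 1) * (b - 1) - s\<^sup>2)"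
  proof -
    have s2: "s\<^sup>2 = 1 - k\<^sup>2" using assms(3) by simp
    show ?thesis unfolding s2 by (simp add: algebra_simps power2_eq_square)
  qed
  ultimately have "(b - 1) * (a * (a - k\<^sup>2)) < (a - 1) * (b * (b - k\<^sup>2))" by simp
  then have "(b - 1) / (b * (b - k\<^sup>2)) < (a - 1) / (a * (a - k\<^sup>2))"
    using pos by (simp add: divide_less_eq less_divide_eq mult.commute)
  then have "sqrt ((b - 1) / (b * (b - k\<^sup>2))) < sqrt ((a - 1) / (a * (a - k\<^sup>2)))" by simp
  then show ?thesis using assms(1) unfolding a_def b_def by simp
qed

text \<open>Strict convexity beyond the threshold, in the form of a graph above its tangent: the
  mean value theorem and the increasing derivative, on either side of \<open>m\<close>.\<close>

lemma arcsin_cosh_tangent: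
  fixes k s x m :: real
  assumes k: "0 < k" "0 < s" "k\<^sup>2 + s\<^sup>2 = 1"
    and x: "arcosh (sqrt (1 + s)) < x" and m: "arcosh (sqrt (1 + s)) < m" and ne: "x \<noteq> m"
  defines "D \<equiv> \<lambda>x. - k * sqrt (((cosh x)\<^sup>2 - 1) / ((cosh x)\<^sup>2 * ((cosh x)\<^sup>2 - k\<^sup>2)))"
  shows "arcsin (k / cosh m) + D m * (x - m) < arcsin (k / cosh x)"
proof -
  have s1: "1 \<le> sqrt (1 + s)" using k(2) by simp
  have pos: "0 < z" "1 + s \<le> (cosh z)\<^sup>2" if "arcosh (sqrt (1 + s)) < z" for z
  proof -
    have a: "0 \<le> arcosh (sqrt (1 + s))" by (rule arcosh_nonneg_real[OF s1])
    then show "0 < z" using that by linarith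
    have "cosh (arcosh (sqrt (1 + s))) \<le> cosh z" using a that by (simp add: cosh_real_nonneg_le_iff del: cosh_arcosh_real)
    then have "sqrt (1 + s) \<le> cosh z" using s1 by simp
    then have "(sqrt (1 + s))\<^sup>2 \<le> (cosh z)\<^sup>2" using k(2) by (intro power_mono) auto
    then show "1 + s \<le> (cosh z)\<^sup>2" using k(2) by simp
  qed
  have k1: "k < 1"
  proof -
    have "k\<^sup>2 < 1" using k(2,3) zero_less_power[of s 2] by linarith
    then show ?thesis using k(1) abs_square_less_1[of k] by simp
  qed
  have der: "((\<lambda>x. arcsin (k / cosh x)) has_real_derivative D z) (at z)" if "arcosh (sqrt (1 + s)) < z" for z
    unfolding D_def by (rule arcsin_cosh_deriv[OF k(1) k1 pos(1)[OF that]])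
  have mono: "D z < D w" if "arcosh (sqrt (1 + s)) < z" "z < w" for z w
    unfolding D_def by (rule arcsin_cosh_deriv_strict_mono[OF k pos(1)[OF that(1)] that(2) pos(2)[OF that(1)]])
  consider "m < x" | "x < m" using ne by linarith
  then show ?thesis
  proof cases
    case 1
    have "\<exists>z>m. z < x \<and> arcsin (k / cosh x) - arcsin (k / cosh m) = (x - m) * D z"
      by (rule MVT2[OF 1]) (rule der, use m in linarith)
    then obtain z where z: "m < z" "z < x" "arcsin (k / cosh x) - arcsin (k / cosh m) = (x - m) * D z"
      by blast
    have "(x - m) * D m < (x - m) * D z" using mono[OF m z(1)] 1 by simp
    then show ?thesis using z(3) by (simp add: mult.commute)
  next
    case 2
    have "\<exists>z>x. z < m \<and> arcsin (k / cosh m) - arcsin (k / cosh x) = (m - x) * D z"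
      by (rule MVT2[OF 2]) (rule der, use x in linarith)
    then obtain z where z: "x < z" "z < m" "arcsin (k / cosh m) - arcsin (k / cosh x) = (m - x) * D z"
      by blast
    have "D z < D m" using mono[of z m] x z by linarith
    then have "(m - x) * D z < (m - x) * D m" using 2 by simp
    then show ?thesis using z(3) by (simp add: algebra_simps)
  qed
qed

text \<open>Jensen's inequality with its equality case: at the mean, the linear parts of the tangent
  bounds sum to zero.\<close>

lemma sum_ge_of_tangent:
  fixes x :: "nat \<Rightarrow> real"
  assumes A: "finite A" and m: "(\<Sum>i\<in>A. x i) = real (card A) * m"
    and t: "\<And>i. i \<in> A \<Longrightarrow> x i \<noteq> m \<Longrightarrow> h m + d * (x i - m) < h (x i)"
  shows "real (card A) * h m \<le> (\<Sum>i\<in>A. h (x i))"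
    and "(\<Sum>i\<in>A. h (x i)) = real (card A) * h m \<Longrightarrow> i \<in> A \<Longrightarrow> x i = m"
proof -
  have le: "h m + d * (x i - m) \<le> h (x i)" if "i \<in> A" for i
    using t[OF that] by (cases "x i = m") auto
  have s: "(\<Sum>i\<in>A. h m + d * (x i - m)) = real (card A) * h m"
    unfolding sum.distrib sum_distrib_left[symmetric] sum_subtractf using m by simp
  show "real (card A) * h m \<le> (\<Sum>i\<in>A. h (x i))"
    unfolding s[symmetric] by (intro sum_mono le)
  assume eq: "(\<Sum>i\<in>A. h (x i)) = real (card A) * h m" and i: "i \<in> A"
  show "x i = m"
  proof (rule ccontr)
    assume "x i \<noteq> m"
    then have "(\<Sum>i\<in>A. h m + d * (x i - m)) < (\<Sum>i\<in>A. h (x i))"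
      using A i le t by (intro sum_strict_mono_ex1) auto
    then show False using eq s by simp
  qed
qed

section \<open>Closed form of the regular area and its concavity\<close>

lemma arcsin_cos_pi_div:
  assumes "n \<ge> 2"
  shows "arcsin (cos (pi / real n)) = pi / 2 - pi / real n"
proof -
  have "pi / real n \<le> pi / 2" "0 < pi / real n" using divide_left_mono[of 2 "real n" pi] assms by auto
  moreover have "cos (pi / real n) = sin (pi / 2 - pi / real n)" by (simp add: sin_diff)
  ultimately show ?thesis by (simp only:) (rule arcsin_sin; linarith)
qed

lemma regular_area_eq:
  assumes "n \<ge> 2"
  shows "regular_area n L = (real n - 2) * pi - 2 * real n * arcsin (cos (pi / real n) / cosh (L / (2 * real n)))"
proof -
  have "2 * real n * arcsin (cos (pi / real n)) = (real n - 2) * pi"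
    unfolding arcsin_cos_pi_div[OF assms] using assms by (simp add: field_simps)
  then show ?thesis by (simp add: regular_area_def right_diff_distrib)
qed

lemma sum_regular_area_le:
  fixes L :: "nat \<Rightarrow> real"
  assumes n: "n \<ge> 3" and A: "finite A" "A \<noteq> {}" and T: "(\<Sum>i\<in>A. L i) = T"
    and L: "\<And>i. i \<in> A \<Longrightarrow> L i > 2 * real n * arcosh (sqrt (1 + sin (pi / real n)))"
  shows "(\<Sum>i\<in>A. regular_area n (L i)) \<le> real (card A) * regular_area n (T / real (card A))"
    and "(\<Sum>i\<in>A. regular_area n (L i)) = real (card A) * regular_area n (T / real (card A)) \<Longrightarrow>
      i \<in> A \<Longrightarrow> L i = T / real (card A)"
proof -
  define k where "k = cos (pi / real n)"
  define s where "s = sin (pi / real n)"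
  define x where "x i = L i / (2 * real n)" for i
  define m where "m = T / real (card A) / (2 * real n)"
  define h where "h y = arcsin (k / cosh y)" for y
  have n0: "real n > 0" and cA: "real (card A) > 0" using n A by (auto simp: card_gt_0_iff)
  have ang: "0 < pi / real n" "pi / real n < pi / 2"
    using n0 n by (auto simp: field_simps)
  have k: "0 < k" unfolding k_def using ang by (intro cos_gt_zero) auto
  have s: "0 < s" unfolding s_def using ang pi_gt_zero by (intro sin_gt_zero) linarith+
  have ks: "k\<^sup>2 + s\<^sup>2 = 1" by (simp add: k_def s_def)
  have xL: "arcosh (sqrt (1 + s)) < x i" if "i \<in> A" for i
    using L[OF that] n0 unfolding x_def s_def by (simp add: pos_less_divide_eq mult.commute)
  have sumx: "(\<Sum>i\<in>A. x i) = real (card A) * m"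
    unfolding x_def m_def sum_divide_distrib[symmetric] T using cA by simp
  \<comment> \<open>The tangent is taken at the mean, which exceeds the threshold because every term
    does.\<close>
  have mL: "arcosh (sqrt (1 + s)) < m"
  proof -
    have "(\<Sum>i\<in>A. arcosh (sqrt (1 + s))) < (\<Sum>i\<in>A. x i)" using A xL by (intro sum_strict_mono) auto
    then show ?thesis unfolding sumx using cA by simp
  qed
  note J = sum_ge_of_tangent[where x = x and h = h, OF A(1) sumx
    arcsin_cosh_tangent[OF k s ks xL mL, folded h_def]]
  have ra: "regular_area n (L i) = 2 * real n * arcsin k - 2 * real n * h (x i)" for i
    by (simp add: regular_area_def k_def h_def x_def right_diff_distrib)
  have rm: "regular_area n (T / real (card A)) = 2 * real n * arcsin k - 2 * real n * h m"
    by (simp add: regular_area_def k_def h_def m_def right_diff_distrib)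
  have sum: "(\<Sum>i\<in>A. regular_area n (L i)) = real (card A) * (2 * real n * arcsin k) - 2 * real n * (\<Sum>i\<in>A. h (x i))"
    unfolding ra sum_subtractf sum_distrib_left by simp
  have diff: "real (card A) * regular_area n (T / real (card A)) - (\<Sum>i\<in>A. regular_area n (L i)) =
      2 * real n * ((\<Sum>i\<in>A. h (x i)) - real (card A) * h m)"
    unfolding sum rm by (simp add: algebra_simps)
  have "0 \<le> 2 * real n * ((\<Sum>i\<in>A. h (x i)) - real (card A) * h m)" using J(1) n0 by simp
  then show "(\<Sum>i\<in>A. regular_area n (L i)) \<le> real (card A) * regular_area n (T / real (card A))"
    using diff by linarith
  assume eq: "(\<Sum>i\<in>A. regular_area n (L i)) = real (card A) * regular_area n (T / real (card A))" and i: "i \<in> A"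
  then have "(\<Sum>i\<in>A. h (x i)) = real (card A) * h m" using diff n0 by simp
  then have "x i = m" using J(2) i by blast
  then show "L i = T / real (card A)"
    using n0 unfolding x_def m_def by (simp only: divide_cancel_right) simp
qed

section \<open>From tuples back to polygons\<close>

context polygon
begin

lemma closed_tuple_V: "closed_tuple n V"
  by (simp add: closed_tuple_def Im_V)

lemma Peri_eq: "Peri vs = tuple_length n V"
  unfolding Peri_def tuple_length_def len by (intro sum.cong refl side_length_V) simp

text \<open>Clockwise polygons are reflected in the imaginary axis, after which the signed sum is
  the area itself.\<close>

lemma oriented_tuple:
  obtains g s where "g = (\<lambda>z. z) \<and> s = (1::real) \<or> g = (\<lambda>z. - cnj z) \<and> s = -1"
    "closed_tuple n (g \<circ> V)" "Area vs = tuple_area n (g \<circ> V)" "Peri vs = tuple_length n (g \<circ> V)"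
    "orientation s"
proof -
  obtain s where s: "orientation s" by (rule orientation_exists)
  have area: "Area vs = s * tuple_area n V" unfolding tuple_area_def by (rule Area_eq[OF s])
  show thesis
  proof (cases "s = 1")
    case True
    show thesis
      by (rule that[of "\<lambda>z. z" s]) (use True area s closed_tuple_V Peri_eq in \<open>simp_all add: o_def\<close>)
  next
    case False
    then have s1: "s = -1" using s by (simp add: orientation_def)
    have "tuple_area n ((\<lambda>z. - cnj z) \<circ> V) = - tuple_area n V"
      unfolding tuple_area_def o_def edge_area_reflect sum_negf ..
    moreover have "tuple_length n ((\<lambda>z. - cnj z) \<circ> V) = tuple_length n V"
      unfolding tuple_length_def o_def hyp_dist_reflect ..
    moreover have "closed_tuple n ((\<lambda>z. - cnj z) \<circ> V)" by (simp add: closed_tuple_def Im_V)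
    ultimately show thesis
      by (intro that[of "\<lambda>z. - cnj z" s]) (use s1 area s Peri_eq in simp_all)
  qed
qed

lemma Area_le_regular: "Area vs \<le> regular_area n (Peri vs)"
proof -
  obtain g where g: "closed_tuple n (g \<circ> V)" "Area vs = tuple_area n (g \<circ> V)" "Peri vs = tuple_length n (g \<circ> V)"
    using oriented_tuple by metis
  show ?thesis unfolding g(2,3) by (rule tuple_area_le[OF _ g(1)]) (use n3 in auto)
qed

lemma Area_eq_regular_form:
  assumes "Area vs = regular_area n (Peri vs)"
  obtains g c a where "g = (\<lambda>z. z) \<or> g = (\<lambda>z. - cnj z)" "Im c > 0" "a \<noteq> 0"
    "\<And>i. disc c (g (V i)) = a * cis (2 * pi / real n) ^ i"
proof -
  obtain g s where g: "g = (\<lambda>z. z) \<and> s = (1::real) \<or> g = (\<lambda>z. - cnj z) \<and> s = -1" "closed_tuple n (g \<circ> V)"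
      "Area vs = tuple_area n (g \<circ> V)" "Peri vs = tuple_length n (g \<circ> V)"
    using oriented_tuple by metis
  have nz: "(g \<circ> V) i \<noteq> (g \<circ> V) (Suc i)" for i using g(1) V_Suc_neq[of i] by auto
  have n2: "n \<ge> 2" using n3 by simp
  obtain c a where "Im c > 0" "a \<noteq> 0" "\<And>i. disc c ((g \<circ> V) i) = a * cis (2 * pi / real n) ^ i"
    using tuple_area_eq_imp[OF n2 g(2) nz] assms unfolding g(3,4) by metis
  then show thesis using that[of g c a] g(1) by auto
qed

text \<open>Rotation about the centre shifts the vertices, so sides and the quotients that carry the
  interior angles agree at all vertices.\<close>

lemma regular_form_imp_regular:
  assumes g: "g = (\<lambda>z. z) \<or> g = (\<lambda>z. - cnj z)" and c: "Im c > 0" "a \<noteq> 0"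
    and ai: "\<And>i. disc c (g (V i)) = a * e ^ i" and e: "cmod e = 1"
  shows "regular_polygon n vs"
proof -
  have I: "Im (g (V i)) > 0" for i using g Im_V[of i] by auto
  have gd: "hyp_dist (g z) (g w) = hyp_dist z w" for z w using g hyp_dist_reflect by auto
  note m = disc_mob[OF c(1) c(1) e]
  have step: "mob c c e (g (V i)) = g (V (Suc i))" for i
  proof -
    have "disc c (mob c c e (g (V i))) = disc c (g (V (Suc i)))"
      unfolding m(2)[OF I] ai by simp
    then show ?thesis using disc_inj[OF c(1) m(1)[OF I] I] by blast
  qed
  have side: "hyp_dist (V (Suc i)) (V (Suc (Suc i))) = hyp_dist (V i) (V (Suc i))" for i
    using hyp_dist_mob[OF c(1) c(1) e I I, of i "Suc i"] unfolding step gd .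
  have quot: "disc (g (V (Suc i))) (g (V (Suc j))) / disc (g (V (Suc i))) (g (V (Suc k))) =
      disc (g (V i)) (g (V j)) / disc (g (V i)) (g (V k))" for i j k
  proof -
    obtain t where t: "t \<noteq> 0" "\<And>z. Im z > 0 \<Longrightarrow> disc (mob c c e (g (V i))) (mob c c e z) = t * disc (g (V i)) z"
      using disc_mob_mob[OF c(1) c(1) e I] by blast
    show ?thesis using t(1) t(2)[OF I, of j] t(2)[OF I, of k] unfolding step by simp
  qed
  define q where "q i = disc (V i) (V (i + (n - 1))) / disc (V i) (V (Suc i))" for i
  have q: "q (Suc i) = q i" for i
    using g
  proof
    assume "g = (\<lambda>z. z)"
    then show ?thesis using quot[of i "i + (n - 1)" "Suc i"] by (simp add: q_def)
  next
    \<comment> \<open>Reflection conjugates every quotient, so their equality is unaffected.\<close>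
    assume "g = (\<lambda>z. - cnj z)"
    then have "cnj (q (Suc i)) = cnj (q i)"
      using quot[of i "i + (n - 1)" "Suc i"] by (simp add: q_def disc_reflect)
    then show ?thesis by simp
  qed
  have q0: "q i = q 0" for i by (induction i) (simp_all add: q)
  have s0: "hyp_dist (V i) (V (Suc i)) = hyp_dist (V 0) (V 1)" for i by (induction i) (simp_all add: side)
  obtain s where s: "orientation s" by (rule orientation_exists)
  have "interior_angle vs i = (if s = 1 then Arg2pi (q 0) else 2 * pi - Arg2pi (q 0))" if "i < n" for i
  proof -
    have "interior_angle vs i = (if s = 1 then Arg2pi (q i) else 2 * pi - Arg2pi (q i))"
      unfolding q_def by (rule interior_angle_eq[OF that s])
    then show ?thesis unfolding q0[of i] .
  qed
  moreover have "side_length vs i = hyp_dist (V 0) (V 1)" if "i < n" for i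
    unfolding side_length_V[OF that] by (rule s0)
  ultimately show ?thesis using poly by (simp add: regular_polygon_def)
qed

text \<open>Equal sides give the quotient of the two neighbours modulus 1, and equal angles fix its
  argument. The quotient is therefore constant, a centre exists, and \<open>equiangular_turn\<close>
  identifies the root of unity.\<close>

lemma regular_imp_Area:
  assumes "regular_polygon n vs"
  shows "Area vs = regular_area n (Peri vs)"
proof -
  have n0: "n > 0" and n2: "n \<ge> 2" using n3 by auto
  obtain g s where g: "g = (\<lambda>z. z) \<and> s = (1::real) \<or> g = (\<lambda>z. - cnj z) \<and> s = -1" "closed_tuple n (g \<circ> V)"
      "Area vs = tuple_area n (g \<circ> V)" "Peri vs = tuple_length n (g \<circ> V)"
    and s: "orientation s"
    by (rule oriented_tuple) (rule that, assumption+)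
  have sides: "hyp_dist (V i) (V (Suc i)) = hyp_dist (V 0) (V (Suc 0))" for i
  proof -
    have im: "i mod n < n" using n0 by simp
    have "V (Suc (i mod n)) = V (Suc i)" by (simp add: V_def mod_Suc_eq)
    then have "hyp_dist (V i) (V (Suc i)) = side_length vs (i mod n)"
      unfolding side_length_V[OF im] by (simp only: V_mod)
    also have "\<dots> = side_length vs 0" using assms im n0 unfolding regular_polygon_def by blast
    finally show ?thesis unfolding side_length_V[OF n0] .
  qed
  let ?r = "cmod (disc (V 0) (V (Suc 0)))"
  have r: "cmod (disc (V i) (V (Suc i))) = ?r" for i
    using sides[of i] hyp_dist_eq_iff_radius[OF Im_V Im_V Im_V Im_V] by blast
  have r0: "?r > 0" using V_Suc_neq[of 0] disc_eq_0_iff[OF Im_V Im_V] by auto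
  define q where "q i = disc (V (Suc i)) (V i) / disc (V (Suc i)) (V (Suc (Suc i)))" for i
  have nz: "disc (V (Suc i)) (V (Suc (Suc i))) \<noteq> 0" for i using r[of "Suc i"] r0 by auto
  have nq: "cmod (q i) = 1" for i
  proof -
    have "cmod (disc (V (Suc i)) (V i)) = ?r"
      using norm_disc_sym[OF Im_V Im_V, of "Suc i" i] r[of i] by (rule trans)
    then show ?thesis unfolding q_def norm_divide r[of "Suc i"] using r0 by (simp only:) simp
  qed
  have angle: "interior_angle vs (Suc i mod n) = (if s = 1 then Arg2pi (q i) else 2 * pi - Arg2pi (q i))" for i
  proof -
    have "V (Suc i mod n) = V (Suc i)" by (rule V_mod)
    moreover have "V (Suc (Suc i mod n)) = V (Suc (Suc i))" by (simp add: V_def mod_Suc_eq)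
    moreover have "V (Suc i mod n + (n - 1)) = V i"
    proof -
      have "(Suc i mod n + (n - 1)) mod n = (Suc i + (n - 1)) mod n" by (simp add: mod_add_left_eq)
      also have "Suc i + (n - 1) = i + n" using n0 by simp
      finally show ?thesis by (simp add: V_def)
    qed
    ultimately show ?thesis
      using interior_angle_eq[OF _ s, of "Suc i mod n"] n0 by (simp only: q_def mod_less_divisor)
  qed
  have "Arg2pi (q i) = Arg2pi (q 0)" for i
  proof -
    have "interior_angle vs (Suc i mod n) = interior_angle vs (Suc 0 mod n)"
      using assms mod_less_divisor[OF n0] unfolding regular_polygon_def by blast
    then show ?thesis unfolding angle by (simp split: if_splits)
  qed
  then have q: "q i = q 0" for i using nq complex_norm_eq_1_exp by metis
  have q0: "q 0 \<noteq> 0" using nq[of 0] by auto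
  have "disc (V (Suc i)) (V i) = q 0 * disc (V (Suc i)) (V (Suc (Suc i)))" for i
    using q[of i] nz[of i] by (simp add: q_def field_simps)
  then obtain c a e where c: "Im c > 0" "a \<noteq> 0" "e ^ n = 1" "\<And>i. disc c (V i) = a * e ^ i"
    using equiangular_centre[of n V ?r "q 0", OF n0 Im_V V_add(1) r0 r q0] by metis
  have e: "e = cis (2 * pi * s / real n)" by (rule equiangular_turn[OF c s])
  show ?thesis
    unfolding g(3,4)
  proof (cases "s = 1")
    case True
    then have "g \<circ> V = V" using g(1) by auto
    moreover have "tuple_area n V = regular_area n (tuple_length n V)"
      by (rule regular_tuple_area[OF n2 Im_V _ c(1,2)]) (use c(4) e True in simp_all)
    ultimately show "tuple_area n (g \<circ> V) = regular_area n (tuple_length n (g \<circ> V))" by simp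
  next
    case False
    then have gs: "g = (\<lambda>z. - cnj z)" "s = -1" using g(1) by auto
    have "disc (- cnj c) ((g \<circ> V) i) = cnj a * cis (2 * pi / real n) ^ i" for i
    proof -
      have "cnj e = cis (2 * pi / real n)" unfolding e gs(2) by (simp add: cis_cnj)
      then show ?thesis unfolding gs(1) o_def disc_reflect c(4) by simp
    qed
    then show "tuple_area n (g \<circ> V) = regular_area n (tuple_length n (g \<circ> V))"
      by (intro regular_tuple_area[OF n2, of _ "- cnj c" "cnj a"]) (use closed_tupleD[OF g(2)] c in auto)
  qed
qed

end

text \<open>After reflection where necessary, both vertex tuples are orbits of the same rotation at
  the same radius. A Moebius map matching centres and first vertices thus matches all vertices;
  \<open>h\<close> is its own inverse, so it also undoes the reflection on the target.\<close>

lemma regular_forms_isometric: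
  assumes "hyp_polygon n vs" "hyp_polygon n ws" "Peri vs = Peri ws"
    and "Area vs = regular_area n (Peri vs)" "Area ws = regular_area n (Peri ws)"
  shows "isometric_polygons vs ws"
proof -
  interpret P: polygon n vs by unfold_locales (rule assms)
  interpret Q: polygon n ws by unfold_locales (rule assms)
  obtain g c a where g: "g = (\<lambda>z. z) \<or> g = (\<lambda>z. - cnj z)" "Im c > 0" "a \<noteq> 0"
    "\<And>i. disc c (g (P.V i)) = a * cis (2 * pi / real n) ^ i"
    using P.Area_eq_regular_form[OF assms(4)] by metis
  obtain h d b where h: "h = (\<lambda>z. z) \<or> h = (\<lambda>z. - cnj z)" "Im d > 0" "b \<noteq> 0"
    "\<And>i. disc d (h (Q.V i)) = b * cis (2 * pi / real n) ^ i"
    using Q.Area_eq_regular_form[OF assms(5)] by metis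
  have len: "tuple_length n (\<lambda>i. k (f i)) = tuple_length n f" if "k = (\<lambda>z. z) \<or> k = (\<lambda>z. - cnj z)" for k f
    using that by (auto simp: tuple_length_def hyp_dist_reflect)
  have Ig: "Im (g (P.V i)) > 0" and Ih: "Im (h (Q.V i)) > 0" for i
    using g(1) h(1) P.Im_V[of i] Q.Im_V[of i] by auto
  have "cmod a = cmod b"
  proof (rule regular_tuple_radius[where n = n and v = "\<lambda>i. g (P.V i)" and w = "\<lambda>i. h (Q.V i)" and c = c and d = d])
    show "tuple_length n (\<lambda>i. g (P.V i)) = tuple_length n (\<lambda>i. h (Q.V i))"
      using assms(3) unfolding len[OF g(1)] len[OF h(1)] P.Peri_eq Q.Peri_eq .
  qed (use P.n3 Ig Ih g h in simp_all)
  then have u: "cmod (b / a) = 1" using g(3) h(3) by (simp add: norm_divide)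
  let ?m = "mob c d (b / a)"
  define f where "f = h \<circ> (?m \<circ> g)"
  have iso: "hyp_isometry k" if "k = (\<lambda>z. z) \<or> k = (\<lambda>z. - cnj z)" for k
    using that hyp_isometry_reflect by (auto simp: hyp_isometry_def bij_betw_def)
  have f: "hyp_isometry f"
    unfolding f_def using iso g(1) h(1) hyp_isometry_mob[OF g(2) h(2) u] by (intro hyp_isometry_comp) auto
  have fV: "f (P.V i) = Q.V i" for i
  proof -
    have "disc d (?m (g (P.V i))) = disc d (h (Q.V i))"
      unfolding disc_mob(2)[OF g(2) h(2) u Ig] g(4) h(4) using g(3) by simp
    then have "?m (g (P.V i)) = h (Q.V i)"
      using disc_inj[OF h(2) disc_mob(1)[OF g(2) h(2) u Ig] Ih] by blast
    then show ?thesis using h(1) by (auto simp: f_def)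
  qed
  have "map f vs = ws"
    by (rule nth_equalityI) (use P.len Q.len fV P.V_less Q.V_less in auto)
  then show ?thesis
    unfolding isometric_polygons_def using f P.isometry_polygon(2)[OF f] by auto
qed

theorem theorem1p11:
  fixes n k :: nat and P :: "nat \<Rightarrow> complex list" and T :: real
  assumes "n \<ge> 3" and "k \<ge> 1"
    and "\<And>i. i \<in> {1..k} \<Longrightarrow> hyp_polygon n (P i)"
    and "(\<Sum>i=1..k. Peri (P i)) = T"
    and "\<And>i. i \<in> {1..k} \<Longrightarrow>
           Peri (P i) > 2 * real n * arcosh (sqrt (1 + sin (pi / real n)))"
  shows
    "(\<Sum>i=1..k. Area (P i)) \<le>
       real k * (real n - 2) * pi
         - 2 * real n * real k *
             arcsin (cos (pi / real n) / cosh (T / (2 * real n * real k))) \<and>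
     ((\<Sum>i=1..k. Area (P i)) =
       real k * (real n - 2) * pi
         - 2 * real n * real k *
             arcsin (cos (pi / real n) / cosh (T / (2 * real n * real k)))
      \<longleftrightarrow>
      (\<exists>Q. regular_polygon n Q \<and> Peri Q = T / real k \<and>
           (\<forall>i\<in>{1..k}. isometric_polygons (P i) Q)))"
proof -
  have n2: "n \<ge> 2" using assms(1) by simp
  have A: "finite {1..k}" "{1..k} \<noteq> {}" and card: "card {1..k} = k" using assms(2) by auto
  have loc: "polygon n (P i)" if "i \<in> {1..k}" for i
    by (rule polygon.intro[OF assms(3)[OF that]])
  have rhs: "real k * (real n - 2) * pi
         - 2 * real n * real k * arcsin (cos (pi / real n) / cosh (T / (2 * real n * real k))) =
      real k * regular_area n (T / real k)"
    unfolding regular_area_eq[OF n2] by (simp add: algebra_simps)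
  note J = sum_regular_area_le[OF assms(1) A assms(4,5), unfolded card]
  have each: "Area (P i) \<le> regular_area n (Peri (P i))" if "i \<in> {1..k}" for i
    by (rule polygon.Area_le_regular[OF loc[OF that]])
  then have sum: "(\<Sum>i=1..k. Area (P i)) \<le> (\<Sum>i=1..k. regular_area n (Peri (P i)))" by (rule sum_mono)
  show ?thesis
    unfolding rhs
  proof (intro conjI iffI)
    show "(\<Sum>i=1..k. Area (P i)) \<le> real k * regular_area n (T / real k)" using sum J(1) by linarith
  next
    assume eq: "(\<Sum>i=1..k. Area (P i)) = real k * regular_area n (T / real k)"
    \<comment> \<open>The sum of the regular areas lies between the two equal outer terms, so the
      isoperimetric inequalities and Jensen's inequality are all equalities.\<close>
    then have "(\<Sum>i=1..k. regular_area n (Peri (P i))) = real k * regular_area n (T / real k)"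
      using sum J(1) by linarith
    then have peri: "Peri (P i) = T / real k" if "i \<in> {1..k}" for i using J(2) that by blast
    have area: "Area (P i) = regular_area n (Peri (P i))" if "i \<in> {1..k}" for i
    proof (rule ccontr)
      assume "Area (P i) \<noteq> regular_area n (Peri (P i))"
      then have "(\<Sum>i=1..k. Area (P i)) < (\<Sum>i=1..k. regular_area n (Peri (P i)))"
        using each that by (intro sum_strict_mono_ex1) (auto simp: order_less_le)
      then show False using eq J(1) by linarith
    qed
    \<comment> \<open>The first polygon serves as the regular model \<open>Q\<close>.\<close>
    have one: "1 \<in> {1..k}" using assms(2) by simp
    interpret Q: polygon n "P 1" by (rule loc[OF one])
    obtain g c a where "g = (\<lambda>z. z) \<or> g = (\<lambda>z. - cnj z)" "Im c > 0" "a \<noteq> 0"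
      "\<And>i. disc c (g (Q.V i)) = a * cis (2 * pi / real n) ^ i"
      using Q.Area_eq_regular_form[OF area[OF one]] by metis
    then have "regular_polygon n (P 1)" by (rule Q.regular_form_imp_regular) simp
    moreover have "isometric_polygons (P i) (P 1)" if "i \<in> {1..k}" for i
      by (rule regular_forms_isometric[OF assms(3)[OF that] assms(3)[OF one] _ area[OF that] area[OF one]])
        (simp only: peri[OF that] peri[OF one])
    ultimately show "\<exists>Q. regular_polygon n Q \<and> Peri Q = T / real k \<and> (\<forall>i\<in>{1..k}. isometric_polygons (P i) Q)"
      using peri[OF one] by blast
  next
    assume "\<exists>Q. regular_polygon n Q \<and> Peri Q = T / real k \<and> (\<forall>i\<in>{1..k}. isometric_polygons (P i) Q)"
    then obtain Q where Q: "regular_polygon n Q" "Peri Q = T / real k" "\<And>i. i \<in> {1..k} \<Longrightarrow> isometric_polygons (P i) Q"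
      by blast
    interpret Q: polygon n Q by unfold_locales (use Q(1) in \<open>simp add: regular_polygon_def\<close>)
    have "Area (P i) = regular_area n (T / real k)" if "i \<in> {1..k}" for i
      using isometric_polygons_Area[OF assms(3)[OF that] Q(3)[OF that]] Q.regular_imp_Area[OF Q(1)] Q(2) by simp
    then show "(\<Sum>i=1..k. Area (P i)) = real k * regular_area n (T / real k)" by simp
  qed
qed

end
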